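(* Let $M$ be a connected, compact Riemannian manifold, let $f:M\to\mathbb{R}$ be a Morse function with negative gradient flow $\phi_t$, and let $p$ be a critical point of $f$. For every $x\in W^s(p)$ and every $v_x\in T_xW^s(p)$, there exists $c>0$ such that $\big|\mathrm{d}\phi_t|_x(v_x)\big|=O(e^{-ct})$ as $t\to+\infty$.
   Context: Manifolds are smooth and without boundary. A Morse function on $M$ is a smooth function $f:M\to\mathbb{R}$ all of whose critical points are non-degenerate (the Hessian of $f$ at each critical point is non-degenerate). The gradient $\nabla f$ is taken with respect to the Riemannian metric $g$ of $M$. The negative gradient flow is the map $\Phi:M\times\mathbb{R}\to M$ with $\frac{\partial}{\partial t}\Phi(x,t)=-\nabla f(\Phi(x,t))$ and $\Phi(x,0)=x$; write $\phi_t=\Phi(\cdot,t)$, and $\mathrm{d}\phi_t|_x:T_xM\to T_{\phi_t(x)}M$ for its differential at $x$. The stable manifold of a critical point $p$ is $W^s(p)=\{x\in M\mid \lim_{t\to+\infty}\phi_t(x)=p\}$; it is an (injectively immersed) submanifold of $M$ diffeomorphic to a Euclidean space of dimension $\dim M-\mathrm{ind}_f(p)$, where $\mathrm{ind}_f(p)$ is the number of negative eigenvalues of the Hessian of $f$ at $p$. $T_xW^s(p)\subset T_xM$ is its tangent space at $x$. The norm $|\cdot|$ is that of the Riemannian metric $g$ on $T_{\phi_t(x)}M$. *)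

theory Defs
  imports "HOL-Analysis.Analysis" "HOL-Library.Landau_Symbols"
begin

text \<open>
  A smooth manifold is a Hausdorff, second countable type \<open>'m\<close> with a smooth atlas \<open>A\<close>. The charts
  take values in a linear subspace \<open>E\<close> of a Euclidean space \<open>'e\<close>; the dimension of the manifold is
  \<open>dim E\<close>. A subspace is used rather than the whole of \<open>'e\<close> because every type in
  \<open>euclidean_space\<close> has positive dimension, which would exclude zero-dimensional manifolds.
\<close>

section \<open>Smooth functions on subsets of a Euclidean space\<close>

fun Ck_on :: "nat \<Rightarrow> 'a::euclidean_space set \<Rightarrow> ('a \<Rightarrow> 'b::real_normed_vector) \<Rightarrow> bool" where
  "Ck_on 0 U h \<longleftrightarrow> continuous_on U h"
| "Ck_on (Suc k) U h \<longleftrightarrow>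
     (\<forall>x\<in>U. h differentiable (at x)) \<and> (\<forall>v. Ck_on k U (\<lambda>x. frechet_derivative h (at x) v))"

text \<open>
  On an arbitrary set, smoothness means local extendability to a smooth function on an open set;
  this is needed for functions on (relatively open subsets of) a linear subspace.
\<close>

definition smooth_on :: "'a::euclidean_space set \<Rightarrow> ('a \<Rightarrow> 'b::real_normed_vector) \<Rightarrow> bool" where
  "smooth_on S h \<longleftrightarrow>
     (\<forall>x\<in>S. \<exists>U H. open U \<and> x \<in> U \<and> (\<forall>k. Ck_on k U H) \<and> (\<forall>y\<in>U \<inter> S. H y = h y))"

section \<open>Manifolds\<close>

text \<open>A chart is its domain together with the coordinate map (irrelevant outside the domain).\<close>

type_synonym ('m, 'e) chart = "'m set \<times> ('m \<Rightarrow> 'e)"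

abbreviation chart_dom :: "('m, 'e) chart \<Rightarrow> 'm set" where
  "chart_dom \<equiv> fst"

abbreviation coord :: "('m, 'e) chart \<Rightarrow> 'm \<Rightarrow> 'e" where
  "coord \<equiv> snd"

definition chart_image :: "('m, 'e) chart \<Rightarrow> 'e set" where
  "chart_image c = coord c ` chart_dom c"

definition chart_inv :: "('m, 'e) chart \<Rightarrow> 'e \<Rightarrow> 'm" where
  "chart_inv c = inv_into (chart_dom c) (coord c)"

definition is_chart :: "'e::euclidean_space set \<Rightarrow> ('m::topological_space, 'e) chart \<Rightarrow> bool" where
  "is_chart E c \<longleftrightarrow>
     open (chart_dom c) \<and> openin (top_of_set E) (chart_image c) \<and>
     homeomorphism (chart_dom c) (chart_image c) (coord c) (chart_inv c)"

definition smooth_manifold ::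
    "'e::euclidean_space set \<Rightarrow> ('m::{t2_space, second_countable_topology}, 'e) chart set \<Rightarrow> bool" where
  "smooth_manifold E A \<longleftrightarrow>
     subspace E \<and> (\<forall>c\<in>A. is_chart E c) \<and> (\<Union>c\<in>A. chart_dom c) = UNIV \<and>
     (\<forall>c\<in>A. \<forall>c'\<in>A. smooth_on (coord c ` (chart_dom c \<inter> chart_dom c')) (coord c' \<circ> chart_inv c))"

text \<open>
  For each point \<open>x\<close> a preferred chart around \<open>x\<close> is chosen, and the tangent space at \<open>x\<close> is
  identified with \<open>E\<close> by means of it: \<open>v \<in> E\<close> stands for the tangent vector whose coordinates in
  the chart \<open>chart_at A x\<close> are \<open>v\<close>. Derivatives of coordinate expressions are taken within \<open>E\<close>
  (or within the subspace \<open>V\<close> below) and are determined on vectors of that subspace.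
\<close>

definition chart_at :: "('m, 'e) chart set \<Rightarrow> 'm \<Rightarrow> ('m, 'e) chart" where
  "chart_at A x = (SOME c. c \<in> A \<and> x \<in> chart_dom c)"

text \<open>
  The tangent vector at \<open>chart_inv c y\<close> with coordinates \<open>a\<close> in an arbitrary chart \<open>c\<close> around this point.
\<close>

definition tangent_of ::
    "'e::euclidean_space set \<Rightarrow> ('m, 'e) chart set \<Rightarrow> ('m, 'e) chart \<Rightarrow> 'e \<Rightarrow> 'e \<Rightarrow> 'e" where
  "tangent_of E A c y a =
     frechet_derivative (coord (chart_at A (chart_inv c y)) \<circ> chart_inv c) (at y within E) a"

definition differential ::
    "'e::euclidean_space set \<Rightarrow> ('m, 'e) chart set \<Rightarrow> ('m \<Rightarrow> 'm) \<Rightarrow> 'm \<Rightarrow> 'e \<Rightarrow> 'e" where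
  "differential E A F x v =
     frechet_derivative (coord (chart_at A (F x)) \<circ> F \<circ> chart_inv (chart_at A x))
       (at (coord (chart_at A x) x) within E) v"

definition has_velocity ::
    "('m::topological_space, 'e::euclidean_space) chart set \<Rightarrow> (real \<Rightarrow> 'm) \<Rightarrow> 'e \<Rightarrow> real \<Rightarrow> bool" where
  "has_velocity A \<gamma> w t \<longleftrightarrow>
     isCont \<gamma> t \<and> ((coord (chart_at A (\<gamma> t)) \<circ> \<gamma>) has_vector_derivative w) (at t)"

section \<open>Riemannian metrics\<close>

definition riemannian_metric ::
    "'e::euclidean_space set \<Rightarrow> ('m, 'e) chart set \<Rightarrow> ('m \<Rightarrow> 'e \<Rightarrow> 'e \<Rightarrow> real) \<Rightarrow> bool" where
  "riemannian_metric E A g \<longleftrightarrow>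
     (\<forall>x. \<forall>a\<in>E. \<forall>b\<in>E. g x a b = g x b a) \<and>
     (\<forall>x. \<forall>a\<in>E. \<forall>a'\<in>E. \<forall>b\<in>E. g x (a + a') b = g x a b + g x a' b) \<and>
     (\<forall>x r. \<forall>a\<in>E. \<forall>b\<in>E. g x (r *\<^sub>R a) b = r * g x a b) \<and>
     (\<forall>x. \<forall>a\<in>E. a \<noteq> 0 \<longrightarrow> g x a a > 0) \<and>
     (\<forall>c\<in>A. \<forall>a\<in>E. \<forall>b\<in>E. smooth_on (chart_image c)
        (\<lambda>y. g (chart_inv c y) (tangent_of E A c y a) (tangent_of E A c y b)))"

definition tangent_norm :: "('m \<Rightarrow> 'e \<Rightarrow> 'e \<Rightarrow> real) \<Rightarrow> 'm \<Rightarrow> 'e \<Rightarrow> real" where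
  "tangent_norm g x v = sqrt (g x v v)"

section \<open>Morse functions\<close>

definition smooth_function ::
    "('m, 'e::euclidean_space) chart set \<Rightarrow> ('m \<Rightarrow> real) \<Rightarrow> bool" where
  "smooth_function A f \<longleftrightarrow> (\<forall>c\<in>A. smooth_on (chart_image c) (f \<circ> chart_inv c))"

definition dfun ::
    "'e::euclidean_space set \<Rightarrow> ('m, 'e) chart set \<Rightarrow> ('m \<Rightarrow> real) \<Rightarrow> 'm \<Rightarrow> 'e \<Rightarrow> real" where
  "dfun E A f x v =
     frechet_derivative (f \<circ> chart_inv (chart_at A x)) (at (coord (chart_at A x) x) within E) v"

definition critical_point ::
    "'e::euclidean_space set \<Rightarrow> ('m, 'e) chart set \<Rightarrow> ('m \<Rightarrow> real) \<Rightarrow> 'm \<Rightarrow> bool" where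
  "critical_point E A f p \<longleftrightarrow> (\<forall>v\<in>E. dfun E A f p v = 0)"

text \<open>
  Second derivative in the preferred chart; only used at critical points, where it does not depend
  on the chart.
\<close>

definition hessian ::
    "'e::euclidean_space set \<Rightarrow> ('m, 'e) chart set \<Rightarrow> ('m \<Rightarrow> real) \<Rightarrow> 'm \<Rightarrow> 'e \<Rightarrow> 'e \<Rightarrow> real" where
  "hessian E A f p a b =
     frechet_derivative
       (\<lambda>y. frechet_derivative (f \<circ> chart_inv (chart_at A p)) (at y within E) a)
       (at (coord (chart_at A p) p) within E) b"

definition morse ::
    "'e::euclidean_space set \<Rightarrow> ('m, 'e) chart set \<Rightarrow> ('m \<Rightarrow> real) \<Rightarrow> bool" where
  "morse E A f \<longleftrightarrow>
     smooth_function A f \<and>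
     (\<forall>p. critical_point E A f p \<longrightarrow>
        (\<forall>a\<in>E. (\<forall>b\<in>E. hessian E A f p a b = 0) \<longrightarrow> a = 0))"

text \<open>
  Eigenspaces of the Hessian, seen through the metric as a self-adjoint endomorphism of the tangent
  space. The index counts the negative eigenvalues with multiplicity.
\<close>

definition hessian_eigenspace ::
    "'e::euclidean_space set \<Rightarrow> ('m, 'e) chart set \<Rightarrow> ('m \<Rightarrow> 'e \<Rightarrow> 'e \<Rightarrow> real) \<Rightarrow> ('m \<Rightarrow> real) \<Rightarrow>
     'm \<Rightarrow> real \<Rightarrow> 'e set" where
  "hessian_eigenspace E A g f p l = {a\<in>E. \<forall>b\<in>E. hessian E A f p a b = l * g p a b}"

definition morse_index ::
    "'e::euclidean_space set \<Rightarrow> ('m, 'e) chart set \<Rightarrow> ('m \<Rightarrow> 'e \<Rightarrow> 'e \<Rightarrow> real) \<Rightarrow> ('m \<Rightarrow> real) \<Rightarrow>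
     'm \<Rightarrow> nat" where
  "morse_index E A g f p =
     (\<Sum>l | l < 0 \<and> hessian_eigenspace E A g f p l \<noteq> {0}. dim (hessian_eigenspace E A g f p l))"

section \<open>The negative gradient flow\<close>

definition gradient ::
    "'e::euclidean_space set \<Rightarrow> ('m, 'e) chart set \<Rightarrow> ('m \<Rightarrow> 'e \<Rightarrow> 'e \<Rightarrow> real) \<Rightarrow> ('m \<Rightarrow> real) \<Rightarrow>
     'm \<Rightarrow> 'e" where
  "gradient E A g f x = (THE w. w \<in> E \<and> (\<forall>v\<in>E. g x w v = dfun E A f x v))"

definition negative_gradient_flow ::
    "'e::euclidean_space set \<Rightarrow> ('m::topological_space, 'e) chart set \<Rightarrow>
     ('m \<Rightarrow> 'e \<Rightarrow> 'e \<Rightarrow> real) \<Rightarrow> ('m \<Rightarrow> real) \<Rightarrow> ('m \<Rightarrow> real \<Rightarrow> 'm) \<Rightarrow> bool" where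
  "negative_gradient_flow E A g f \<Phi> \<longleftrightarrow>
     (\<forall>x. \<Phi> x 0 = x) \<and>
     (\<forall>x t. has_velocity A (\<Phi> x) (- gradient E A g f (\<Phi> x t)) t)"

section \<open>Stable manifolds and their tangent spaces\<close>

definition stable_manifold :: "('m::topological_space \<Rightarrow> real \<Rightarrow> 'm) \<Rightarrow> 'm \<Rightarrow> 'm set" where
  "stable_manifold \<Phi> p = {x. (\<Phi> x \<longlongrightarrow> p) at_top}"

text \<open>
  An injective immersion of the Euclidean space \<open>V\<close> into the manifold with image \<open>S\<close>, i.e. a
  diffeomorphism of \<open>V\<close> with the injectively immersed submanifold \<open>S\<close>.
\<close>

definition immersed_parametrization ::
    "('m::topological_space, 'e::euclidean_space) chart set \<Rightarrow> 'e set \<Rightarrow> ('e \<Rightarrow> 'm) \<Rightarrow> 'm set \<Rightarrow> bool" where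
  "immersed_parametrization A V \<iota> S \<longleftrightarrow>
     subspace V \<and> \<iota> ` V = S \<and> inj_on \<iota> V \<and> continuous_on V \<iota> \<and>
     (\<forall>c\<in>A. smooth_on {y\<in>V. \<iota> y \<in> chart_dom c} (coord c \<circ> \<iota>)) \<and>
     (\<forall>y\<in>V. inj_on (frechet_derivative (coord (chart_at A (\<iota> y)) \<circ> \<iota>) (at y within V)) V)"

text \<open>
  The tangent space at \<open>x\<close> of the stable manifold, an injectively immersed Euclidean space of
  dimension \<open>dim E - morse_index E A g f p\<close>: the image of the differential of its parametrization.
\<close>

definition stable_tangent_space ::
    "'e::euclidean_space set \<Rightarrow> ('m::topological_space, 'e) chart set \<Rightarrow>
     ('m \<Rightarrow> 'e \<Rightarrow> 'e \<Rightarrow> real) \<Rightarrow> ('m \<Rightarrow> real) \<Rightarrow> ('m \<Rightarrow> real \<Rightarrow> 'm) \<Rightarrow> 'm \<Rightarrow> 'm \<Rightarrow> 'e set" where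
  "stable_tangent_space E A g f \<Phi> p x =
     {v. \<exists>V \<iota> y u. immersed_parametrization A V \<iota> (stable_manifold \<Phi> p) \<and>
           dim V + morse_index E A g f p = dim E \<and>
           y \<in> V \<and> \<iota> y = x \<and> u \<in> V \<and>
           v = frechet_derivative (coord (chart_at A x) \<circ> \<iota>) (at y within V) u}"

end

theory Submission
  imports Defs
begin

text \<open>
Let \<open>v\<close> be tangent to \<open>W\<^sup>s(p)\<close> at \<open>x\<close>. It is the velocity of a curve \<open>x\<^sub>s\<close> of points of
\<open>W\<^sup>s(p)\<close> with \<open>x\<^sub>0 = x\<close>, so in a chart around \<open>p\<close> the vector \<open>d\<phi>\<^sub>t(v)\<close> is the limit of the
difference quotients of \<open>\<phi>\<^sub>t(x\<^sub>s)\<close> at \<open>s = 0\<close>. Therefore it suffices that any two points of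
\<open>W\<^sup>s(p)\<close> whose orbits have come close to \<open>p\<close> approach each other at a uniform exponential rate:
dividing that estimate by \<open>s\<close> gives the estimate for \<open>d\<phi>\<^sub>t(v)\<close>.

The rate comes from a quadratic Lyapunov function. Let \<open>H\<close> be the Hessian of \<open>f\<close> at \<open>p\<close> and let
\<open>\<delta>(t)\<close> be the difference, in the chart, of two orbits that stay near \<open>p\<close>. The linearisation of
\<open>-\<nabla>f\<close> at \<open>p\<close> is \<open>-g\<^sup>-\<^sup>1H\<close>, and for the linearised equation the derivative of \<open>H(\<delta>, \<delta>)\<close> is
\<open>-2 |g\<^sup>-\<^sup>1H\<delta>|\<^sup>2\<close>. As \<open>H\<close> is non-degenerate, the derivative of \<open>H(\<delta>, \<delta>)\<close> is at most
\<open>-m |\<delta>|\<^sup>2\<close> for the nonlinear equation too, close enough to \<open>p\<close> (\<open>hyperbolic_estimates\<close>). For small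
\<open>\<kappa> > 0\<close> the function \<open>H(\<delta>, \<delta>) - \<kappa> |\<delta>|\<^sup>2\<close> is decreasing as well. On the stable manifold
\<open>\<delta> \<rightarrow> 0\<close>, so this function is non-negative; hence \<open>H(\<delta>, \<delta>)\<close> is comparable with \<open>|\<delta>|\<^sup>2\<close>
along these orbits and decays exponentially (\<open>exponential_contraction\<close>). Thus the positivity of \<open>H\<close> in the
stable directions is a consequence of the convergence to \<open>p\<close>.

That orbits of \<open>W\<^sup>s(p)\<close> stay near \<open>p\<close> once they have come close uses \<open>f\<close>: it is decreasing along
orbits and at least \<open>f(p)\<close> on \<open>W\<^sup>s(p)\<close>, and \<open>f + \<kappa> |y - p|\<^sup>2\<close> is decreasing near \<open>p\<close>
(\<open>stable_orbit_trapped\<close>). So the time after which \<open>\<phi>\<^sub>t(x\<^sub>s)\<close> remains near \<open>p\<close> can be chosen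
independently of \<open>s\<close>, for small \<open>s\<close>.

That \<open>\<phi>\<^sub>t\<close> is differentiable follows from an estimate of second differences: if the map \<open>F\<close> is \<open>\<phi>\<^sub>t\<close> in charts, then
\<open>F(z+h+k) - F(z+h) - F(z+k) + F(z)\<close> satisfies a linear differential inequality in \<open>t\<close> whose
inhomogeneity is quadratic in \<open>(h, k)\<close>. By Gronwall's inequality it is \<open>O((|h| + |k|)\<^sup>2)\<close>, and a
Lipschitz map with this property is differentiable (\<open>approximately_additive_has_derivative\<close>).
Accordingly the regularity of \<open>-\<nabla>f\<close> in a chart is used in the form of a bound on second
differences (\<open>second_lip\<close>), which is derived directly from the equation
\<open>g(X, \<cdot>) = -df\<close> for \<open>X = -\<nabla>f\<close>.
\<close>

section \<open>Maps with controlled second differences\<close>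

text \<open>
For a \<open>C\<^sup>2\<close> map the second difference over a quadrilateral is controlled by the second
difference of its vertices and, for the curvature of the map, by the product of the two sums of
opposite side lengths.
\<close>

definition quad :: "'a::real_normed_vector \<Rightarrow> 'a \<Rightarrow> 'a \<Rightarrow> 'a \<Rightarrow> real" where
  "quad a b c d = norm (a - b - c + d) + (norm (a - b) + norm (c - d)) * (norm (a - c) + norm (b - d))"

text \<open>
One constant serves as bound, Lipschitz constant and constant for second differences. The class
contains the \<open>C\<^sup>2\<close> maps on compact convex sets and is passed on from the coefficients of a coercive
linear equation to its solution.
\<close>

definition second_lip :: "real \<Rightarrow> 'a set \<Rightarrow> ('a::real_normed_vector \<Rightarrow> 'b::real_normed_vector) \<Rightarrow> bool" where
  "second_lip M S h \<longleftrightarrow> 0 \<le> M \<and> (\<forall>a\<in>S. norm (h a) \<le> M) \<and>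
     (\<forall>a\<in>S. \<forall>b\<in>S. norm (h a - h b) \<le> M * norm (a - b)) \<and>
     (\<forall>a\<in>S. \<forall>b\<in>S. \<forall>c\<in>S. \<forall>d\<in>S. norm (h a - h b - h c + h d) \<le> M * quad a b c d)"

lemma quad_nonneg: "0 \<le> quad a b c d"
  by (simp add: quad_def)

lemma second_lip_nonneg: "second_lip M S h \<Longrightarrow> 0 \<le> M"
  by (simp add: second_lip_def)

lemma second_lip_bound: "second_lip M S h \<Longrightarrow> a \<in> S \<Longrightarrow> norm (h a) \<le> M"
  by (simp add: second_lip_def)

lemma second_lip_lipschitz:
  "second_lip M S h \<Longrightarrow> a \<in> S \<Longrightarrow> b \<in> S \<Longrightarrow> norm (h a - h b) \<le> M * norm (a - b)"
  by (simp add: second_lip_def)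

lemma second_lip_quad:
  "second_lip M S h \<Longrightarrow> a \<in> S \<Longrightarrow> b \<in> S \<Longrightarrow> c \<in> S \<Longrightarrow> d \<in> S \<Longrightarrow>
     norm (h a - h b - h c + h d) \<le> M * quad a b c d"
  by (simp add: second_lip_def)

lemma second_lip_mono:
  assumes "second_lip M S h" "M \<le> N" "T \<subseteq> S" "\<And>y. y \<in> T \<Longrightarrow> h' y = h y"
  shows "second_lip N T h'"
proof -
  have *: "x \<le> M * y \<Longrightarrow> 0 \<le> y \<Longrightarrow> x \<le> N * y" for x y :: real
    using mult_right_mono[OF assms(2), of y] by linarith
  show ?thesis
    unfolding second_lip_def
  proof (intro conjI ballI)
    show "0 \<le> N" using assms(2) second_lip_nonneg[OF assms(1)] by simp
    fix a assume "a \<in> T"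
    then have "a \<in> S" using assms by auto
    have "norm (h a) \<le> M" using second_lip_bound[OF assms(1) \<open>a \<in> S\<close>] .
    then show "norm (h' a) \<le> N" using assms \<open>a \<in> T\<close> by simp
    fix b assume "b \<in> T"
    then have "b \<in> S" using assms by auto
    show "norm (h' a - h' b) \<le> N * norm (a - b)"
      using *[OF second_lip_lipschitz[OF assms(1) \<open>a \<in> S\<close> \<open>b \<in> S\<close>]] assms(4) \<open>a \<in> T\<close> \<open>b \<in> T\<close> by simp
    fix c d assume "c \<in> T" "d \<in> T"
    then have cd: "c \<in> S" "d \<in> S" using assms by auto
    show "norm (h' a - h' b - h' c + h' d) \<le> N * quad a b c d"
      using *[OF second_lip_quad[OF assms(1) \<open>a \<in> S\<close> \<open>b \<in> S\<close> cd] quad_nonneg]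
         assms(4) \<open>a \<in> T\<close> \<open>b \<in> T\<close> \<open>c \<in> T\<close> \<open>d \<in> T\<close> by simp
  qed
qed

lemma norm_linear_le_sum_Basis:
  fixes L :: "'a::euclidean_space \<Rightarrow> 'b::real_normed_vector"
  assumes "linear L" "\<And>i. i \<in> Basis \<Longrightarrow> norm (L i) \<le> B i"
  shows "norm (L v) \<le> (\<Sum>i\<in>Basis. B i) * norm v"
proof -
  have "L v = L (\<Sum>i\<in>Basis. (v \<bullet> i) *\<^sub>R i)" by (simp add: euclidean_representation)
  also have "\<dots> = (\<Sum>i\<in>Basis. (v \<bullet> i) *\<^sub>R L i)"
    using assms(1) by (simp add: linear_sum linear_cmul)
  finally have "norm (L v) \<le> (\<Sum>i\<in>Basis. norm ((v \<bullet> i) *\<^sub>R L i))" by (metis norm_sum)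
  also have "\<dots> \<le> (\<Sum>i\<in>Basis. norm v * B i)"
    by (rule sum_mono) (auto intro!: mult_mono Basis_le_norm assms)
  finally show ?thesis by (simp add: sum_distrib_left sum_distrib_right mult.commute)
qed

lemma subspace_projection:
  fixes E :: "'e::euclidean_space set"
  assumes "subspace E"
  obtains P K where "linear P" "\<And>v. P v \<in> E" "\<And>v. v \<in> E \<Longrightarrow> P v = v" "K \<ge> 1" "\<And>v. norm (P v) \<le> K * norm v"
proof -
  have "linear (\<lambda>x::'e. x)" by (rule linear_ident)
  from linear_exists_left_inverse_on[OF this assms]
  obtain P where P: "linear P" "range P \<subseteq> E" "\<And>v. v \<in> E \<Longrightarrow> P v = v"
    by (auto simp: inj_on_def)
  obtain B where B: "\<And>v. norm (P v) \<le> B * norm v" using linear_bounded[OF P(1)] by blast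
  have "norm (P v) \<le> max 1 B * norm v" for v
    using B[of v] mult_right_mono[of B "max 1 B" "norm v"] by simp
  then show ?thesis using that[of P "max 1 B"] P by auto
qed

lemma Ck_on_differentiable:
  "Ck_on (Suc k) U h \<Longrightarrow> x \<in> U \<Longrightarrow> (h has_derivative frechet_derivative h (at x)) (at x)"
  by (simp add: frechet_derivative_works)

lemma Ck_on_SucD: "Ck_on (Suc k) U h \<Longrightarrow> Ck_on k U h"
proof (induction k arbitrary: h)
  case 0
  then show ?case
    by (auto intro!: continuous_at_imp_continuous_on differentiable_imp_continuous_within)
qed simp

lemma Ck_on_subset: "Ck_on k V K \<Longrightarrow> V' \<subseteq> V \<Longrightarrow> Ck_on k V' K"
  by (induction k arbitrary: K) (auto intro: continuous_on_subset)

lemma Ck_on_1_derivative_bounded: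
  fixes h :: "'a::euclidean_space \<Rightarrow> 'b::real_normed_vector"
  assumes "Ck_on 1 U h" "K \<subseteq> U" "compact K"
  shows "\<exists>M\<ge>0. \<forall>x\<in>K. \<forall>v. norm (frechet_derivative h (at x) v) \<le> M * norm v"
proof -
  have "\<exists>B. \<forall>x\<in>K. norm (frechet_derivative h (at x) i) \<le> B" for i
  proof -
    have "continuous_on K (\<lambda>x. frechet_derivative h (at x) i)"
      using assms(1,2) by (auto intro: continuous_on_subset)
    from compact_imp_bounded[OF compact_continuous_image[OF this assms(3)]]
    show ?thesis by (auto simp: bounded_iff)
  qed
  then obtain B where B: "\<And>i x. x \<in> K \<Longrightarrow> norm (frechet_derivative h (at x) i) \<le> B i" by metis
  have 1: "norm (frechet_derivative h (at x) v) \<le> (\<Sum>i\<in>Basis. B i) * norm v" if "x \<in> K" for x v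
  proof (rule norm_linear_le_sum_Basis)
    show "linear (frechet_derivative h (at x))"
      using assms that by (auto intro!: linear_frechet_derivative)
  qed (use B that in auto)
  show ?thesis
  proof (intro exI[of _ "\<bar>\<Sum>i\<in>Basis. B i\<bar>"] conjI ballI allI)
    fix x v :: 'a assume "x \<in> K"
    have "(\<Sum>i\<in>Basis. B i) * norm v \<le> \<bar>\<Sum>i\<in>Basis. B i\<bar> * norm v"
      by (rule mult_right_mono) auto
    then show "norm (frechet_derivative h (at x) v) \<le> \<bar>\<Sum>i\<in>Basis. B i\<bar> * norm v"
      using 1[OF \<open>x \<in> K\<close>, of v] by simp
  qed auto
qed

lemma Ck_on_1_lipschitz:
  fixes h :: "'a::euclidean_space \<Rightarrow> 'b::real_normed_vector"
  assumes "Ck_on 1 U h" "K \<subseteq> U" "compact K" "convex K"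
  shows "\<exists>M\<ge>0. \<forall>x\<in>K. \<forall>y\<in>K. norm (h x - h y) \<le> M * norm (x - y)"
proof -
  obtain M where M: "M \<ge> 0" "\<And>x v. x \<in> K \<Longrightarrow> norm (frechet_derivative h (at x) v) \<le> M * norm v"
    using Ck_on_1_derivative_bounded[OF assms(1-3)] by auto
  have "norm (h x - h y) \<le> M * norm (x - y)" if "x \<in> K" "y \<in> K" for x y
  proof (rule differentiable_bound[OF assms(4) _ _ that])
    fix z assume "z \<in> K"
    have "Ck_on (Suc 0) U h" using assms(1) by simp
    then show "(h has_derivative frechet_derivative h (at z)) (at z within K)"
      using \<open>z \<in> K\<close> assms(2) by (blast intro: has_derivative_at_withinI[OF Ck_on_differentiable])
    show "onorm (frechet_derivative h (at z)) \<le> M"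
      by (rule onorm_bound) (use M \<open>z \<in> K\<close> in auto)
  qed
  then show ?thesis using M(1) by auto
qed

text \<open>
The second difference is the increment on \<open>[0,1]\<close> of the difference of \<open>h\<close> along the segments
from \<open>b\<close> to \<open>a\<close> and from \<open>d\<close> to \<open>c\<close>; the derivative of that difference is estimated by the bound and
the Lipschitz constant of the derivative of \<open>h\<close>.
\<close>

lemma Ck_on_2_second_lip:
  fixes h :: "'a::euclidean_space \<Rightarrow> 'b::real_normed_vector"
  assumes "Ck_on 2 U h" "K \<subseteq> U" "compact K" "convex K"
  shows "\<exists>M. second_lip M K h"
proof -
  have C2: "Ck_on (Suc (Suc 0)) U h" using assms(1) by (simp add: numeral_2_eq_2)
  have C1: "Ck_on 1 U h" using Ck_on_SucD[OF C2] by simp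
  obtain M where M: "M \<ge> 0" "\<And>x v. x \<in> K \<Longrightarrow> norm (frechet_derivative h (at x) v) \<le> M * norm v"
    using Ck_on_1_derivative_bounded[OF C1 assms(2,3)] by auto
  obtain L where L: "L \<ge> 0" "\<And>x y. x \<in> K \<Longrightarrow> y \<in> K \<Longrightarrow> norm (h x - h y) \<le> L * norm (x - y)"
    using Ck_on_1_lipschitz[OF C1 assms(2-4)] by auto
  have "\<exists>N\<ge>0. \<forall>x\<in>K. \<forall>y\<in>K.
     norm (frechet_derivative h (at x) i - frechet_derivative h (at y) i) \<le> N * norm (x - y)" for i
    by (rule Ck_on_1_lipschitz[OF _ assms(2-4)]) (use C2 in simp)
  then obtain N where N: "\<And>i. N i \<ge> 0" "\<And>i x y. x \<in> K \<Longrightarrow> y \<in> K \<Longrightarrow>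
     norm (frechet_derivative h (at x) i - frechet_derivative h (at y) i) \<le> N i * norm (x - y)"
    by metis
  define N' where "N' = (\<Sum>i\<in>(Basis::'a set). N i)"
  have N': "N' \<ge> 0" unfolding N'_def using N by (intro sum_nonneg) auto
  have lin: "linear (frechet_derivative h (at x))" if "x \<in> K" for x
    using assms that C1 by (auto intro!: linear_frechet_derivative)
  have NN: "norm (frechet_derivative h (at x) v - frechet_derivative h (at y) v) \<le> N' * norm (x - y) * norm v"
    if "x \<in> K" "y \<in> K" for x y v
  proof -
    have "linear (\<lambda>v. frechet_derivative h (at x) v - frechet_derivative h (at y) v)"
      by (intro linear_compose_sub lin that)
    then have "norm (frechet_derivative h (at x) v - frechet_derivative h (at y) v)
      \<le> (\<Sum>i\<in>Basis. N i * norm (x - y)) * norm v"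
      by (rule norm_linear_le_sum_Basis) (use N that in auto)
    then show ?thesis by (simp add: N'_def sum_distrib_right)
  qed
  have Q: "norm (h a - h b - h c + h d) \<le> (M + N') * quad a b c d"
    if K: "a \<in> K" "b \<in> K" "c \<in> K" "d \<in> K" for a b c d
  proof -
    define x where "x s = b + s *\<^sub>R (a - b)" for s :: real
    define y where "y s = d + s *\<^sub>R (c - d)" for s :: real
    have xK: "x s \<in> K" "y s \<in> K" if "s \<in> {0..1}" for s
      using that K convexD_alt[OF assms(4), of b a s] convexD_alt[OF assms(4), of d c s]
      by (auto simp: x_def y_def algebra_simps)
    define \<theta>' where "\<theta>' s u = frechet_derivative h (at (x s)) (u *\<^sub>R (a - b)) - frechet_derivative h (at (y s)) (u *\<^sub>R (c - d))"
      for s and u :: real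
    have der: "((\<lambda>s. h (x s) - h (y s)) has_derivative \<theta>' s) (at s within {0..1})" if "s \<in> {0..1}" for s
    proof -
      have "(x has_derivative (\<lambda>u. u *\<^sub>R (a - b))) (at s within {0..1})"
        "(y has_derivative (\<lambda>u. u *\<^sub>R (c - d))) (at s within {0..1})"
        unfolding x_def y_def by (auto intro!: derivative_eq_intros)
      moreover have "(h has_derivative frechet_derivative h (at (x s))) (at (x s))"
        "(h has_derivative frechet_derivative h (at (y s))) (at (y s))"
        using xK[OF that] assms(2) Ck_on_differentiable[OF C2] by auto
      ultimately have "((\<lambda>s. h (x s)) has_derivative (\<lambda>u. frechet_derivative h (at (x s)) (u *\<^sub>R (a - b)))) (at s within {0..1})"
       "((\<lambda>s. h (y s)) has_derivative (\<lambda>u. frechet_derivative h (at (y s)) (u *\<^sub>R (c - d)))) (at s within {0..1})"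
        by (auto intro: has_derivative_compose)
      from has_derivative_diff[OF this] show ?thesis by (simp add: \<theta>'_def[abs_def])
    qed
    define B where "B = M * norm (a - b - c + d) + N' * (norm (a - c) + norm (b - d)) * norm (c - d)"
    have "norm ((h (x 1) - h (y 1)) - (h (x 0) - h (y 0))) \<le> B * norm (1 - 0 :: real)"
    proof (rule differentiable_bound[OF _ der])
      fix s :: real assume s: "s \<in> {0..1}"
      note xs = xK[OF s]
      show "onorm (\<theta>' s) \<le> B"
      proof (rule onorm_bound)
        show "0 \<le> B" using M N' by (simp add: B_def)
        fix u :: real
        interpret lx: linear "frechet_derivative h (at (x s))" using lin xs by blast
        interpret ly: linear "frechet_derivative h (at (y s))" using lin xs by blast
        have "\<theta>' s u = u *\<^sub>R (frechet_derivative h (at (x s)) (a - b - c + d) +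
            (frechet_derivative h (at (x s)) (c - d) - frechet_derivative h (at (y s)) (c - d)))"
          unfolding \<theta>'_def by (simp add: lx.scale ly.scale lx.add lx.diff ly.diff algebra_simps)
        then have "norm (\<theta>' s u) = \<bar>u\<bar> * norm (frechet_derivative h (at (x s)) (a - b - c + d) +
            (frechet_derivative h (at (x s)) (c - d) - frechet_derivative h (at (y s)) (c - d)))"
          by simp
        also have "\<dots> \<le> \<bar>u\<bar> * (M * norm (a - b - c + d) + N' * norm (x s - y s) * norm (c - d))"
          by (intro mult_left_mono norm_triangle_mono M NN xs) auto
        also have "\<dots> \<le> \<bar>u\<bar> * B"
        proof -
          have eq: "x s - y s = (1 - s) *\<^sub>R (b - d) + s *\<^sub>R (a - c)"
            by (simp add: x_def y_def algebra_simps)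
          have "norm (x s - y s) \<le> (1 - s) * norm (b - d) + s * norm (a - c)"
            using norm_triangle_ineq[of "(1 - s) *\<^sub>R (b - d)" "s *\<^sub>R (a - c)"] s unfolding eq by simp
          also have "\<dots> \<le> norm (b - d) + norm (a - c)"
            using s by (intro add_mono mult_left_le_one_le) auto
          finally have "norm (x s - y s) \<le> norm (a - c) + norm (b - d)" by simp
          then show ?thesis unfolding B_def
            by (intro mult_left_mono add_mono mult_right_mono) (use N' in auto)
        qed
        finally show "norm (\<theta>' s u) \<le> B * norm u" by (simp add: mult.commute)
      qed
    qed auto
    also have "(h (x 1) - h (y 1)) - (h (x 0) - h (y 0)) = h a - h b - h c + h d"
      by (simp add: x_def y_def)
    also have "B * norm (1 - 0 :: real) \<le> (M + N') * quad a b c d"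
    proof -
      have "0 \<le> norm (a - b) * (norm (a - c) + norm (b - d))" by simp
      then have *: "norm (a - b - c + d) \<le> quad a b c d" "(norm (a - c) + norm (b - d)) * norm (c - d) \<le> quad a b c d"
        unfolding quad_def by (auto simp: algebra_simps)
      show ?thesis
        using mult_left_mono[OF *(1) M(1)] mult_left_mono[OF *(2) N']
        by (simp add: B_def algebra_simps)
    qed
    finally show ?thesis .
  qed
  have "bounded (h ` K)"
    using assms Ck_on_SucD[OF Ck_on_SucD[OF C2]]
    by (intro compact_imp_bounded compact_continuous_image) (auto intro: continuous_on_subset)
  then obtain B where B: "B > 0" "\<And>x. x \<in> K \<Longrightarrow> norm (h x) \<le> B"
    by (auto simp: bounded_pos)
  have "second_lip (M + N' + L + B) K h"
    unfolding second_lip_def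
  proof (intro conjI ballI)
    show "0 \<le> M + N' + L + B" using M N' L B by simp
    fix a assume a: "a \<in> K"
    show "norm (h a) \<le> M + N' + L + B" using M N' L B(1) B(2)[OF a] by linarith
    fix b assume b: "b \<in> K"
    have "L * norm (a - b) \<le> (M + N' + L + B) * norm (a - b)"
      using M N' L B by (intro mult_right_mono) auto
    with L(2)[OF a b] show "norm (h a - h b) \<le> (M + N' + L + B) * norm (a - b)" by simp
    fix c d assume c: "c \<in> K" "d \<in> K"
    have "(M + N') * quad a b c d \<le> (M + N' + L + B) * quad a b c d"
      using M N' L B quad_nonneg by (intro mult_right_mono) auto
    with Q[OF a b c] show "norm (h a - h b - h c + h d) \<le> (M + N' + L + B) * quad a b c d" by simp
  qed
  then show ?thesis by blast
qed

lemma second_lip_scaleR: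
  assumes "second_lip M S h"
  shows "second_lip (\<bar>r\<bar> * M) S (\<lambda>y. r *\<^sub>R h y)"
proof -
  have eq: "r *\<^sub>R h a - r *\<^sub>R h b - r *\<^sub>R h c + r *\<^sub>R h d = r *\<^sub>R (h a - h b - h c + h d)" for a b c d
    by (simp add: algebra_simps)
  show ?thesis
    using assms unfolding second_lip_def eq
    by (auto simp: scaleR_diff_right[symmetric] mult.assoc intro!: mult_left_mono)
qed

lemma second_lip_add:
  assumes "second_lip M S h" "second_lip N S k"
  shows "second_lip (M + N) S (\<lambda>y. h y + k y)"
proof -
  have tri: "norm (x + y) \<le> (M + N) * z" if "norm x \<le> M * z" "norm y \<le> N * z" for x y :: 'b and z
    using that norm_triangle_ineq[of x y] by (simp add: algebra_simps)
  have 1: "h a + k a - (h b + k b) = (h a - h b) + (k a - k b)" for a b by simp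
  have 2: "h a + k a - (h b + k b) - (h c + k c) + (h d + k d) =
     (h a - h b - h c + h d) + (k a - k b - k c + k d)" for a b c d by simp
  show ?thesis
    using assms unfolding second_lip_def 2 unfolding 1
    by (auto intro!: tri order_trans[OF norm_triangle_ineq add_mono])
qed

lemma second_lip_sum:
  assumes "finite I" "\<And>i. i \<in> I \<Longrightarrow> second_lip (B i) S (h i)"
  shows "second_lip (\<Sum>i\<in>I. B i) S (\<lambda>y. \<Sum>i\<in>I. h i y)"
  using assms
proof (induction I rule: finite_induct)
  case empty
  then show ?case by (simp add: second_lip_def)
next
  case (insert i I)
  then show ?case by (simp add: second_lip_add)
qed

text \<open>
If \<open>k\<close> depends linearly on \<open>v\<close>, bounds for the basis vectors give a bound that is uniform in
\<open>v\<close>. The factor \<open>c\<close> carries the norm of a second argument, so that the lemma can be applied twice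
to a family of bilinear forms.
\<close>

lemma second_lip_expansion:
  fixes v :: "'e::euclidean_space"
  assumes "\<And>i. i \<in> Basis \<Longrightarrow> second_lip (B i * c) S (h i)"
    and "\<And>y. y \<in> S \<Longrightarrow> k y = (\<Sum>i\<in>Basis. (v \<bullet> i) *\<^sub>R h i y)"
  shows "second_lip ((\<Sum>i\<in>Basis. B i) * norm v * c) S k"
proof (rule second_lip_mono)
  show "second_lip (\<Sum>i\<in>Basis. \<bar>v \<bullet> i\<bar> * (B i * c)) S (\<lambda>y. \<Sum>i\<in>Basis. (v \<bullet> i) *\<^sub>R h i y)"
    by (intro second_lip_sum second_lip_scaleR assms) auto
  have "(\<Sum>i\<in>Basis. \<bar>v \<bullet> i\<bar> * (B i * c)) \<le> (\<Sum>i\<in>Basis. norm v * (B i * c))"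
    by (intro sum_mono mult_right_mono Basis_le_norm second_lip_nonneg[OF assms(1)]) auto
  then show "(\<Sum>i\<in>Basis. \<bar>v \<bullet> i\<bar> * (B i * c)) \<le> (\<Sum>i\<in>Basis. B i) * norm v * c"
    by (simp add: sum_distrib_right sum_distrib_left mult_ac)
qed (use assms(2) in auto)

text \<open>
Comparing \<open>a, b\<close> with the parallel pair \<open>q + (a - b), q\<close> gives a parallelogram, for which the second
difference of the vertices vanishes. So the bound on second differences transports the approximation
by \<open>L\<close> from \<open>q\<close> to all nearby points, uniformly: \<open>L\<close> is a strict derivative.
\<close>

lemma second_lip_strict_derivative:
  fixes h :: "'e::euclidean_space \<Rightarrow> 'b::real_normed_vector"
  assumes E: "subspace E" "q \<in> E" and r: "0 < r" and h: "second_lip M (E \<inter> cball q r) h"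
    and L: "(h has_derivative L) (at q within E)" and \<eta>: "0 < \<eta>"
  shows "\<exists>r'>0. \<forall>a\<in>E \<inter> cball q r'. \<forall>b\<in>E \<inter> cball q r'. norm (h a - h b - L (a - b)) \<le> \<eta> * norm (a - b)"
proof -
  have M: "0 \<le> M" using second_lip_nonneg[OF h] .
  obtain d where d: "d > 0" "\<And>y. y \<in> E \<Longrightarrow> norm (y - q) < d \<Longrightarrow> norm (h y - h q - L (y - q)) \<le> \<eta> / 2 * norm (y - q)"
    using L \<eta> unfolding has_derivative_within_alt by (meson half_gt_zero)
  \<comment> \<open>\<open>c = q + (a - b)\<close> must lie in both balls, and \<open>4 M r' \<le> \<eta> / 2\<close>\<close>
  define r' where "r' = min (min (r / 2) (d / 3)) (\<eta> / (8 * (M + 1)))"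
  have "r' \<le> r / 2" "r' \<le> d / 3" "r' \<le> \<eta> / (8 * (M + 1))"
    unfolding r'_def by linarith+
  moreover have "r' > 0" using r d(1) \<eta> M by (simp add: r'_def)
  ultimately have r': "r' > 0" "2 * r' \<le> r" "2 * r' < d" "r' \<le> \<eta> / (8 * (M + 1))"
    using d(1) by auto
  have rM: "M * (4 * r') \<le> \<eta> / 2"
  proof -
    have "M * (4 * r') \<le> (M + 1) * (4 * r')" using r' by (intro mult_right_mono) auto
    also have "\<dots> \<le> (M + 1) * (4 * (\<eta> / (8 * (M + 1))))" using r' M by (intro mult_left_mono) auto
    also have "\<dots> = \<eta> / 2" using M by (simp add: divide_simps)
    finally show ?thesis .
  qed
  have "norm (h a - h b - L (a - b)) \<le> \<eta> * norm (a - b)"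
    if a: "a \<in> E \<inter> cball q r'" and b: "b \<in> E \<inter> cball q r'" for a b
  proof -
    define c where "c = q + (a - b)"
    have cE: "c \<in> E" using a b E by (auto simp: c_def intro: subspace_add subspace_diff)
    have aq: "norm (a - q) \<le> r'" and bq: "norm (b - q) \<le> r'" using a b by (auto simp: dist_norm norm_minus_commute)
    have "norm (a - b) \<le> 2 * r'"
      using norm_triangle_ineq4[of "a - q" "b - q"] aq bq by simp
    then have cq: "norm (c - q) \<le> 2 * r'" by (simp add: c_def)
    have in_ball: "a \<in> E \<inter> cball q r" "b \<in> E \<inter> cball q r" "c \<in> E \<inter> cball q r" "q \<in> E \<inter> cball q r"
      using a b cE cq r' E r by (auto simp: dist_norm norm_minus_commute)
    have "quad a b c q = 4 * norm (a - b) * norm (b - q)"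
      by (simp add: quad_def c_def algebra_simps)
    then have "norm (h a - h b - h c + h q) \<le> M * (4 * norm (a - b) * norm (b - q))"
      using second_lip_quad[OF h in_ball] by simp
    also have "\<dots> \<le> M * (4 * norm (a - b) * r')"
      using M bq by (intro mult_left_mono) auto
    also have "\<dots> = (M * (4 * r')) * norm (a - b)" by simp
    also have "\<dots> \<le> \<eta> / 2 * norm (a - b)" by (intro mult_right_mono rM) auto
    finally have 1: "norm (h a - h b - h c + h q) \<le> \<eta> / 2 * norm (a - b)" .
    have 2: "norm (h c - h q - L (a - b)) \<le> \<eta> / 2 * norm (a - b)"
      using d(2)[OF cE] cq r' by (simp add: c_def)
    have "h a - h b - L (a - b) = (h a - h b - h c + h q) + (h c - h q - L (a - b))" by simp
    then have "norm (h a - h b - L (a - b)) \<le> norm (h a - h b - h c + h q) + norm (h c - h q - L (a - b))"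
      by (metis norm_triangle_ineq)
    with 1 2 show ?thesis by simp
  qed
  then show ?thesis using r'(1) by blast
qed

lemma eventually_at_right_small: "0 < e \<Longrightarrow> \<forall>\<^sub>F r in at_right (0::real). 0 < r \<and> r < e"
  by (auto simp: eventually_at_right_field)

lemma small_cball_subset:
  assumes "open U" "q \<in> U"
  shows "\<forall>\<^sub>F r in at_right (0::real). cball q r \<subseteq> U"
proof -
  obtain e where "e > 0" "cball q e \<subseteq> U" using assms open_contains_cball by blast
  then show ?thesis
    using eventually_at_right_small[of e] by (auto elim!: eventually_mono)
qed

lemma quad_le_spread:
  fixes a b c d :: "'a::real_normed_vector"
  assumes "norm (a - d) \<le> K" "norm (b - d) \<le> K" "norm (c - d) \<le> K"
  shows "quad a b c d \<le> norm (a - b - c + d) + 9 * K\<^sup>2"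
proof -
  have "norm (a - b) \<le> 2 * K" "norm (a - c) \<le> 2 * K"
    using norm_triangle_ineq4[of "a - d" "b - d"] norm_triangle_ineq4[of "a - d" "c - d"] assms by auto
  then have "norm (a - b) + norm (c - d) \<le> 3 * K" "norm (a - c) + norm (b - d) \<le> 3 * K"
    using assms by auto
  moreover have "0 \<le> K" using assms(1) norm_ge_zero order_trans by blast
  ultimately have "(norm (a - b) + norm (c - d)) * (norm (a - c) + norm (b - d)) \<le> (3 * K) * (3 * K)"
    by (intro mult_mono) auto
  then show ?thesis by (simp add: quad_def power2_eq_square)
qed

section \<open>Approximately additive maps are differentiable\<close>

text \<open>
As in the theorem of Hyers on approximately additive maps, the rescalings \<open>2\<^sup>n G(h / 2\<^sup>n)\<close> form a
Cauchy sequence, because doubling the argument changes \<open>G\<close> by a factor two up to a quadratic error.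
The limit is additive and bounded, hence linear, and differs from \<open>G\<close> by a quadratic error.
\<close>

lemma approximately_additive_has_derivative:
  fixes G :: "'a::real_normed_vector \<Rightarrow> 'b::banach"
  assumes \<rho>: "0 < \<rho>" and M: "0 \<le> M"
    and lip: "\<And>h. norm h < \<rho> \<Longrightarrow> norm (G h) \<le> M * norm h"
    and add: "\<And>h k. norm h + norm k < \<rho> \<Longrightarrow> norm (G (h + k) - G h - G k) \<le> M * (norm h + norm k)\<^sup>2"
  shows "\<exists>L. (G has_derivative L) (at 0)"
proof -
  define Y where "Y n h = 2 ^ n *\<^sub>R G (h /\<^sub>R 2 ^ n)" for n :: nat and h
  have small: "\<forall>\<^sub>F n in sequentially. r / 2 ^ n < \<rho>" for r :: real
  proof -
    have "(\<lambda>n. r * (1/2) ^ n) \<longlonglongrightarrow> r * 0"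
      by (intro tendsto_mult tendsto_const LIMSEQ_power_zero) auto
    then have "\<forall>\<^sub>F n in sequentially. r * (1/2) ^ n < \<rho>"
      using \<rho> by (intro order_tendstoD(2)[of _ "r * 0"]) auto
    then show ?thesis by (simp add: power_one_over field_simps)
  qed
  have step: "norm (Y (Suc n) h - Y n h) \<le> M * (norm h)\<^sup>2 * (1/2) ^ n" if "norm h / 2 ^ n < \<rho>" for n h
  proof -
    define k where "k = h /\<^sub>R 2 ^ Suc n"
    have nk: "norm k + norm k = norm h / 2 ^ n" by (simp add: k_def field_simps)
    have kk: "k + k = h /\<^sub>R 2 ^ n"
      by (simp add: k_def scaleR_2[symmetric])
    have "norm (G (k + k) - G k - G k) \<le> M * (norm h / 2 ^ n)\<^sup>2"
      using add[of k k] that nk by simp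
    moreover have "Y (Suc n) h - Y n h = - (2 ^ n *\<^sub>R (G (k + k) - G k - G k))"
      unfolding kk unfolding Y_def k_def[symmetric] by (simp add: algebra_simps scaleR_2[symmetric])
    ultimately have "norm (Y (Suc n) h - Y n h) \<le> 2 ^ n * (M * (norm h / 2 ^ n)\<^sup>2)" by simp
    also have "\<dots> = M * (norm h)\<^sup>2 * (1/2) ^ n"
      by (simp add: power2_eq_square power_one_over field_simps)
    finally show ?thesis .
  qed
  have conv: "convergent (\<lambda>n. Y n h)" for h
  proof -
    have "summable (\<lambda>n. Y (Suc n) h - Y n h)"
    proof (rule summable_comparison_test_ev)
      show "\<forall>\<^sub>F n in sequentially. norm (Y (Suc n) h - Y n h) \<le> M * (norm h)\<^sup>2 * (1/2) ^ n"
        using small[of "norm h"] by eventually_elim (rule step)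
      show "summable (\<lambda>n. M * (norm h)\<^sup>2 * (1/2) ^ n :: real)"
        by (intro summable_mult summable_geometric) auto
    qed
    then have "(\<lambda>n. \<Sum>k<n. Y (Suc k) h - Y k h) \<longlonglongrightarrow> (\<Sum>k. Y (Suc k) h - Y k h)"
      by (rule summable_LIMSEQ)
    from tendsto_add[OF this tendsto_const[of "Y 0 h"]]
    have "(\<lambda>n. (Y n h - Y 0 h) + Y 0 h) \<longlonglongrightarrow> (\<Sum>k. Y (Suc k) h - Y k h) + Y 0 h"
      by (simp only: sum_lessThan_telescope[of "\<lambda>k. Y k h"])
    then show ?thesis by (auto simp: convergent_def)
  qed
  define L where "L h = lim (\<lambda>n. Y n h)" for h
  have lim: "(\<lambda>n. Y n h) \<longlonglongrightarrow> L h" for h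
    using conv[of h] by (simp add: L_def convergent_LIMSEQ_iff)
  have Lbound: "norm (L h) \<le> M * norm h" for h
  proof (rule tendsto_upperbound[OF tendsto_norm[OF lim]])
    show "\<forall>\<^sub>F n in sequentially. norm (Y n h) \<le> M * norm h"
      using small[of "norm h"]
    proof eventually_elim
      case (elim n)
      then have "norm (G (h /\<^sub>R 2 ^ n)) \<le> M * (norm h / 2 ^ n)"
        using lip[of "h /\<^sub>R 2 ^ n"] by (simp add: field_simps)
      then have "2 ^ n * norm (G (h /\<^sub>R 2 ^ n)) \<le> 2 ^ n * (M * (norm h / 2 ^ n))"
        by (intro mult_left_mono) auto
      then show ?case by (simp add: Y_def)
    qed
  qed auto
  have Ladd: "L (h + k) = L h + L k" for h k
  proof -
    have "(\<lambda>n. Y n (h + k) - Y n h - Y n k) \<longlonglongrightarrow> 0"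
    proof (rule Lim_null_comparison)
      have "(\<lambda>n. M * (norm h + norm k)\<^sup>2 * (1/2) ^ n) \<longlonglongrightarrow> M * (norm h + norm k)\<^sup>2 * 0"
        by (intro tendsto_mult tendsto_const LIMSEQ_power_zero) auto
      then show "(\<lambda>n. M * (norm h + norm k)\<^sup>2 * (1/2) ^ n) \<longlonglongrightarrow> 0" by simp
      show "\<forall>\<^sub>F n in sequentially. norm (Y n (h + k) - Y n h - Y n k) \<le> M * (norm h + norm k)\<^sup>2 * (1/2) ^ n"
        using small[of "norm h + norm k"]
      proof eventually_elim
        case (elim n)
        have eq: "norm (h /\<^sub>R 2 ^ n) + norm (k /\<^sub>R 2 ^ n) = (norm h + norm k) / 2 ^ n"
          by (simp add: field_simps)
        have "norm (G (h /\<^sub>R 2 ^ n + k /\<^sub>R 2 ^ n) - G (h /\<^sub>R 2 ^ n) - G (k /\<^sub>R 2 ^ n))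
            \<le> M * ((norm h + norm k) / 2 ^ n)\<^sup>2"
          using add[of "h /\<^sub>R 2 ^ n" "k /\<^sub>R 2 ^ n"] elim unfolding eq by simp
        then have "2 ^ n * norm (G (h /\<^sub>R 2 ^ n + k /\<^sub>R 2 ^ n) - G (h /\<^sub>R 2 ^ n) - G (k /\<^sub>R 2 ^ n))
            \<le> 2 ^ n * (M * ((norm h + norm k) / 2 ^ n)\<^sup>2)" (is "?l \<le> ?r")
          by (intro mult_left_mono) auto
        moreover have "?r = M * (norm h + norm k)\<^sup>2 * (1/2) ^ n"
          by (simp add: power2_eq_square power_one_over field_simps)
        moreover have "?l = norm (Y n (h + k) - Y n h - Y n k)"
        proof -
          have "Y n (h + k) - Y n h - Y n k =
             2 ^ n *\<^sub>R (G (h /\<^sub>R 2 ^ n + k /\<^sub>R 2 ^ n) - G (h /\<^sub>R 2 ^ n) - G (k /\<^sub>R 2 ^ n))"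
            by (simp add: Y_def scaleR_add_right scaleR_diff_right)
          then show ?thesis by simp
        qed
        ultimately show ?case by simp
      qed
    qed
    moreover have "(\<lambda>n. Y n (h + k) - Y n h - Y n k) \<longlonglongrightarrow> L (h + k) - L h - L k"
      by (intro tendsto_diff lim)
    ultimately have "L (h + k) - L h - L k = 0" using LIMSEQ_unique by blast
    then show ?thesis by (simp add: algebra_simps)
  qed
  interpret additive L by unfold_locales (rule Ladd)
  have Lint: "L (of_int m *\<^sub>R h) = of_int m *\<^sub>R L h" for m h
  proof -
    have nat: "L (of_nat n *\<^sub>R h) = of_nat n *\<^sub>R L h" for n
      by (induction n) (auto simp: zero Ladd algebra_simps)
    show ?thesis
    proof (cases m)
      case (nonneg n)
      then show ?thesis using nat[of n] by simp
    next
      case (neg n)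
      then show ?thesis using nat[of "Suc n"] minus by (simp only: of_int_minus of_int_of_nat_eq scaleR_minus_left)
    qed
  qed
  \<comment> \<open>\<open>n r h\<close> differs from an integer multiple of \<open>h\<close> by a vector of norm at most \<open>norm h\<close>, so the
      defect of homogeneity, multiplied by \<open>n\<close>, stays bounded.\<close>
  have Lscale: "L (r *\<^sub>R h) = r *\<^sub>R L h" for r h
  proof -
    have "real n * norm (L (r *\<^sub>R h) - r *\<^sub>R L h) \<le> 2 * M * norm h" for n
    proof -
      define \<theta> where "\<theta> = real n * r - of_int \<lfloor>real n * r\<rfloor>"
      have \<theta>: "0 \<le> \<theta>" "\<theta> \<le> 1" by (auto simp: \<theta>_def) linarith
      have "real n *\<^sub>R L (r *\<^sub>R h) = L ((real n * r) *\<^sub>R h)"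
        using Lint[of "int n" "r *\<^sub>R h"] by simp
      also have "(real n * r) *\<^sub>R h = of_int \<lfloor>real n * r\<rfloor> *\<^sub>R h + \<theta> *\<^sub>R h"
        by (simp add: \<theta>_def algebra_simps)
      also have "L \<dots> = of_int \<lfloor>real n * r\<rfloor> *\<^sub>R L h + L (\<theta> *\<^sub>R h)"
        by (simp only: Ladd Lint)
      finally have eq: "real n *\<^sub>R (L (r *\<^sub>R h) - r *\<^sub>R L h) = L (\<theta> *\<^sub>R h) - \<theta> *\<^sub>R L h"
        by (simp add: \<theta>_def algebra_simps)
      have "real n * norm (L (r *\<^sub>R h) - r *\<^sub>R L h) = norm (L (\<theta> *\<^sub>R h) - \<theta> *\<^sub>R L h)"
        unfolding eq[symmetric] by simp
      also have "\<dots> \<le> norm (L (\<theta> *\<^sub>R h)) + norm (\<theta> *\<^sub>R L h)" by (rule norm_triangle_ineq4)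
      also have "\<dots> \<le> M * norm h + M * norm h"
      proof (rule add_mono)
        have "norm (L (\<theta> *\<^sub>R h)) \<le> M * (\<theta> * norm h)" using Lbound[of "\<theta> *\<^sub>R h"] \<theta> by simp
        also have "\<dots> \<le> M * norm h" using \<theta> M by (intro mult_left_mono mult_left_le_one_le) auto
        finally show "norm (L (\<theta> *\<^sub>R h)) \<le> M * norm h" .
        have "norm (\<theta> *\<^sub>R L h) \<le> norm (L h)" using \<theta> by (simp add: mult_left_le_one_le)
        then show "norm (\<theta> *\<^sub>R L h) \<le> M * norm h" using Lbound[of h] by simp
      qed
      finally show ?thesis by simp
    qed
    then have bd: "norm (L (r *\<^sub>R h) - r *\<^sub>R L h) \<le> 2 * M * norm h / real (Suc n)" for n
      by (metis of_nat_0_less_iff zero_less_Suc mult.commute pos_le_divide_eq)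
    have "(\<lambda>n. 2 * M * norm h / real (Suc n)) \<longlonglongrightarrow> 0"
      by (rule LIMSEQ_Suc[OF lim_const_over_n])
    then have "norm (L (r *\<^sub>R h) - r *\<^sub>R L h) \<le> 0"
      by (rule tendsto_lowerbound) (use bd in auto)
    then show ?thesis by simp
  qed
  have bl: "bounded_linear L"
    by (rule bounded_linear_intro[of _ M]) (use Ladd Lscale Lbound in \<open>auto simp: mult.commute\<close>)
  have quad: "norm (G h - L h) \<le> 2 * M * (norm h)\<^sup>2" if "norm h < \<rho>" for h
  proof -
    have small: "norm h / 2 ^ n < \<rho>" for n
    proof -
      have "norm h / 2 ^ n \<le> norm h / 1" by (intro divide_left_mono) auto
      then show ?thesis using that by simp
    qed
    have "norm (Y n h - Y 0 h) \<le> M * (norm h)\<^sup>2 * (2 - 2 * (1/2) ^ n)" for n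
    proof (induction n)
      case (Suc n)
      have "norm (Y (Suc n) h - Y 0 h) \<le> norm (Y (Suc n) h - Y n h) + norm (Y n h - Y 0 h)"
        by (metis norm_triangle_ineq diff_add_cancel add_diff_eq)
      also have "\<dots> \<le> M * (norm h)\<^sup>2 * (1/2) ^ n + M * (norm h)\<^sup>2 * (2 - 2 * (1/2) ^ n)"
        by (intro add_mono Suc step small)
      finally show ?case by (simp add: algebra_simps)
    qed simp
    also have "M * (norm h)\<^sup>2 * (2 - 2 * (1/2) ^ n) \<le> M * (norm h)\<^sup>2 * 2" for n
      using M by (intro mult_left_mono) auto
    finally have "norm (Y n h - Y 0 h) \<le> 2 * M * (norm h)\<^sup>2" for n by (simp add: mult_ac)
    moreover have "(\<lambda>n. norm (Y n h - Y 0 h)) \<longlonglongrightarrow> norm (L h - Y 0 h)"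
      by (intro tendsto_intros lim)
    ultimately have "norm (L h - Y 0 h) \<le> 2 * M * (norm h)\<^sup>2"
      by (intro tendsto_upperbound[of _ _ sequentially]) auto
    then show ?thesis by (simp add: Y_def norm_minus_commute)
  qed
  have G0: "G 0 = 0" using lip[of 0] \<rho> by simp
  have "(G has_derivative L) (at 0)"
  proof (rule has_derivativeI_sandwich[OF \<rho> bl])
    fix y :: 'a assume y: "y \<noteq> 0" "dist y 0 < \<rho>"
    have "norm (G y - L y) \<le> 2 * M * (norm y)\<^sup>2" using quad y by simp
    then show "norm (G y - G 0 - L (y - 0)) / norm (y - 0) \<le> 2 * M * norm y"
      using y G0 by (simp add: pos_divide_le_eq power2_eq_square mult_ac)
  next
    have "(\<lambda>x::'a. 2 * M * norm x) \<midarrow>0\<rightarrow> 2 * M * norm (0::'a)" by (intro tendsto_intros)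
    then show "(\<lambda>x::'a. 2 * M * norm x) \<midarrow>0\<rightarrow> 0" by simp
  qed
  then show ?thesis by blast
qed

text \<open>
The same for increments from \<open>z\<close> in a subspace; composing with a projection reduces this to the
whole space.
\<close>

lemma approximately_additive_differentiable_within:
  fixes F :: "'e::euclidean_space \<Rightarrow> 'b::banach"
  assumes E: "subspace E" "z \<in> E" and \<rho>: "0 < \<rho>" and M: "0 \<le> M"
    and lip: "\<And>h. h \<in> E \<Longrightarrow> norm h < \<rho> \<Longrightarrow> norm (F (z + h) - F z) \<le> M * norm h"
    and add: "\<And>h k. h \<in> E \<Longrightarrow> k \<in> E \<Longrightarrow> norm h + norm k < \<rho> \<Longrightarrow>
       norm (F (z + h + k) - F (z + h) - F (z + k) + F z) \<le> M * (norm h + norm k)\<^sup>2"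
  shows "F differentiable (at z within E)"
proof -
  obtain P K where P: "linear P" "\<And>v. P v \<in> E" "\<And>v. v \<in> E \<Longrightarrow> P v = v"
    and K: "K \<ge> 1" "\<And>v. norm (P v) \<le> K * norm v"
    using subspace_projection[OF E(1)] by blast
  define G where "G h = F (z + P h) - F z" for h
  have "\<exists>L. (G has_derivative L) (at 0)"
  proof (rule approximately_additive_has_derivative[of "\<rho> / K" "M * K\<^sup>2"])
    show "0 < \<rho> / K" using \<rho> K by simp
    show "0 \<le> M * K\<^sup>2" using M by simp
    fix h :: 'e assume "norm h < \<rho> / K"
    then have "K * norm h < \<rho>" using K by (simp add: pos_less_divide_eq mult.commute)
    then have "norm (P h) < \<rho>" using K(2)[of h] by linarith
    then have "norm (G h) \<le> M * norm (P h)" unfolding G_def by (intro lip P)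
    also have "\<dots> \<le> M * (K\<^sup>2 * norm h)"
    proof (rule mult_left_mono[OF _ M])
      have "K * norm h \<le> (K * K) * norm h" using K(1) by (intro mult_right_mono) auto
      then show "norm (P h) \<le> K\<^sup>2 * norm h" using K(2)[of h] by (simp add: power2_eq_square)
    qed
    finally show "norm (G h) \<le> M * K\<^sup>2 * norm h" by (simp add: mult.assoc)
  next
    fix h k :: 'e assume "norm h + norm k < \<rho> / K"
    then have "K * (norm h + norm k) < \<rho>" using K by (simp add: pos_less_divide_eq mult.commute)
    moreover have le: "norm (P h) + norm (P k) \<le> K * (norm h + norm k)"
      using K(2)[of h] K(2)[of k] by (simp add: algebra_simps)
    ultimately have "norm (P h) + norm (P k) < \<rho>" by linarith
    then have "norm (F (z + P h + P k) - F (z + P h) - F (z + P k) + F z) \<le> M * (norm (P h) + norm (P k))\<^sup>2"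
      by (intro add P)
    moreover have "G (h + k) - G h - G k = F (z + P h + P k) - F (z + P h) - F (z + P k) + F z"
      by (simp add: G_def linear_add[OF P(1)] add.assoc)
    ultimately have "norm (G (h + k) - G h - G k) \<le> M * (norm (P h) + norm (P k))\<^sup>2" by simp
    also have "\<dots> \<le> M * (K * (norm h + norm k))\<^sup>2"
      by (intro mult_left_mono power_mono le M) auto
    finally show "norm (G (h + k) - G h - G k) \<le> M * K\<^sup>2 * (norm h + norm k)\<^sup>2"
      by (simp add: power_mult_distrib mult.assoc)
  qed
  then obtain L where L: "(G has_derivative L) (at 0)" by blast
  have "((\<lambda>y. y - z) has_derivative (\<lambda>v. v)) (at z within E)"
    by (auto intro!: derivative_eq_intros)
  moreover have "(G has_derivative L) (at (z - z))" using L by simp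
  ultimately have "((\<lambda>y. G (y - z)) has_derivative L) (at z within E)"
    by (rule has_derivative_compose)
  then have "((\<lambda>y. G (y - z) + F z) has_derivative L) (at z within E)"
    by (auto intro!: derivative_eq_intros)
  moreover have "G (y - z) + F z = F y" if "y \<in> E" for y
    using that E P(3)[of "y - z"] by (simp add: G_def subspace_diff)
  ultimately have "(F has_derivative L) (at z within E)"
    using E(2) by (intro has_derivative_transform[of z E F]) auto
  then show ?thesis by (auto simp: differentiable_def)
qed

section \<open>Symmetry of the second derivative\<close>

text \<open>
The quotient is symmetric in \<open>a\<close> and \<open>b\<close>, whereas its limit is the derivative in direction \<open>b\<close> of the
derivative in direction \<open>a\<close>: this is what makes second derivatives symmetric. The limit is found by
the mean value theorem in direction \<open>a\<close>, followed by the differentiability of \<open>D\<close> at \<open>z\<close>.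
\<close>

lemma second_difference_quotient_tendsto:
  fixes h :: "'a::euclidean_space \<Rightarrow> real"
  assumes U: "open U" "z \<in> U" and h: "\<And>y. y \<in> U \<Longrightarrow> (h has_derivative D y) (at y)"
    and H: "((\<lambda>y. D y a) has_derivative H) (at z)"
  shows "((\<lambda>s. (h (z + s *\<^sub>R a + s *\<^sub>R b) - h (z + s *\<^sub>R a) - h (z + s *\<^sub>R b) + h z) / s\<^sup>2) \<longlongrightarrow> H b)
           (at_right 0)"
proof (rule tendstoI)
  fix e :: real assume e: "e > 0"
  define N where "N = norm a + norm b + 1"
  have N: "N > 0" unfolding N_def by (smt (verit) norm_ge_zero)
  interpret H: bounded_linear H using H by (rule has_derivative_bounded_linear)
  obtain \<eta> where \<eta>: "\<eta> > 0" "ball z \<eta> \<subseteq> U" using U open_contains_ball by blast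
  have "e / (4 * N) > 0" using e N by simp
  then obtain d where d: "d > 0" "\<And>y. norm (y - z) < d \<Longrightarrow>
      norm (D y a - D z a - H (y - z)) \<le> e / (4 * N) * norm (y - z)"
    using H unfolding has_derivative_within_alt by (auto 4 3)
  define r where "r = min d \<eta> / N"
  have r: "r > 0" using d \<eta> N by (simp add: r_def)
  have "dist ((h (z + s *\<^sub>R a + s *\<^sub>R b) - h (z + s *\<^sub>R a) - h (z + s *\<^sub>R b) + h z) / s\<^sup>2) (H b) < e"
    if s: "0 < s" "s < r" for s
  proof -
    have sN: "s * N < min d \<eta>" using s N by (simp add: r_def pos_less_divide_eq)
    have small: "norm (x *\<^sub>R a + y *\<^sub>R b) \<le> s * N" if "0 \<le> x" "x \<le> s" "0 \<le> y" "y \<le> s" for x y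
    proof -
      have "norm (x *\<^sub>R a + y *\<^sub>R b) \<le> x * norm a + y * norm b"
        using norm_triangle_ineq[of "x *\<^sub>R a" "y *\<^sub>R b"] that by simp
      also have "\<dots> \<le> s * norm a + s * norm b"
        by (intro add_mono mult_right_mono that) auto
      also have "\<dots> \<le> s * N" using s by (simp add: N_def algebra_simps)
      finally show ?thesis .
    qed
    have inU: "z + (x *\<^sub>R a + y *\<^sub>R b) \<in> U" if "0 \<le> x" "x \<le> s" "0 \<le> y" "y \<le> s" for x y
    proof -
      have "norm (x *\<^sub>R a + y *\<^sub>R b) < \<eta>" using small[OF that] sN by simp
      then have "z + (x *\<^sub>R a + y *\<^sub>R b) \<in> ball z \<eta>" by (simp add: dist_norm norm_minus_commute add.commute)
      then show ?thesis using \<eta> by blast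
    qed
    define \<theta> where "\<theta> \<sigma> = h (z + (\<sigma> *\<^sub>R a + s *\<^sub>R b)) - h (z + (\<sigma> *\<^sub>R a + 0 *\<^sub>R b))" for \<sigma>
    have "\<exists>\<sigma>>0. \<sigma> < s \<and> \<theta> s - \<theta> 0 =
      (s - 0) * (D (z + (\<sigma> *\<^sub>R a + s *\<^sub>R b)) a - D (z + (\<sigma> *\<^sub>R a + 0 *\<^sub>R b)) a)"
    proof (rule MVT2)
      fix \<sigma> assume \<sigma>: "0 \<le> \<sigma>" "\<sigma> \<le> s"
      have "((\<lambda>\<sigma>. z + (\<sigma> *\<^sub>R a + y *\<^sub>R b)) has_derivative (\<lambda>u. u *\<^sub>R a)) (at \<sigma>)" for y
        by (auto intro!: derivative_eq_intros)
      from has_derivative_compose[OF this h[OF inU]] 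
      have "((\<lambda>\<sigma>. h (z + (\<sigma> *\<^sub>R a + y *\<^sub>R b))) has_derivative (\<lambda>u. D (z + (\<sigma> *\<^sub>R a + y *\<^sub>R b)) (u *\<^sub>R a))) (at \<sigma>)"
        if "0 \<le> y" "y \<le> s" for y using \<sigma> that by blast
      then have A: "((\<lambda>\<sigma>. h (z + (\<sigma> *\<^sub>R a + y *\<^sub>R b))) has_field_derivative D (z + (\<sigma> *\<^sub>R a + y *\<^sub>R b)) a) (at \<sigma>)"
        if "0 \<le> y" "y \<le> s" for y
        unfolding has_field_derivative_def
        by (rule has_derivative_eq_rhs[OF _ ext])
          (use that linear_cmul[OF has_derivative_linear[OF h[OF inU[OF \<sigma> that]]], of _ a] in auto)
      show "(\<theta> has_field_derivative D (z + (\<sigma> *\<^sub>R a + s *\<^sub>R b)) a - D (z + (\<sigma> *\<^sub>R a + 0 *\<^sub>R b)) a) (at \<sigma>)"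
        unfolding \<theta>_def[abs_def] by (rule DERIV_diff[OF A A]) (use s in auto)
    qed (use s in simp)
    then obtain \<sigma> where \<sigma>: "0 < \<sigma>" "\<sigma> < s" and
      mv: "\<theta> s - \<theta> 0 = s * (D (z + (\<sigma> *\<^sub>R a + s *\<^sub>R b)) a - D (z + (\<sigma> *\<^sub>R a + 0 *\<^sub>R b)) a)"
      by auto
    have est: "\<bar>D (z + (\<sigma> *\<^sub>R a + y *\<^sub>R b)) a - D z a - H (\<sigma> *\<^sub>R a + y *\<^sub>R b)\<bar> \<le> e / 4 * s"
      if "0 \<le> y" "y \<le> s" for y
    proof -
      have sm: "norm (\<sigma> *\<^sub>R a + y *\<^sub>R b) \<le> s * N" using small \<sigma> that by simp
      then have "\<bar>D (z + (\<sigma> *\<^sub>R a + y *\<^sub>R b)) a - D z a - H (\<sigma> *\<^sub>R a + y *\<^sub>R b)\<bar>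
         \<le> e / (4 * N) * norm (\<sigma> *\<^sub>R a + y *\<^sub>R b)"
        using d(2)[of "z + (\<sigma> *\<^sub>R a + y *\<^sub>R b)"] sN by simp
      also have "\<dots> \<le> e / (4 * N) * (s * N)"
        using e N by (intro mult_left_mono sm) auto
      finally show ?thesis using N by simp
    qed
    define X1 X2 where "X1 = D (z + (\<sigma> *\<^sub>R a + s *\<^sub>R b)) a - D z a"
      and "X2 = D (z + (\<sigma> *\<^sub>R a + 0 *\<^sub>R b)) a - D z a"
    have Hl: "H (\<sigma> *\<^sub>R a + y *\<^sub>R b) = \<sigma> * H a + y * H b" for y
      by (simp add: H.add H.scaleR)
    have "\<bar>X1 - (\<sigma> * H a + s * H b)\<bar> \<le> e / 4 * s" "\<bar>X2 - (\<sigma> * H a + 0 * H b)\<bar> \<le> e / 4 * s"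
      using est[of s] est[of 0] s unfolding Hl X1_def X2_def by (blast intro: less_imp_le order.refl)+
    then have "\<bar>X1 - X2 - s * H b\<bar> \<le> e / 2 * s" by linarith
    moreover have eq: "h (z + s *\<^sub>R a + s *\<^sub>R b) - h (z + s *\<^sub>R a) - h (z + s *\<^sub>R b) + h z = s * (X1 - X2)"
      using mv by (simp add: \<theta>_def X1_def X2_def add.assoc)
    ultimately have "s * \<bar>X1 - X2 - s * H b\<bar> \<le> s * (e / 2 * s)"
      using s by (intro mult_left_mono) auto
    moreover have "s * (X1 - X2) / s\<^sup>2 - H b = s * (X1 - X2 - s * H b) / s\<^sup>2"
      using s by (simp add: field_simps power2_eq_square)
    ultimately have "\<bar>s * (X1 - X2) / s\<^sup>2 - H b\<bar> \<le> e / 2"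
      using s by (simp add: abs_mult pos_divide_le_eq power2_eq_square mult_ac)
    then show ?thesis unfolding eq dist_real_def using e by simp
  qed
  then show "\<forall>\<^sub>F s in at_right 0. dist ((h (z + s *\<^sub>R a + s *\<^sub>R b) - h (z + s *\<^sub>R a) - h (z + s *\<^sub>R b) + h z) / s\<^sup>2) (H b) < e"
    using r by (auto simp: eventually_at_right_field)
qed

lemma second_derivative_symmetric:
  fixes h :: "'a::euclidean_space \<Rightarrow> real"
  assumes U: "open U" "z \<in> U" and C2: "Ck_on 2 U h"
  shows "frechet_derivative (\<lambda>y. frechet_derivative h (at y) a) (at z) b =
         frechet_derivative (\<lambda>y. frechet_derivative h (at y) b) (at z) a"
proof -
  have C: "Ck_on (Suc (Suc 0)) U h" using C2 by (simp add: numeral_2_eq_2)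
  have D: "((\<lambda>y. frechet_derivative h (at y) v) has_derivative
      frechet_derivative (\<lambda>y. frechet_derivative h (at y) v) (at z)) (at z)" for v
    using C U by (simp add: frechet_derivative_works)
  note lim = second_difference_quotient_tendsto[OF U Ck_on_differentiable[OF C] D]
  have "((\<lambda>s. (h (z + s *\<^sub>R a + s *\<^sub>R b) - h (z + s *\<^sub>R a) - h (z + s *\<^sub>R b) + h z) / s\<^sup>2) \<longlongrightarrow>
     frechet_derivative (\<lambda>y. frechet_derivative h (at y) b) (at z) a) (at_right 0)"
    using lim[of b a] by (simp add: algebra_simps)
  from tendsto_unique[OF _ lim[of a b] this] show ?thesis by simp
qed

section \<open>Differential inequalities and continuation along an interval\<close>

text \<open>
Differentiating \<open>|u|\<^sup>2 + C\<^sup>2\<close> instead of \<open>|u|\<close> absorbs the inhomogeneity and avoids the zeros of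
\<open>u\<close>; the price is the rate \<open>L + 1\<close> in place of \<open>L\<close>.
\<close>

lemma gronwall:
  fixes u :: "real \<Rightarrow> 'a::real_inner"
  assumes der: "\<And>t. t \<in> {t0..T} \<Longrightarrow> (u has_vector_derivative u' t) (at t)"
    and bd: "\<And>t. t \<in> {t0..T} \<Longrightarrow> norm (u' t) \<le> L * norm (u t) + C"
    and L: "0 \<le> L" and C: "0 \<le> C" and t: "t \<in> {t0..T}"
  shows "norm (u t) \<le> (norm (u t0) + C) * exp ((L + 1) * (t - t0))"
proof -
  define \<psi> where "\<psi> s = (u s \<bullet> u s + C\<^sup>2) * exp (- (2 * L + 1) * (s - t0))" for s
  have "\<psi> t \<le> \<psi> t0"
  proof (rule DERIV_nonpos_imp_nonincreasing[of t0 t \<psi>])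
    fix s assume "t0 \<le> s" "s \<le> t"
    then have s: "s \<in> {t0..T}" using t by auto
    have "((\<lambda>s. u s \<bullet> u s) has_derivative (\<lambda>r. u s \<bullet> (r *\<^sub>R u' s) + (r *\<^sub>R u' s) \<bullet> u s)) (at s)"
      using der[OF s] unfolding has_vector_derivative_def by (intro has_derivative_inner)
    then have "((\<lambda>s. u s \<bullet> u s) has_field_derivative 2 * (u s \<bullet> u' s)) (at s)"
      unfolding has_field_derivative_def
      by (rule has_derivative_eq_rhs) (auto simp: inner_commute)
    then have "(\<psi> has_field_derivative (2 * (u s \<bullet> u' s) - (2 * L + 1) * (u s \<bullet> u s + C\<^sup>2)) *
         exp (- (2 * L + 1) * (s - t0))) (at s)"
      unfolding \<psi>_def[abs_def] by (auto intro!: derivative_eq_intros simp: algebra_simps)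
    moreover have "2 * (u s \<bullet> u' s) - (2 * L + 1) * (u s \<bullet> u s + C\<^sup>2) \<le> 0"
    proof -
      have "u s \<bullet> u' s \<le> norm (u s) * norm (u' s)" by (rule norm_cauchy_schwarz)
      also have "\<dots> \<le> norm (u s) * (L * norm (u s) + C)" by (intro mult_left_mono bd s) auto
      finally have "2 * (u s \<bullet> u' s) \<le> 2 * L * (u s \<bullet> u s) + 2 * norm (u s) * C"
        by (simp add: dot_square_norm power2_eq_square algebra_simps)
      moreover have "2 * norm (u s) * C \<le> u s \<bullet> u s + C\<^sup>2"
        using sum_squares_bound[of "norm (u s)" C] by (simp add: dot_square_norm)
      moreover have "0 \<le> L * C\<^sup>2" using L by simp
      ultimately show ?thesis by (simp add: algebra_simps)
    qed
    ultimately show "\<exists>y. (\<psi> has_field_derivative y) (at s) \<and> y \<le> 0"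
      by (blast intro: mult_nonpos_nonneg exp_ge_zero)
  qed (use t in auto)
  then have "(u t \<bullet> u t + C\<^sup>2) * exp (- (2 * L + 1) * (t - t0)) * exp ((2 * L + 1) * (t - t0))
      \<le> (u t0 \<bullet> u t0 + C\<^sup>2) * exp ((2 * L + 1) * (t - t0))"
    unfolding \<psi>_def by (intro mult_right_mono) auto
  then have "u t \<bullet> u t + C\<^sup>2 \<le> (u t0 \<bullet> u t0 + C\<^sup>2) * exp ((2 * L + 1) * (t - t0))"
    by (simp add: mult.assoc exp_add[symmetric] algebra_simps)
  also have "\<dots> \<le> (norm (u t0) + C)\<^sup>2 * exp ((2 * L + 2) * (t - t0))"
  proof (rule mult_mono)
    show "u t0 \<bullet> u t0 + C\<^sup>2 \<le> (norm (u t0) + C)\<^sup>2"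
      using C by (simp add: dot_square_norm power2_sum)
    show "exp ((2 * L + 1) * (t - t0)) \<le> exp ((2 * L + 2) * (t - t0))"
      using t by (auto intro!: mult_right_mono)
  qed auto
  also have "\<dots> = ((norm (u t0) + C) * exp ((L + 1) * (t - t0)))\<^sup>2"
    unfolding power_mult_distrib exp_double[symmetric] by (simp add: algebra_simps)
  finally have "(norm (u t))\<^sup>2 \<le> ((norm (u t0) + C) * exp ((L + 1) * (t - t0)))\<^sup>2"
    using zero_le_power2[of C] unfolding dot_square_norm by linarith
  then show ?thesis
    by (rule power2_le_imp_le) (use C in simp)
qed

lemma speed_bound:
  fixes \<gamma> :: "real \<Rightarrow> 'a::real_normed_vector"
  assumes "a \<le> b" and der: "\<And>s. s \<in> {a..b} \<Longrightarrow> (\<gamma> has_vector_derivative \<gamma>' s) (at s)"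
    and bd: "\<And>s. s \<in> {a..b} \<Longrightarrow> norm (\<gamma>' s) \<le> N"
  shows "norm (\<gamma> b - \<gamma> a) \<le> N * (b - a)"
proof -
  have "norm (\<gamma> b - \<gamma> a) \<le> N * norm (b - a)"
  proof (rule differentiable_bound[of "{a..b}" \<gamma> "\<lambda>s r. r *\<^sub>R \<gamma>' s"])
    fix s assume s: "s \<in> {a..b}"
    show "(\<gamma> has_derivative (\<lambda>r. r *\<^sub>R \<gamma>' s)) (at s within {a..b})"
      using has_derivative_at_withinI[OF der[OF s, unfolded has_vector_derivative_def]] .
    show "onorm (\<lambda>r. r *\<^sub>R \<gamma>' s) \<le> N"
    proof (rule onorm_bound)
      show "0 \<le> N" using bd[OF s] norm_ge_zero order_trans by blast
      show "norm (r *\<^sub>R \<gamma>' s) \<le> N * norm r" for r :: real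
        using mult_left_mono[OF bd[OF s] abs_ge_zero[of r]] by (simp add: mult.commute)
    qed
  qed (use assms(1) in auto)
  then show ?thesis using assms(1) by simp
qed

lemma integral_curves_distance:
  fixes a b :: "real \<Rightarrow> 'e::real_inner"
  assumes X: "second_lip N S X"
    and a: "\<And>t. t \<in> {t1..t2} \<Longrightarrow> a t \<in> S" "\<And>t. t \<in> {t1..t2} \<Longrightarrow> (a has_vector_derivative X (a t)) (at t)"
    and b: "\<And>t. t \<in> {t1..t2} \<Longrightarrow> b t \<in> S" "\<And>t. t \<in> {t1..t2} \<Longrightarrow> (b has_vector_derivative X (b t)) (at t)"
    and t: "t \<in> {t1..t2}"
  shows "norm (a t - b t) \<le> norm (a t1 - b t1) * exp ((N + 1) * (t2 - t1))"
proof -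
  have "norm (a t - b t) \<le> (norm (a t1 - b t1) + 0) * exp ((N + 1) * (t - t1))"
  proof (rule gronwall[of t1 t2 "\<lambda>t. a t - b t" "\<lambda>t. X (a t) - X (b t)"])
    fix s assume s: "s \<in> {t1..t2}"
    show "((\<lambda>t. a t - b t) has_vector_derivative X (a s) - X (b s)) (at s)"
      by (intro has_vector_derivative_diff a b s)
    show "norm (X (a s) - X (b s)) \<le> N * norm (a s - b s) + 0"
      using second_lip_lipschitz[OF X a(1)[OF s] b(1)[OF s]] by simp
  qed (use second_lip_nonneg[OF X] t in auto)
  also have "\<dots> \<le> (norm (a t1 - b t1) + 0) * exp ((N + 1) * (t2 - t1))"
    using t second_lip_nonneg[OF X] by (intro mult_left_mono) auto
  finally show ?thesis by simp
qed

text \<open>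
The second difference of four integral curves satisfies a linear differential inequality whose
inhomogeneity is a multiple of the square of their spread, and the spread grows at most exponentially.
\<close>

lemma integral_curves_second_difference:
  fixes a b c d :: "real \<Rightarrow> 'e::real_inner"
  assumes X: "second_lip N S X" and t12: "t1 \<le> t2"
    and a: "\<And>t. t \<in> {t1..t2} \<Longrightarrow> a t \<in> S" "\<And>t. t \<in> {t1..t2} \<Longrightarrow> (a has_vector_derivative X (a t)) (at t)"
    and b: "\<And>t. t \<in> {t1..t2} \<Longrightarrow> b t \<in> S" "\<And>t. t \<in> {t1..t2} \<Longrightarrow> (b has_vector_derivative X (b t)) (at t)"
    and c: "\<And>t. t \<in> {t1..t2} \<Longrightarrow> c t \<in> S" "\<And>t. t \<in> {t1..t2} \<Longrightarrow> (c has_vector_derivative X (c t)) (at t)"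
    and d: "\<And>t. t \<in> {t1..t2} \<Longrightarrow> d t \<in> S" "\<And>t. t \<in> {t1..t2} \<Longrightarrow> (d has_vector_derivative X (d t)) (at t)"
    and K: "norm (a t1 - d t1) \<le> K" "norm (b t1 - d t1) \<le> K" "norm (c t1 - d t1) \<le> K"
    and q: "norm (a t1 - b t1 - c t1 + d t1) \<le> q"
  defines "e \<equiv> exp ((N + 1) * (t2 - t1))"
  shows "norm (a t2 - b t2 - c t2 + d t2) \<le> (q + N * (9 * (K * e)\<^sup>2)) * e"
proof -
  have N: "0 \<le> N" by (rule second_lip_nonneg[OF X])
  have spread: "norm (a t - d t) \<le> K * e" "norm (b t - d t) \<le> K * e" "norm (c t - d t) \<le> K * e"
    if t: "t \<in> {t1..t2}" for t
    unfolding e_def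
    using order_trans[OF integral_curves_distance[OF X a d t] mult_right_mono[OF K(1) exp_ge_zero]]
      order_trans[OF integral_curves_distance[OF X b d t] mult_right_mono[OF K(2) exp_ge_zero]]
      order_trans[OF integral_curves_distance[OF X c d t] mult_right_mono[OF K(3) exp_ge_zero]]
    by blast+
  have "norm (a t2 - b t2 - c t2 + d t2) \<le>
     (norm (a t1 - b t1 - c t1 + d t1) + N * (9 * (K * e)\<^sup>2)) * exp ((N + 1) * (t2 - t1))"
  proof (rule gronwall[of t1 t2 "\<lambda>t. a t - b t - c t + d t" "\<lambda>t. X (a t) - X (b t) - X (c t) + X (d t)"])
    fix s assume s: "s \<in> {t1..t2}"
    show "((\<lambda>t. a t - b t - c t + d t) has_vector_derivative X (a s) - X (b s) - X (c s) + X (d s)) (at s)"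
      by (intro has_vector_derivative_diff has_vector_derivative_add a b c d s)
    have "norm (X (a s) - X (b s) - X (c s) + X (d s)) \<le> N * quad (a s) (b s) (c s) (d s)"
      by (rule second_lip_quad[OF X a(1)[OF s] b(1)[OF s] c(1)[OF s] d(1)[OF s]])
    also have "\<dots> \<le> N * (norm (a s - b s - c s + d s) + 9 * (K * e)\<^sup>2)"
      by (intro mult_left_mono quad_le_spread spread s N)
    finally show "norm (X (a s) - X (b s) - X (c s) + X (d s)) \<le> N * norm (a s - b s - c s + d s) + N * (9 * (K * e)\<^sup>2)"
      by (simp add: algebra_simps)
  qed (use N t12 in auto)
  also have "\<dots> \<le> (q + N * (9 * (K * e)\<^sup>2)) * e"
    unfolding e_def by (intro mult_right_mono add_right_mono q) auto
  finally show ?thesis .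
qed

text \<open>
Induction along a real interval: the infimum of the counterexamples cannot be reached from the left
and cannot be left to the right.
\<close>

lemma real_interval_induct:
  fixes P :: "real \<Rightarrow> bool"
  assumes base: "P a"
    and left: "\<And>t. a < t \<Longrightarrow> t \<le> b \<Longrightarrow> (\<And>s. a \<le> s \<Longrightarrow> s < t \<Longrightarrow> P s) \<Longrightarrow> P t"
    and right: "\<And>t. a \<le> t \<Longrightarrow> t < b \<Longrightarrow> (\<And>s. a \<le> s \<Longrightarrow> s \<le> t \<Longrightarrow> P s) \<Longrightarrow> \<exists>e>0. \<forall>s. t < s \<and> s < t + e \<longrightarrow> P s"
    and t: "a \<le> t" "t \<le> b"
  shows "P t"
proof (rule ccontr)
  assume "\<not> P t"
  define S where "S = {s. a \<le> s \<and> s \<le> b \<and> \<not> P s}"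
  have ne: "S \<noteq> {}" using t \<open>\<not> P t\<close> by (auto simp: S_def)
  have bdd: "bdd_below S" by (auto simp: S_def)
  define m where "m = Inf S"
  have am: "a \<le> m" unfolding m_def by (rule cInf_greatest[OF ne]) (auto simp: S_def)
  have tS: "t \<in> S" using t \<open>\<not> P t\<close> by (auto simp: S_def)
  have mb: "m \<le> b" unfolding m_def using cInf_lower[OF tS bdd] t by simp
  have below: "P s" if "a \<le> s" "s < m" for s
  proof (rule ccontr)
    assume "\<not> P s"
    then have "s \<in> S" using that mb by (auto simp: S_def)
    then show False using cInf_lower[OF _ bdd] that by (force simp: m_def)
  qed
  have "P m" using base left[OF _ mb below] am by (cases "a = m") auto
  then have "m \<noteq> t" using \<open>\<not> P t\<close> by auto
  moreover have "m \<le> t" unfolding m_def using cInf_lower[OF tS bdd] .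
  ultimately have "m < b" using t by simp
  have le: "P s" if "a \<le> s" "s \<le> m" for s using below that \<open>P m\<close> by (cases "s = m") auto
  obtain e where e: "e > 0" "\<And>s. m < s \<Longrightarrow> s < m + e \<Longrightarrow> P s"
    using right[OF am \<open>m < b\<close> le] by blast
  have "m + e \<le> Inf S"
  proof (rule cInf_greatest[OF ne])
    fix s assume "s \<in> S"
    then have "\<not> P s" "a \<le> s" by (auto simp: S_def)
    then have "\<not> s \<le> m" using le by blast
    then show "m + e \<le> s" using e(2)[of s] \<open>\<not> P s\<close> by (rule_tac ccontr) auto
  qed
  then show False using e by (simp add: m_def)
qed

text \<open>
This is how a priori estimates confine a curve: as long as it has stayed in \<open>K\<close>, the estimate
\<open>step\<close> puts it into the open set \<open>W\<close>, so it cannot be about to leave \<open>K\<close>.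
\<close>

lemma stays_in_closed_set:
  fixes \<gamma> :: "real \<Rightarrow> 'm::topological_space"
  assumes cont: "\<And>t. t \<in> {t0..T} \<Longrightarrow> isCont \<gamma> t"
    and K: "closed K" and W: "open W" "W \<subseteq> K" and start: "\<gamma> t0 \<in> K"
    and step: "\<And>t. t \<in> {t0..T} \<Longrightarrow> (\<And>s. s \<in> {t0..t} \<Longrightarrow> \<gamma> s \<in> K) \<Longrightarrow> \<gamma> t \<in> W"
    and t: "t \<in> {t0..T}"
  shows "\<gamma> t \<in> K"
proof (rule real_interval_induct[of "\<lambda>t. \<gamma> t \<in> K" t0 T])
  fix t assume t: "t0 < t" "t \<le> T" and IH: "\<And>s. t0 \<le> s \<Longrightarrow> s < t \<Longrightarrow> \<gamma> s \<in> K"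
  have "(\<gamma> \<longlongrightarrow> \<gamma> t) (at_left t)"
    using cont[of t] t by (auto simp: isCont_def intro: filterlim_mono[OF _ order.refl at_le])
  moreover have "\<forall>\<^sub>F s in at_left t. \<gamma> s \<in> K"
    unfolding eventually_at_left_field using t IH by (intro exI[of _ t0]) auto
  ultimately show "\<gamma> t \<in> K"
    using K by (intro Lim_in_closed_set[of K \<gamma> "at_left t"]) auto
next
  fix t assume t: "t0 \<le> t" "t < T" and IH: "\<And>s. t0 \<le> s \<Longrightarrow> s \<le> t \<Longrightarrow> \<gamma> s \<in> K"
  have "\<gamma> t \<in> W" using step[of t] t IH by auto
  moreover have "(\<gamma> \<longlongrightarrow> \<gamma> t) (at_right t)"
    using cont[of t] t by (auto simp: isCont_def intro: filterlim_mono[OF _ order.refl at_le])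
  ultimately have "\<forall>\<^sub>F s in at_right t. \<gamma> s \<in> W" using W by (auto intro: topological_tendstoD)
  then obtain c where "c > t" "\<And>s. t < s \<Longrightarrow> s < c \<Longrightarrow> \<gamma> s \<in> W"
    by (auto simp: eventually_at_right_field)
  then show "\<exists>e>0. \<forall>s. t < s \<and> s < t + e \<longrightarrow> \<gamma> s \<in> K"
    using W by (intro exI[of _ "c - t"]) auto
qed (use start t in auto)

section \<open>Fields defined by a gradient equation\<close>

lemma quadratic_le_linear:
  fixes n :: real
  assumes "l * n\<^sup>2 \<le> c * n" "0 < l" "0 \<le> n" "0 \<le> c"
  shows "n \<le> c / l"
proof (cases "n = 0")
  case False
  then have "l * n \<le> c" using assms by (simp add: power2_eq_square)
  then show ?thesis using assms by (simp add: pos_le_divide_eq mult.commute)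
qed (use assms in auto)

text \<open>
Finite dimension makes non-degeneracy quantitative. The functional \<open>H a\<close> is represented by the vector
\<open>T a\<close>, and an injective linear map on a subspace is bounded below.
\<close>

lemma nondegenerate_lower_bound:
  fixes H :: "'e::euclidean_space \<Rightarrow> 'e \<Rightarrow> real"
  assumes E: "subspace E" and H: "bounded_bilinear H"
    and nd: "\<And>a. a \<in> E \<Longrightarrow> (\<And>b. b \<in> E \<Longrightarrow> H a b = 0) \<Longrightarrow> a = 0"
  shows "\<exists>\<beta>>0. \<forall>a\<in>E. \<exists>v\<in>E. norm v \<le> 1 \<and> \<beta> * norm a \<le> H a v"
proof -
  interpret H: bounded_bilinear H by (rule H)
  obtain P K where P: "linear P" "\<And>v. P v \<in> E" "\<And>v. v \<in> E \<Longrightarrow> P v = v"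
    and K: "K \<ge> 1" "\<And>v. norm (P v) \<le> K * norm v"
    using subspace_projection[OF E] by blast
  define T where "T a = (\<Sum>i\<in>Basis. H a (P i) *\<^sub>R i)" for a
  have T: "T a \<bullet> w = H a (P w)" for a w
  proof -
    have "H a (P w) = H a (P (\<Sum>i\<in>Basis. (w \<bullet> i) *\<^sub>R i))" by (simp add: euclidean_representation)
    also have "\<dots> = (\<Sum>i\<in>Basis. (w \<bullet> i) * H a (P i))"
      by (simp only: linear_sum[OF P(1)] linear_cmul[OF P(1)] H.sum_right H.scaleR_right real_scaleR_def)
    finally show ?thesis by (simp add: T_def inner_sum_left inner_commute[of w] mult.commute)
  qed
  have lin: "bounded_linear T"
    unfolding T_def
    by (rule linear_conv_bounded_linear[THEN iffD1], rule linearI)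
      (auto simp: H.add_left H.scaleR_left algebra_simps sum.distrib scaleR_sum_right)
  have "\<forall>x\<in>E. T x = 0 \<longrightarrow> x = 0"
  proof (intro ballI impI)
    fix x assume "x \<in> E" "T x = 0"
    then show "x = 0" using T[of x] P(3) by (intro nd) (auto, metis inner_zero_left)
  qed
  from injective_imp_isometric[OF closed_subspace[OF E] E lin this]
  obtain e where e: "e > 0" "\<And>x. x \<in> E \<Longrightarrow> e * norm x \<le> norm (T x)" by auto
  have "\<exists>v\<in>E. norm v \<le> 1 \<and> e / K * norm a \<le> H a v" if a: "a \<in> E" for a
  proof (cases "T a = 0")
    case True
    then have "a = 0" using e(1) e(2)[OF a] by (simp add: mult_le_0_iff)
    then show ?thesis using E by (intro bexI[of _ 0]) (auto simp: subspace_0 H.zero_left)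
  next
    case False
    define v where "v = P (T a) /\<^sub>R (K * norm (T a))"
    have "v \<in> E" using P E by (simp add: v_def subspace_scale)
    moreover have "norm v \<le> 1"
      using K(2)[of "T a"] K(1) False by (simp add: v_def divide_simps)
    moreover have "H a v = norm (T a) / K"
      using False T[of a "T a"] K(1) by (simp add: v_def H.scaleR_right dot_square_norm power2_eq_square divide_simps)
    then have "e / K * norm a \<le> H a v" using e(2)[OF a] K(1) by (simp add: divide_right_mono)
    ultimately show ?thesis by blast
  qed
  then show ?thesis using e K by (intro exI[of _ "e / K"]) auto
qed

text \<open>
\<open>X\<close> is the negative gradient, with respect to inner products \<open>G y\<close> on \<open>E\<close>, of the linear forms
\<open>D y\<close>. The equation is used directly: testing it with a difference \<open>w\<close> of values of \<open>X\<close> and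
using coercivity bounds \<open>w\<close>, which takes the place of inverting \<open>G\<close>.
\<close>

locale gradient_equation =
  fixes E S :: "'e::euclidean_space set" and D :: "'e \<Rightarrow> 'e \<Rightarrow> real" and G :: "'e \<Rightarrow> 'e \<Rightarrow> 'e \<Rightarrow> real"
    and X :: "'e \<Rightarrow> 'e" and M l :: real
  assumes E: "subspace E"
    and M: "1 \<le> M" and l: "0 < l"
    and X_in: "y \<in> S \<Longrightarrow> X y \<in> E"
    and G_diff: "y \<in> S \<Longrightarrow> u \<in> E \<Longrightarrow> v \<in> E \<Longrightarrow> w \<in> E \<Longrightarrow> G y (u - v) w = G y u w - G y v w"
    and D_lip: "v \<in> E \<Longrightarrow> second_lip (M * norm v) S (\<lambda>y. D y v)"
    and G_lip: "u \<in> E \<Longrightarrow> v \<in> E \<Longrightarrow> second_lip (M * norm u * norm v) S (\<lambda>y. G y u v)"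
    and coercive: "y \<in> S \<Longrightarrow> u \<in> E \<Longrightarrow> l * (norm u)\<^sup>2 \<le> G y u u"
    and equation: "y \<in> S \<Longrightarrow> v \<in> E \<Longrightarrow> G y (X y) v = - D y v"
begin

lemma X_bound:
  assumes y: "y \<in> S"
  shows "norm (X y) \<le> M / l"
proof (rule quadratic_le_linear[OF _ l])
  have "l * (norm (X y))\<^sup>2 \<le> - D y (X y)"
    using coercive[OF y X_in[OF y]] equation[OF y X_in[OF y]] by simp
  then show "l * (norm (X y))\<^sup>2 \<le> M * norm (X y)"
    using second_lip_bound[OF D_lip[OF X_in[OF y]] y] by simp
qed (use M in auto)

definition lip_const :: real where "lip_const = (M + M * (M / l)) / l"

lemma lip_const_nonneg: "0 \<le> lip_const"
  using M l by (simp add: lip_const_def)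

lemma X_lipschitz:
  assumes a: "a \<in> S" and b: "b \<in> S"
  shows "norm (X a - X b) \<le> lip_const * norm (a - b)"
proof -
  define w where "w = X a - X b"
  have Xb: "X b \<in> E" and w: "w \<in> E" unfolding w_def using X_in a b E by (auto intro: subspace_diff)
  have "G a w w = - (D a w - D b w) - (G a (X b) w - G b (X b) w)"
    using G_diff[OF a X_in[OF a] Xb w] equation[OF a w] equation[OF b w] by (simp add: w_def)
  then have "l * (norm w)\<^sup>2 \<le> - (D a w - D b w) - (G a (X b) w - G b (X b) w)"
    using coercive[OF a w] by simp
  moreover have "\<bar>D a w - D b w\<bar> \<le> M * norm w * norm (a - b)"
    using second_lip_lipschitz[OF D_lip[OF w] a b] by simp
  moreover have "\<bar>G a (X b) w - G b (X b) w\<bar> \<le> M * norm (X b) * norm w * norm (a - b)"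
    using second_lip_lipschitz[OF G_lip[OF Xb w] a b] by simp
  moreover have "M * norm (X b) * norm w * norm (a - b) \<le> M * (M / l) * norm w * norm (a - b)"
    using M by (intro mult_right_mono mult_left_mono X_bound b) auto
  ultimately have "l * (norm w)\<^sup>2 \<le> M * norm w * norm (a - b) + M * (M / l) * norm w * norm (a - b)"
    by linarith
  then have "l * (norm w)\<^sup>2 \<le> (M + M * (M / l)) * norm (a - b) * norm w"
    by (simp add: algebra_simps)
  from quadratic_le_linear[OF this l] show ?thesis
    using M l by (simp add: w_def lip_const_def)
qed

text \<open>
With \<open>w\<close> the second difference of \<open>X\<close>, the product rule for second differences expresses
\<open>G a w w\<close> by the second difference of \<open>D\<close>, products of first differences of \<open>G\<close> and \<open>X\<close>, and the
second difference of \<open>G\<close>.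
\<close>

lemma X_second_difference:
  assumes a: "a \<in> S" and b: "b \<in> S" and c: "c \<in> S" and d: "d \<in> S"
  shows "norm (X a - X b - X c + X d) \<le> (M + 2 * M * lip_const + M * (M / l)) / l * quad a b c d"
proof -
  define w where "w = (X a - X b) - (X c - X d)"
  note XE = X_in[OF a] X_in[OF b] X_in[OF c] X_in[OF d]
  note sub = subspace_diff[OF E]
  have w: "w \<in> E" unfolding w_def by (intro sub XE)
  have bd: "X b - X d \<in> E" and cd: "X c - X d \<in> E" by (intro sub XE)+
  define T1 where "T1 = D a w - D b w - D c w + D d w"
  define T2 where "T2 = G a (X b - X d) w - G b (X b - X d) w"
  define T3 where "T3 = G a (X c - X d) w - G c (X c - X d) w"
  define T4 where "T4 = G a (X d) w - G b (X d) w - G c (X d) w + G d (X d) w"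
  \<comment> \<open>\<open>T4\<close> enters because \<open>G a - G d\<close> is the sum of \<open>G a - G b\<close> and \<open>G a - G c\<close> minus the second difference of \<open>G\<close>\<close>
  have "G a w w = - T1 - T2 - T3 - T4"
    using equation[OF a w] equation[OF b w] equation[OF c w] equation[OF d w]
    unfolding T1_def T2_def T3_def T4_def
    by (simp add: w_def[symmetric] G_diff a b c XE w) (simp add: w_def G_diff a b c d XE w sub w[unfolded w_def])
  then have "l * (norm w)\<^sup>2 \<le> - T1 - T2 - T3 - T4" using coercive[OF a w] by simp
  moreover have "\<bar>T1\<bar> \<le> M * quad a b c d * norm w"
    using second_lip_quad[OF D_lip[OF w] a b c d] by (simp add: T1_def mult_ac)
  moreover have "\<bar>T2\<bar> \<le> M * lip_const * quad a b c d * norm w"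
  proof -
    have "\<bar>T2\<bar> \<le> M * norm (X b - X d) * norm w * norm (a - b)"
      using second_lip_lipschitz[OF G_lip[OF bd w] a b] by (simp add: T2_def)
    also have "\<dots> \<le> M * (lip_const * norm (b - d)) * norm w * norm (a - b)"
      using M by (intro mult_right_mono mult_left_mono X_lipschitz b d) auto
    also have "\<dots> = M * lip_const * norm w * (norm (a - b) * norm (b - d))" by simp
    also have "\<dots> \<le> M * lip_const * norm w * quad a b c d"
      using M lip_const_nonneg
      by (intro mult_left_mono mult_nonneg_nonneg) (auto simp: quad_def algebra_simps add_nonneg_nonneg)
    finally show ?thesis by (simp add: mult_ac)
  qed
  moreover have "\<bar>T3\<bar> \<le> M * lip_const * quad a b c d * norm w"
  proof -
    have "\<bar>T3\<bar> \<le> M * norm (X c - X d) * norm w * norm (a - c)"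
      using second_lip_lipschitz[OF G_lip[OF cd w] a c] by (simp add: T3_def)
    also have "\<dots> \<le> M * (lip_const * norm (c - d)) * norm w * norm (a - c)"
      using M by (intro mult_right_mono mult_left_mono X_lipschitz c d) auto
    also have "\<dots> = M * lip_const * norm w * (norm (c - d) * norm (a - c))" by simp
    also have "\<dots> \<le> M * lip_const * norm w * quad a b c d"
      using M lip_const_nonneg
      by (intro mult_left_mono mult_nonneg_nonneg) (auto simp: quad_def algebra_simps add_nonneg_nonneg)
    finally show ?thesis by (simp add: mult_ac)
  qed
  moreover have "\<bar>T4\<bar> \<le> M * (M / l) * quad a b c d * norm w"
  proof -
    have "\<bar>T4\<bar> \<le> M * norm (X d) * norm w * quad a b c d"
      using second_lip_quad[OF G_lip[OF X_in[OF d] w] a b c d] by (simp add: T4_def)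
    also have "\<dots> \<le> M * (M / l) * norm w * quad a b c d"
      using M by (intro mult_right_mono mult_left_mono X_bound d quad_nonneg) auto
    finally show ?thesis by (simp add: mult_ac)
  qed
  ultimately have "l * (norm w)\<^sup>2 \<le> M * quad a b c d * norm w + M * lip_const * quad a b c d * norm w +
     M * lip_const * quad a b c d * norm w + M * (M / l) * quad a b c d * norm w"
    by linarith
  then have "l * (norm w)\<^sup>2 \<le> ((M + 2 * M * lip_const + M * (M / l)) * quad a b c d) * norm w"
    by (simp add: algebra_simps)
  moreover have "0 \<le> M + 2 * M * lip_const + M * (M / l)"
    using M l lip_const_nonneg by (intro add_nonneg_nonneg mult_nonneg_nonneg divide_nonneg_nonneg) auto
  ultimately have "norm w \<le> (M + 2 * M * lip_const + M * (M / l)) * quad a b c d / l"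
    by (intro quadratic_le_linear[OF _ l]) (auto intro: mult_nonneg_nonneg quad_nonneg)
  then show ?thesis by (simp add: w_def algebra_simps)
qed

lemma X_second_lip: "\<exists>N. second_lip N S X"
proof -
  define N where "N = M / l + lip_const + (M + 2 * M * lip_const + M * (M / l)) / l"
  have nn: "0 \<le> M / l" "0 \<le> lip_const" "0 \<le> (M + 2 * M * lip_const + M * (M / l)) / l"
    using M l lip_const_nonneg by auto
  have "second_lip N S X"
    unfolding second_lip_def
  proof (intro conjI ballI)
    show "0 \<le> N" using nn by (simp add: N_def)
    fix a assume a: "a \<in> S"
    show "norm (X a) \<le> N" using X_bound[OF a] nn by (simp add: N_def)
    fix b assume b: "b \<in> S"
    have "lip_const * norm (a - b) \<le> N * norm (a - b)"
      using nn by (intro mult_right_mono) (auto simp: N_def)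
    then show "norm (X a - X b) \<le> N * norm (a - b)" using X_lipschitz[OF a b] by simp
    fix c d assume c: "c \<in> S" and d: "d \<in> S"
    have "(M + 2 * M * lip_const + M * (M / l)) / l * quad a b c d \<le> N * quad a b c d"
      using nn by (intro mult_right_mono quad_nonneg) (auto simp: N_def)
    then show "norm (X a - X b - X c + X d) \<le> N * quad a b c d"
      using X_second_difference[OF a b c d] by simp
  qed
  then show ?thesis ..
qed

section \<open>Hyperbolicity and exponential contraction\<close>

text \<open>
Let \<open>H\<close> be the derivative of \<open>D\<close> at the zero \<open>q\<close> of \<open>X\<close>, and put \<open>\<delta> = a - b\<close>,
\<open>w = X a - X b\<close>. Since \<open>X\<close> is small near \<open>q\<close>, the difference of the two gradient equations says that
\<open>G a w v\<close> equals \<open>- H \<delta> v\<close> up to \<open>\<epsilon> |\<delta>| |v|\<close>. With \<open>v\<close> adapted to the non-degenerate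
\<open>H\<close> this bounds \<open>|\<delta>|\<close> by a multiple of \<open>|w|\<close>; then \<open>v = w\<close> and coercivity give the negativity of
\<open>H \<delta> w\<close>.
\<close>

lemma hyperbolic_estimates:
  assumes H: "bounded_bilinear H"
    and nd: "\<And>a. a \<in> E \<Longrightarrow> (\<And>b. b \<in> E \<Longrightarrow> H a b = 0) \<Longrightarrow> a = 0"
    and q: "q \<in> S" "X q = 0" and r0: "0 < r0" "E \<inter> cball q r0 \<subseteq> S"
    and strict: "\<And>\<eta>. 0 < \<eta> \<Longrightarrow> \<exists>r>0. \<forall>a\<in>E \<inter> cball q r. \<forall>b\<in>E \<inter> cball q r. \<forall>v\<in>E.
       \<bar>D a v - D b v - H (a - b) v\<bar> \<le> \<eta> * norm (a - b) * norm v"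
  shows "\<exists>r>0. \<exists>m>0. r \<le> r0 \<and> (\<forall>a\<in>E \<inter> cball q r. \<forall>b\<in>E \<inter> cball q r.
      H (a - b) (X a - X b) \<le> - m * (norm (a - b))\<^sup>2 \<and> m * norm (a - b) \<le> norm (X a - X b))"
proof -
  obtain \<beta> where \<beta>: "\<beta> > 0" "\<And>a. a \<in> E \<Longrightarrow> \<exists>v\<in>E. norm v \<le> 1 \<and> \<beta> * norm a \<le> H a v"
    using nondegenerate_lower_bound[OF E H nd] by auto
  define \<beta>1 where "\<beta>1 = \<beta> / (2 * M)"
  have b1: "\<beta>1 > 0" using \<beta> M by (simp add: \<beta>1_def)
  \<comment> \<open>the first bound makes \<open>\<beta>1 |\<delta>| \<le> |w|\<close>, the second lets coercivity absorb the error in \<open>H \<delta> w\<close>\<close>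
  define \<epsilon> where "\<epsilon> = min (\<beta> / 2) (l * \<beta>1 / 2)"
  have eps: "\<epsilon> > 0" using \<beta> l b1 by (simp add: \<epsilon>_def)
  obtain r1 where r1: "r1 > 0" "\<And>a b v. a \<in> E \<inter> cball q r1 \<Longrightarrow> b \<in> E \<inter> cball q r1 \<Longrightarrow> v \<in> E \<Longrightarrow>
     \<bar>D a v - D b v - H (a - b) v\<bar> \<le> \<epsilon> / 2 * norm (a - b) * norm v"
    using strict[of "\<epsilon> / 2"] eps by (metis half_gt_zero)
  define c where "c = M * (lip_const + 1)"
  have c: "c > 0" using M lip_const_nonneg by (simp add: c_def)
  \<comment> \<open>on this ball \<open>M |X|\<close> is at most \<open>\<epsilon> / 2\<close>, because \<open>X q = 0\<close>\<close>
  define r where "r = min (min r0 r1) (\<epsilon> / (2 * c))"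
  have r: "r > 0" "r \<le> r0" "r \<le> r1" using r0 r1 eps c by (auto simp: r_def)
  have rM: "M * (lip_const * r) \<le> \<epsilon> / 2"
  proof -
    have "M * (lip_const * r) \<le> M * ((lip_const + 1) * r)"
      using M r by (intro mult_left_mono mult_right_mono) auto
    also have "\<dots> = c * r" by (simp add: c_def)
    also have "\<dots> \<le> c * (\<epsilon> / (2 * c))"
      using c by (intro mult_left_mono) (auto simp: r_def)
    also have "\<dots> = \<epsilon> / 2" using c by simp
    finally show ?thesis .
  qed
  define m where "m = min \<beta>1 (l / 2 * \<beta>1\<^sup>2)"
  have m: "m > 0" using b1 l by (simp add: m_def)
  have key: "H (a - b) (X a - X b) \<le> - m * (norm (a - b))\<^sup>2 \<and> m * norm (a - b) \<le> norm (X a - X b)"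
    if a: "a \<in> E \<inter> cball q r" and b: "b \<in> E \<inter> cball q r" for a b
  proof -
    have aS: "a \<in> S" and bS: "b \<in> S" and aE: "a \<in> E" and bE: "b \<in> E" using a b r r0(2) by auto
    define w where "w = X a - X b"
    define \<delta> where "\<delta> = a - b"
    have wE: "w \<in> E" and dE: "\<delta> \<in> E" unfolding w_def \<delta>_def using X_in aS bS aE bE E by (auto intro: subspace_diff)
    have est: "\<bar>H \<delta> v + G a w v\<bar> \<le> \<epsilon> * norm \<delta> * norm v" if v: "v \<in> E" for v
    proof -
      have "G a w v = - (D a v - D b v) - (G a (X b) v - G b (X b) v)"
        using G_diff[OF aS X_in[OF aS] X_in[OF bS] v] equation[OF aS v] equation[OF bS v] by (simp add: w_def)
      moreover have "\<bar>D a v - D b v - H \<delta> v\<bar> \<le> \<epsilon> / 2 * norm \<delta> * norm v"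
        unfolding \<delta>_def using a b r v by (intro r1) auto
      moreover have "\<bar>G a (X b) v - G b (X b) v\<bar> \<le> \<epsilon> / 2 * norm \<delta> * norm v"
      proof -
        have "norm (X b) \<le> lip_const * norm (b - q)" using X_lipschitz[OF bS q(1)] q(2) by simp
        also have "\<dots> \<le> lip_const * r"
          using b lip_const_nonneg by (intro mult_left_mono) (auto simp: dist_norm norm_minus_commute)
        finally have "M * norm (X b) \<le> M * (lip_const * r)" using M by (intro mult_left_mono) auto
        then have Xb: "M * norm (X b) \<le> \<epsilon> / 2" using rM by simp
        have "\<bar>G a (X b) v - G b (X b) v\<bar> \<le> (M * norm (X b)) * norm v * norm \<delta>"
          using second_lip_lipschitz[OF G_lip[OF X_in[OF bS] v] aS bS] by (simp add: \<delta>_def)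
        also have "\<dots> \<le> (\<epsilon> / 2) * norm v * norm \<delta>"
          by (intro mult_right_mono Xb) auto
        finally show ?thesis by (simp add: mult_ac)
      qed
      ultimately show ?thesis by linarith
    qed
    have low: "\<beta>1 * norm \<delta> \<le> norm w"
    proof -
      obtain v where v: "v \<in> E" "norm v \<le> 1" "\<beta> * norm \<delta> \<le> H \<delta> v" using \<beta>(2)[OF dE] by blast
      have "\<bar>G a w v\<bar> \<le> M * norm w * norm v" using second_lip_bound[OF G_lip[OF wE v(1)] aS] by simp
      also have "\<dots> \<le> M * norm w" using v(2) M by (simp add: mult_left_le)
      finally have 1: "\<bar>G a w v\<bar> \<le> M * norm w" .
      have "\<epsilon> * norm \<delta> * norm v \<le> \<epsilon> * norm \<delta>" using v(2) eps by (simp add: mult_left_le)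
      also have "\<dots> \<le> \<beta> / 2 * norm \<delta>" by (intro mult_right_mono) (auto simp: \<epsilon>_def)
      finally have "\<beta> / 2 * norm \<delta> \<le> M * norm w" using 1 est[OF v(1)] v(3) by (simp add: abs_le_iff)
      then show ?thesis using M by (simp add: \<beta>1_def field_simps)
    qed
    have "m * norm \<delta> \<le> \<beta>1 * norm \<delta>" by (intro mult_right_mono) (auto simp: m_def)
    with low have 1: "m * norm \<delta> \<le> norm w" by simp
    have "H \<delta> w \<le> - G a w w + \<epsilon> * norm \<delta> * norm w" using est[OF wE] by (simp add: abs_le_iff)
    also have "- G a w w \<le> - l * (norm w)\<^sup>2" using coercive[OF aS wE] by simp
    also have "\<epsilon> * norm \<delta> * norm w \<le> l / 2 * (norm w)\<^sup>2"
    proof -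
      have "\<epsilon> * norm \<delta> \<le> l / 2 * (\<beta>1 * norm \<delta>)"
        using mult_right_mono[OF min.cobounded2, of "norm \<delta>" "\<beta> / 2" "l * \<beta>1 / 2"] by (simp add: \<epsilon>_def mult_ac)
      also have "\<dots> \<le> l / 2 * norm w" using low l by (intro mult_left_mono) auto
      finally have "\<epsilon> * norm \<delta> * norm w \<le> l / 2 * norm w * norm w" by (intro mult_right_mono) auto
      then show ?thesis by (simp add: power2_eq_square)
    qed
    finally have "H \<delta> w \<le> - (l / 2 * (norm w)\<^sup>2)" by simp
    also have "\<dots> \<le> - (l / 2 * (\<beta>1 * norm \<delta>)\<^sup>2)"
      using low b1 l by (intro le_imp_neg_le mult_left_mono power_mono) auto
    also have "\<dots> \<le> - (m * (norm \<delta>)\<^sup>2)"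
      unfolding power_mult_distrib mult.assoc[symmetric]
      by (intro le_imp_neg_le mult_right_mono) (auto simp: m_def)
    finally show ?thesis using 1 by (simp add: w_def \<delta>_def)
  qed
  show ?thesis using r m key by blast
qed

end

text \<open>
\<open>H(\<delta>, \<delta>)\<close> and \<open>H(\<delta>, \<delta>) - \<kappa> |\<delta>|\<^sup>2\<close> are both decreasing. The second tends to zero, hence
is non-negative, and so the first dominates \<open>|\<delta>|\<^sup>2\<close>, although \<open>H\<close> itself may be indefinite.
Being also at most \<open>K |\<delta>|\<^sup>2\<close>, it decays exponentially.
\<close>

lemma exponential_contraction:
  fixes \<delta> :: "real \<Rightarrow> 'e::real_inner"
  assumes der: "\<And>t. T \<le> t \<Longrightarrow> (\<delta> has_vector_derivative w t) (at t)"
    and lim: "(\<delta> \<longlongrightarrow> 0) at_top"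
    and H: "bounded_bilinear H" "\<And>u v. H u v = H v u" "\<And>u v. \<bar>H u v\<bar> \<le> K * norm u * norm v"
    and K: "0 < K" and m: "0 < m" and L: "0 \<le> L"
    and w: "\<And>t. T \<le> t \<Longrightarrow> norm (w t) \<le> L * norm (\<delta> t)"
    and decay: "\<And>t. T \<le> t \<Longrightarrow> H (\<delta> t) (w t) \<le> - m * (norm (\<delta> t))\<^sup>2"
    and t: "T \<le> t"
  shows "norm (\<delta> t) \<le> sqrt (K * (L + 1) / m) * norm (\<delta> T) * exp (- (m / K) * (t - T))"
proof -
  interpret H: bounded_bilinear H by (rule H)
  define Q where "Q s = H (\<delta> s) (\<delta> s)" for s
  \<comment> \<open>any \<open>\<kappa> > 0\<close> with \<open>\<kappa> L \<le> m\<close> works; \<open>L + 1\<close> avoids a division by zero\<close>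
  define \<kappa> where "\<kappa> = m / (L + 1)"
  have \<kappa>: "\<kappa> > 0" "\<kappa> * L \<le> m" using m L by (auto simp: \<kappa>_def field_simps)
  have dQ: "(Q has_field_derivative 2 * H (\<delta> s) (w s)) (at s)" if "T \<le> s" for s
  proof -
    have "(Q has_derivative (\<lambda>r. H (\<delta> s) (r *\<^sub>R w s) + H (r *\<^sub>R w s) (\<delta> s))) (at s)"
      unfolding Q_def[abs_def] using der[OF that] unfolding has_vector_derivative_def
      by (intro H.FDERIV)
    then show ?thesis unfolding has_field_derivative_def
      by (rule has_derivative_eq_rhs) (auto simp: H.scaleR_left H.scaleR_right H(2)[of "w s"])
  qed
  have dN: "((\<lambda>s. \<delta> s \<bullet> \<delta> s) has_field_derivative 2 * (\<delta> s \<bullet> w s)) (at s)" if "T \<le> s" for s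
  proof -
    have "((\<lambda>s. \<delta> s \<bullet> \<delta> s) has_derivative (\<lambda>r. \<delta> s \<bullet> (r *\<^sub>R w s) + (r *\<^sub>R w s) \<bullet> \<delta> s)) (at s)"
      using der[OF that] unfolding has_vector_derivative_def by (intro has_derivative_inner)
    then show ?thesis unfolding has_field_derivative_def
      by (rule has_derivative_eq_rhs) (auto simp: inner_commute)
  qed
  have pos: "\<kappa> * (norm (\<delta> s))\<^sup>2 \<le> Q s" if s: "T \<le> s" for s
  proof -
    define \<psi> where "\<psi> r = Q r - \<kappa> * (\<delta> r \<bullet> \<delta> r)" for r
    have mono: "\<psi> r \<le> \<psi> s" if "s \<le> r" for r
    proof (rule DERIV_nonpos_imp_nonincreasing[of s r \<psi>, OF that])
      fix x assume x: "s \<le> x" "x \<le> r"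
      then have Tx: "T \<le> x" using s by simp
      have "(\<psi> has_field_derivative 2 * H (\<delta> x) (w x) - \<kappa> * (2 * (\<delta> x \<bullet> w x))) (at x)"
        unfolding \<psi>_def[abs_def] by (intro DERIV_diff dQ[OF Tx] DERIV_cmult dN[OF Tx])
      moreover have "2 * H (\<delta> x) (w x) - \<kappa> * (2 * (\<delta> x \<bullet> w x)) \<le> 0"
      proof -
        have "\<bar>\<delta> x \<bullet> w x\<bar> \<le> norm (\<delta> x) * norm (w x)" by (rule Cauchy_Schwarz_ineq2)
        also have "\<dots> \<le> norm (\<delta> x) * (L * norm (\<delta> x))" by (intro mult_left_mono w Tx) auto
        finally have "\<kappa> * - (\<delta> x \<bullet> w x) \<le> \<kappa> * (L * (norm (\<delta> x))\<^sup>2)"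
          using \<kappa> by (intro mult_left_mono) (auto simp: power2_eq_square mult_ac)
        also have "\<dots> \<le> m * (norm (\<delta> x))\<^sup>2"
          using mult_right_mono[OF \<kappa>(2), of "(norm (\<delta> x))\<^sup>2"] by simp
        finally show ?thesis using decay[OF Tx] by simp
      qed
      ultimately show "\<exists>y. (\<psi> has_field_derivative y) (at x) \<and> y \<le> 0" by blast
    qed
    have "(\<psi> \<longlongrightarrow> H 0 0 - \<kappa> * ((0::'e) \<bullet> 0)) at_top"
      unfolding \<psi>_def Q_def by (rule tendsto_diff[OF H.tendsto[OF lim lim] tendsto_mult[OF tendsto_const tendsto_inner[OF lim lim]]])
    then have "(\<psi> \<longlongrightarrow> 0) at_top" by (simp add: H.zero_left)
    moreover have "\<forall>\<^sub>F r in at_top. \<psi> r \<le> \<psi> s"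
      using eventually_ge_at_top[of s] by eventually_elim (rule mono)
    ultimately have "0 \<le> \<psi> s" by (intro tendsto_upperbound[of \<psi> 0 at_top]) auto
    then show ?thesis by (simp add: \<psi>_def dot_square_norm)
  qed
  have Qle: "Q s \<le> K * (norm (\<delta> s))\<^sup>2" for s
    using H(3)[of "\<delta> s" "\<delta> s"] by (simp add: Q_def power2_eq_square mult.assoc)
  \<comment> \<open>\<open>2 m / K\<close> is the rate at which \<open>H(\<delta>, \<delta>)\<close> decays\<close>
  define \<phi> where "\<phi> s = Q s * exp ((2 * m / K) * (s - T))" for s
  have "\<phi> t \<le> \<phi> T"
  proof (rule DERIV_nonpos_imp_nonincreasing[of T t \<phi>, OF t])
    fix x assume x: "T \<le> x" "x \<le> t"
    have "(\<phi> has_field_derivative (2 * H (\<delta> x) (w x) + (2 * m / K) * Q x) * exp ((2 * m / K) * (x - T))) (at x)"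
      using K unfolding \<phi>_def[abs_def] by (auto intro!: derivative_eq_intros dQ x simp: algebra_simps)
    moreover have "2 * H (\<delta> x) (w x) + (2 * m / K) * Q x \<le> 0"
    proof -
      have "(2 * m / K) * Q x \<le> (2 * m / K) * (K * (norm (\<delta> x))\<^sup>2)"
        using m K by (intro mult_left_mono Qle) auto
      then show ?thesis using decay[OF x(1)] K by simp
    qed
    ultimately show "\<exists>y. (\<phi> has_field_derivative y) (at x) \<and> y \<le> 0"
      by (blast intro: mult_nonpos_nonneg exp_ge_zero)
  qed
  then have "Q t * exp ((2 * m / K) * (t - T)) * exp (- (2 * m / K) * (t - T)) \<le> Q T * exp (- (2 * m / K) * (t - T))"
    unfolding \<phi>_def by (intro mult_right_mono) auto
  then have "Q t \<le> Q T * exp (- (2 * m / K) * (t - T))"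
    by (simp add: mult.assoc exp_add[symmetric])
  also have "\<dots> \<le> K * (norm (\<delta> T))\<^sup>2 * exp (- (2 * m / K) * (t - T))"
    by (intro mult_right_mono Qle) auto
  finally have "\<kappa> * (norm (\<delta> t))\<^sup>2 \<le> K * (norm (\<delta> T))\<^sup>2 * exp (- (2 * m / K) * (t - T))"
    using pos[OF t] by simp
  then have "(norm (\<delta> t))\<^sup>2 \<le> K / \<kappa> * (norm (\<delta> T))\<^sup>2 * exp (- (2 * m / K) * (t - T))"
    using \<kappa> by (simp add: field_simps)
  also have "\<dots> = (sqrt (K * (L + 1) / m) * norm (\<delta> T) * exp (- (m / K) * (t - T)))\<^sup>2"
    using K L m unfolding power_mult_distrib exp_double[symmetric] by (simp add: \<kappa>_def)
  finally show ?thesis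
    by (rule power2_le_imp_le) (use K L m in simp)
qed

section \<open>Derivatives within a subspace\<close>

lemma has_derivative_compose_nhd:
  assumes f: "(f has_derivative f') (at x within S)" and g: "(g has_derivative g') (at (f x) within T)"
    and N: "open N" "x \<in> N" "\<And>y. y \<in> S \<Longrightarrow> y \<in> N \<Longrightarrow> f y \<in> T"
  shows "((\<lambda>x. g (f x)) has_derivative (\<lambda>v. g' (f' v))) (at x within S)"
proof -
  have eq: "at x within (S \<inter> N) = at x within S"
    using N by (intro at_within_nhd[of x N]) auto
  have "(f has_derivative f') (at x within (S \<inter> N))" using f eq by simp
  moreover have "(g has_derivative g') (at (f x) within f ` (S \<inter> N))"
    using g by (rule has_derivative_subset) (use N in auto)
  ultimately have "((\<lambda>x. g (f x)) has_derivative (\<lambda>v. g' (f' v))) (at x within (S \<inter> N))"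
    by (rule has_derivative_in_compose)
  then show ?thesis by (simp only: eq)
qed

lemma has_derivative_transform_nhd:
  assumes f: "(f has_derivative f') (at x within S)" and "x \<in> S"
    and N: "open N" "x \<in> N" "\<And>y. y \<in> S \<Longrightarrow> y \<in> N \<Longrightarrow> f y = g y"
  shows "(g has_derivative f') (at x within S)"
proof -
  obtain e where e: "e > 0" "ball x e \<subseteq> N" using N open_contains_ball by blast
  show ?thesis
  proof (rule has_derivative_transform_within[OF f e(1) assms(2)])
    fix y assume "y \<in> S" "dist y x < e"
    then show "f y = g y" using e(2) by (intro N(3)) (auto simp: dist_commute)
  qed
qed

text \<open>
Derivatives within a subspace can be tested along curves in that subspace; most identities between
differentials below are obtained in this way.
\<close>

lemma has_vector_derivative_compose_nhd:
  fixes c :: "real \<Rightarrow> 'a::real_normed_vector"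
  assumes c: "(c has_vector_derivative v) (at t)" and F: "(F has_derivative L) (at (c t) within E)"
    and N: "open N" "t \<in> N" "\<And>s. s \<in> N \<Longrightarrow> c s \<in> E"
  shows "((\<lambda>s. F (c s)) has_vector_derivative L v) (at t)"
proof -
  have "((\<lambda>s. F (c s)) has_derivative (\<lambda>r. L (r *\<^sub>R v))) (at t)"
    by (rule has_derivative_compose_nhd[OF c[unfolded has_vector_derivative_def] F N(1,2)]) (use N(3) in auto)
  then show ?thesis
    unfolding has_vector_derivative_def
    by (simp add: linear_cmul[OF has_derivative_linear[OF F]])
qed

lemma isCont_open_nhd:
  assumes "isCont \<gamma> t" "open S" "\<gamma> t \<in> S"
  shows "\<exists>N. open N \<and> t \<in> N \<and> (\<forall>s\<in>N. \<gamma> s \<in> S)"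
proof -
  have "(\<gamma> \<longlongrightarrow> \<gamma> t) (nhds t)"
    using assms(1) by (simp add: isCont_def tendsto_at_iff_tendsto_nhds)
  from topological_tendstoD[OF this assms(2,3)] show ?thesis
    unfolding eventually_nhds by blast
qed

lemma line_has_vector_derivative: "((\<lambda>s. z + s *\<^sub>R v) has_vector_derivative v) (at t)"
  unfolding has_vector_derivative_def by (auto intro!: derivative_eq_intros)

lemma has_derivative_within_subspace_unique:
  assumes E: "subspace E" "z \<in> E" "v \<in> E"
    and L: "(F has_derivative L) (at z within E)" "(F has_derivative L') (at z within E)"
  shows "L v = L' v"
proof -
  have 1: "((\<lambda>s::real. F (z + s *\<^sub>R v)) has_vector_derivative K v) (at 0)"
    if "(F has_derivative K) (at z within E)" for K
    using has_vector_derivative_compose_nhd[of "\<lambda>s. z + s *\<^sub>R v" v 0 F K E UNIV]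
      line_has_vector_derivative that E by (auto intro: subspace_add subspace_scale)
  show ?thesis using vector_derivative_unique_at[OF 1[OF L(1)] 1[OF L(2)]] .
qed

lemma frechet_derivative_within_subspace:
  assumes "subspace E" "z \<in> E" "v \<in> E" "(F has_derivative L) (at z within E)"
  shows "frechet_derivative F (at z within E) v = L v"
  using has_derivative_within_subspace_unique[OF assms(1-3) _ assms(4)] differentiableI[OF assms(4)]
  by (simp add: frechet_derivative_works)

lemma vector_derivative_difference_quotient:
  fixes c :: "real \<Rightarrow> 'a::real_normed_vector"
  assumes "(c has_vector_derivative v) (at t)"
  shows "((\<lambda>s. (c s - c t) /\<^sub>R (s - t)) \<longlongrightarrow> v) (at t)"
proof -
  have "((\<lambda>s. (1 / norm (s - t)) *\<^sub>R (c s - (c t + (s - t) *\<^sub>R v))) \<longlongrightarrow> 0) (at t)"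
    using assms by (simp add: has_vector_derivative_def has_derivative_within)
  then have "((\<lambda>s. norm ((1 / norm (s - t)) *\<^sub>R (c s - (c t + (s - t) *\<^sub>R v)))) \<longlongrightarrow> 0) (at t)"
    by (rule tendsto_norm_zero)
  moreover have eq: "norm ((1 / norm (s - t)) *\<^sub>R (c s - (c t + (s - t) *\<^sub>R v))) = norm ((c s - c t) /\<^sub>R (s - t) - v)"
    if "s \<noteq> t" for s
  proof -
    have "(c s - c t) /\<^sub>R (s - t) - v = (1 / (s - t)) *\<^sub>R (c s - (c t + (s - t) *\<^sub>R v))"
      using that by (simp add: scaleR_diff_right scaleR_add_right divide_inverse diff_diff_eq)
    then show ?thesis by simp
  qed
  have "\<forall>\<^sub>F s in at t. norm ((1 / norm (s - t)) *\<^sub>R (c s - (c t + (s - t) *\<^sub>R v))) = norm ((c s - c t) /\<^sub>R (s - t) - v)"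
    unfolding eventually_at_filter by (intro always_eventually) (use eq in blast)
  ultimately have "((\<lambda>s. norm ((c s - c t) /\<^sub>R (s - t) - v)) \<longlongrightarrow> 0) (at t)"
    by (blast intro: Lim_transform_eventually)
  then show ?thesis
    by (simp add: tendsto_norm_zero_iff LIM_zero_iff)
qed

lemma vector_derivative_norm_le:
  fixes \<beta> :: "real \<Rightarrow> 'a::real_normed_vector" and \<gamma> :: "real \<Rightarrow> 'b::real_normed_vector"
  assumes "(\<beta> has_vector_derivative b) (at t)" "(\<gamma> has_vector_derivative c) (at t)"
    and le: "\<forall>\<^sub>F s in at t. norm (\<beta> s - \<beta> t) \<le> K * norm (\<gamma> s - \<gamma> t)"
  shows "norm b \<le> K * norm c"
proof (rule tendsto_le[OF trivial_limit_at])
  show "((\<lambda>s. norm ((\<beta> s - \<beta> t) /\<^sub>R (s - t))) \<longlongrightarrow> norm b) (at t)"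
    by (intro tendsto_norm vector_derivative_difference_quotient assms)
  show "((\<lambda>s. K * norm ((\<gamma> s - \<gamma> t) /\<^sub>R (s - t))) \<longlongrightarrow> K * norm c) (at t)"
    by (intro tendsto_mult tendsto_const tendsto_norm vector_derivative_difference_quotient assms)
  show "\<forall>\<^sub>F s in at t. norm ((\<beta> s - \<beta> t) /\<^sub>R (s - t)) \<le> K * norm ((\<gamma> s - \<gamma> t) /\<^sub>R (s - t))"
    using le
  proof eventually_elim
    case (elim s)
    have "\<bar>inverse (s - t)\<bar> * norm (\<beta> s - \<beta> t) \<le> \<bar>inverse (s - t)\<bar> * (K * norm (\<gamma> s - \<gamma> t))"
      by (intro mult_left_mono elim) auto
    then show ?case by (simp add: mult_ac)
  qed
qed

lemma vector_derivative_in_subspace: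
  fixes c :: "real \<Rightarrow> 'a::euclidean_space"
  assumes E: "subspace E" and c: "(c has_vector_derivative v) (at t)"
    and N: "open N" "t \<in> N" "\<And>s. s \<in> N \<Longrightarrow> c s \<in> E"
  shows "v \<in> E"
proof (rule Lim_in_closed_set[OF closed_subspace[OF E]])
  show "((\<lambda>s. (c s - c t) /\<^sub>R (s - t)) \<longlongrightarrow> v) (at t)"
    by (rule vector_derivative_difference_quotient[OF c])
  show "\<forall>\<^sub>F s in at t. (c s - c t) /\<^sub>R (s - t) \<in> E"
    using eventually_at_in_open'[OF N(1,2)]
    by eventually_elim (use N E in \<open>auto intro!: subspace_scale subspace_diff\<close>)
qed auto

lemma linear_on_subspace_expansion:
  fixes v :: "'e::euclidean_space" and \<phi> :: "'e \<Rightarrow> 'b::real_vector"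
  assumes "\<And>a b. a \<in> E \<Longrightarrow> b \<in> E \<Longrightarrow> \<phi> (a + b) = \<phi> a + \<phi> b"
    and "\<And>r a. a \<in> E \<Longrightarrow> \<phi> (r *\<^sub>R a) = r *\<^sub>R \<phi> a"
    and P: "linear P" "\<And>v. P v \<in> E" and v: "P v = v"
  shows "\<phi> v = (\<Sum>i\<in>Basis. (v \<bullet> i) *\<^sub>R \<phi> (P i))"
proof -
  have lin: "linear (\<lambda>u. \<phi> (P u))"
    by (rule linearI) (simp_all add: linear_add[OF P(1)] linear_cmul[OF P(1)] assms(1,2) P(2))
  have "\<phi> v = \<phi> (P (\<Sum>i\<in>Basis. (v \<bullet> i) *\<^sub>R i))" by (simp add: euclidean_representation v)
  also have "\<dots> = (\<Sum>i\<in>Basis. (v \<bullet> i) *\<^sub>R \<phi> (P i))"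
    by (simp only: linear_sum[OF lin] linear_cmul[OF lin])
  finally show ?thesis .
qed

text \<open>
The form is only given on \<open>E\<close>. Adding \<open>(w - P w) \<bullet> (v - P v)\<close> for a projection \<open>P\<close> onto \<open>E\<close>
extends it to a positive definite form on the whole space, where an injective linear map is surjective.
\<close>

lemma riesz_on_subspace:
  fixes E :: "'e::euclidean_space set" and \<gamma> :: "'e \<Rightarrow> 'e \<Rightarrow> real"
  assumes E: "subspace E"
    and add: "\<And>a b v. a \<in> E \<Longrightarrow> b \<in> E \<Longrightarrow> v \<in> E \<Longrightarrow> \<gamma> (a + b) v = \<gamma> a v + \<gamma> b v"
    and scale: "\<And>r a v. a \<in> E \<Longrightarrow> v \<in> E \<Longrightarrow> \<gamma> (r *\<^sub>R a) v = r * \<gamma> a v"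
    and sym: "\<And>a b. a \<in> E \<Longrightarrow> b \<in> E \<Longrightarrow> \<gamma> a b = \<gamma> b a"
    and pos: "\<And>a. a \<in> E \<Longrightarrow> a \<noteq> 0 \<Longrightarrow> \<gamma> a a > 0"
    and \<phi>: "\<And>a b. a \<in> E \<Longrightarrow> b \<in> E \<Longrightarrow> \<phi> (a + b) = \<phi> a + \<phi> b" "\<And>r a. a \<in> E \<Longrightarrow> \<phi> (r *\<^sub>R a) = r * \<phi> a"
  shows "\<exists>!w. w \<in> E \<and> (\<forall>v\<in>E. \<gamma> w v = \<phi> v)"
proof -
  obtain P K where P: "linear P" "\<And>v. P v \<in> E" "\<And>v. v \<in> E \<Longrightarrow> P v = v"
    and "1 \<le> K" "\<And>v. norm (P v) \<le> K * norm v"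
    using subspace_projection[OF E] by blast
  define S where "S w = (\<Sum>i\<in>Basis. (\<gamma> (P w) (P i) + (w - P w) \<bullet> (i - P i)) *\<^sub>R i)" for w
  have addr: "\<gamma> a (u + v) = \<gamma> a u + \<gamma> a v" if "a \<in> E" "u \<in> E" "v \<in> E" for a u v
    unfolding sym[OF that(1) subspace_add[OF E that(2,3)]] sym[OF that(1,2)] sym[OF that(1,3)]
    by (rule add[OF that(2,3,1)])
  have scaler: "\<gamma> a (r *\<^sub>R u) = r * \<gamma> a u" if "a \<in> E" "u \<in> E" for a u r
    unfolding sym[OF that(1) subspace_scale[OF E that(2)]] sym[OF that(1,2)] by (rule scale[OF that(2,1)])
  have expand: "\<gamma> a v = (\<Sum>i\<in>Basis. (v \<bullet> i) *\<^sub>R \<gamma> a (P i))" if "a \<in> E" "v \<in> E" for a v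
    by (rule linear_on_subspace_expansion[where E = E]) (use that P addr scaler in auto)
  have P0: "P 0 = 0" using linear_0[OF P(1)] .
  have S: "S w \<bullet> v = \<gamma> (P w) (P v) + (w - P w) \<bullet> (v - P v)" for w v
  proof -
    have lin: "linear (\<lambda>v. \<gamma> (P w) (P v) + (w - P w) \<bullet> (v - P v))"
      by (rule linearI) (simp_all add: addr scaler P(2) linear_add[OF P(1)] linear_cmul[OF P(1)]
          inner_add_right inner_diff_right algebra_simps)
    have "\<gamma> (P w) (P v) + (w - P w) \<bullet> (v - P v) = (\<lambda>v. \<gamma> (P w) (P v) + (w - P w) \<bullet> (v - P v)) (\<Sum>i\<in>Basis. (v \<bullet> i) *\<^sub>R i)"
      by (simp add: euclidean_representation)
    also have "\<dots> = (\<Sum>i\<in>Basis. (v \<bullet> i) * (\<gamma> (P w) (P i) + (w - P w) \<bullet> (i - P i)))"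
      by (simp only: linear_sum[OF lin] linear_cmul[OF lin] real_scaleR_def)
    finally show ?thesis by (simp add: S_def inner_sum_left inner_commute[of v] mult.commute)
  qed
  have lin: "linear S"
    by (rule linearI) (simp_all add: S_def add scale P(2) linear_add[OF P(1)] linear_cmul[OF P(1)]
        inner_add_left inner_diff_left algebra_simps sum.distrib scaleR_sum_right sum_subtractf)
  have "inj S"
    unfolding linear_injective_0[OF lin]
  proof (intro allI impI)
    fix w assume "S w = 0"
    then have 0: "\<gamma> (P w) (P w) + (w - P w) \<bullet> (w - P w) = 0" using S[of w w] by simp
    have "\<gamma> (P w) (P w) \<ge> 0"
      using pos[OF P(2), of w] scale[OF P(2) P(2), of 0 w w] by (cases "P w = 0") auto
    then have "w - P w = 0" "\<gamma> (P w) (P w) = 0" using 0 inner_ge_zero[of "w - P w"] by (auto simp: add_nonneg_eq_0_iff)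
    then show "w = 0" using pos[OF P(2), of w] by auto
  qed
  then have "surj S" using linear_injective_imp_surjective[OF lin] by blast
  then obtain w where w: "S w = (\<Sum>i\<in>Basis. \<phi> (P i) *\<^sub>R i)" by (metis surjD)
  have eq: "\<gamma> (P w) v = \<phi> v" if v: "v \<in> E" for v
  proof -
    have "\<phi> v = (\<Sum>i\<in>Basis. (v \<bullet> i) *\<^sub>R \<phi> (P i))"
      using P v \<phi> by (intro linear_on_subspace_expansion[where E = E]) auto
    also have "\<dots> = S w \<bullet> v" by (simp add: w inner_sum_left inner_commute[of v] mult.commute)
    also have "\<dots> = \<gamma> (P w) v" using S[of w v] P(3)[OF v] by simp
    finally show ?thesis by simp
  qed
  show ?thesis
  proof (rule ex1I[of _ "P w"])
    fix w' assume w': "w' \<in> E \<and> (\<forall>v\<in>E. \<gamma> w' v = \<phi> v)"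
    have d: "w' + (-1) *\<^sub>R P w \<in> E" using w' P(2) E by (intro subspace_add subspace_scale) auto
    have "\<gamma> (w' + (-1) *\<^sub>R P w) v = 0" if v: "v \<in> E" for v
    proof -
      have "\<gamma> (w' + (-1) *\<^sub>R P w) v = \<gamma> w' v + \<gamma> ((-1) *\<^sub>R P w) v"
        by (rule add) (use w' v P(2) E in \<open>auto intro: subspace_neg\<close>)
      also have "\<dots> = \<gamma> w' v + (-1) * \<gamma> (P w) v" by (simp only: scale[OF P(2) v])
      finally show ?thesis using w' eq[OF v] v by simp
    qed
    from this[OF d] have "w' + (-1) *\<^sub>R P w = 0" using pos[OF d] by force
    then show "w' = P w" by simp
  qed (use P(2) eq in auto)
qed

lemma openin_nhd:
  fixes E :: "'a::topological_space set"
  assumes "openin (top_of_set E) S" "q \<in> S"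
  obtains N where "open N" "q \<in> N" "E \<inter> N \<subseteq> S" "S \<subseteq> E"
  using assms by (auto simp: openin_open)

text \<open>
On a relatively open set a local smooth extension represents the derivatives within \<open>E\<close> at all
nearby points simultaneously, which gives access to higher derivatives.
\<close>

lemma smooth_on_extension:
  fixes E :: "'e::euclidean_space set" and h :: "'e \<Rightarrow> 'b::real_normed_vector"
  assumes h: "smooth_on S h" and S: "openin (top_of_set E) S" and q: "q \<in> S"
  obtains U H where "open U" "q \<in> U" "\<And>k. Ck_on k U H" "E \<inter> U \<subseteq> S" "\<And>y. y \<in> E \<inter> U \<Longrightarrow> H y = h y"
    "\<And>y. y \<in> E \<inter> U \<Longrightarrow> (h has_derivative frechet_derivative H (at y)) (at y within E)"
proof -
  obtain U H where U: "open U" "q \<in> U" "\<And>k. Ck_on k U H" "\<And>y. y \<in> U \<inter> S \<Longrightarrow> H y = h y"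
    using h[unfolded smooth_on_def, rule_format, OF q] by blast
  obtain N where N: "open N" "q \<in> N" "E \<inter> N \<subseteq> S" using openin_nhd[OF S q] by metis
  define W where "W = U \<inter> N"
  have CW: "Ck_on k W H" for k by (rule Ck_on_subset[OF U(3)]) (simp add: W_def)
  have W: "open W" "q \<in> W" "E \<inter> W \<subseteq> S" "\<And>y. y \<in> E \<inter> W \<Longrightarrow> H y = h y"
    using U N by (auto simp: W_def)
  have "(h has_derivative frechet_derivative H (at y)) (at y within E)" if y: "y \<in> E \<inter> W" for y
  proof (rule has_derivative_transform_nhd[where N = W])
    show "(H has_derivative frechet_derivative H (at y)) (at y within E)"
      by (rule has_derivative_at_withinI[OF Ck_on_differentiable[OF CW]]) (use y in simp)
  qed (use y W in auto)
  then show ?thesis using that[OF W(1,2) CW W(3,4)] by blast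
qed

lemma smooth_on_has_derivative:
  fixes E :: "'e::euclidean_space set" and h :: "'e \<Rightarrow> 'b::real_normed_vector"
  assumes "smooth_on S h" "openin (top_of_set E) S" "y \<in> S"
  shows "(h has_derivative frechet_derivative h (at y within E)) (at y within E)"
proof -
  have "y \<in> E" using assms openin_subset by fastforce
  obtain U H where "open U" "y \<in> U" "(h has_derivative frechet_derivative H (at y)) (at y within E)"
    using smooth_on_extension[OF assms] \<open>y \<in> E\<close> by (metis IntI)
  then show ?thesis using frechet_derivative_works differentiableI by blast
qed

section \<open>Charts and coordinate changes\<close>

locale manifold_atlas =
  fixes E :: "'e::euclidean_space set" and A :: "('m::{t2_space, second_countable_topology}, 'e) chart set"
  assumes manifold: "smooth_manifold E A"
begin

lemma subspace_E: "subspace E"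
  using manifold by (simp add: smooth_manifold_def)

lemma chart:
  assumes "c \<in> A"
  shows "open (chart_dom c)" "openin (top_of_set E) (chart_image c)"
    "homeomorphism (chart_dom c) (chart_image c) (coord c) (chart_inv c)"
  using manifold assms by (auto simp: smooth_manifold_def is_chart_def)

lemma chart_image_subset: "c \<in> A \<Longrightarrow> chart_image c \<subseteq> E"
  using openin_subset[OF chart(2)] by simp

lemma chart_coord:
  assumes "c \<in> A" "x \<in> chart_dom c"
  shows "coord c x \<in> chart_image c" "coord c x \<in> E" "chart_inv c (coord c x) = x"
  using homeomorphism_apply1[OF chart(3)[OF assms(1)] assms(2)] assms(2) chart_image_subset[OF assms(1)]
  by (auto simp: chart_image_def)

lemma chart_inverse:
  assumes "c \<in> A" "y \<in> chart_image c"
  shows "chart_inv c y \<in> chart_dom c" "coord c (chart_inv c y) = y"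
  using homeomorphism_apply2[OF chart(3)[OF assms(1)] assms(2)] homeomorphism_image2[OF chart(3)[OF assms(1)]] assms(2)
  by auto

lemma chart_at: "chart_at A x \<in> A" "x \<in> chart_dom (chart_at A x)"
proof -
  have "x \<in> (\<Union>c\<in>A. chart_dom c)" using manifold by (simp add: smooth_manifold_def)
  then have "\<exists>c. c \<in> A \<and> x \<in> chart_dom c" by auto
  from someI_ex[OF this] show "chart_at A x \<in> A" "x \<in> chart_dom (chart_at A x)"
    by (auto simp: chart_at_def)
qed

lemma continuous_coord: "c \<in> A \<Longrightarrow> continuous_on (chart_dom c) (coord c)"
  using chart(3) by (auto simp: homeomorphism_def)

lemma continuous_chart_inv: "c \<in> A \<Longrightarrow> continuous_on (chart_image c) (chart_inv c)"
  using chart(3) by (auto simp: homeomorphism_def)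

lemma isCont_coord: "c \<in> A \<Longrightarrow> x \<in> chart_dom c \<Longrightarrow> isCont (coord c) x"
  using continuous_coord chart(1) by (simp add: continuous_on_eq_continuous_at)

definition overlap :: "('m, 'e) chart \<Rightarrow> ('m, 'e) chart \<Rightarrow> 'e set" where
  "overlap c c' = coord c ` (chart_dom c \<inter> chart_dom c')"

lemma overlap_openin: "c \<in> A \<Longrightarrow> c' \<in> A \<Longrightarrow> openin (top_of_set E) (overlap c c')"
  unfolding overlap_def
  by (metis chart homeomorphism_imp_open_map open_openin openin_open_Int openin_trans)

lemma overlap_iff:
  assumes "c \<in> A"
  shows "y \<in> overlap c c' \<longleftrightarrow> y \<in> chart_image c \<and> chart_inv c y \<in> chart_dom c'"
proof
  assume "y \<in> overlap c c'"
  then obtain x where "y = coord c x" "x \<in> chart_dom c" "x \<in> chart_dom c'" by (auto simp: overlap_def)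
  then show "y \<in> chart_image c \<and> chart_inv c y \<in> chart_dom c'" using chart_coord[OF assms, of x] by simp
next
  assume "y \<in> chart_image c \<and> chart_inv c y \<in> chart_dom c'"
  then show "y \<in> overlap c c'" using chart_inverse[OF assms, of y] by (force simp: overlap_def)
qed

text \<open>
Indexed by the point of the manifold, rather than by its coordinates, so that successive coordinate
changes at a fixed point compose without changing the base point.
\<close>

definition transition_deriv :: "('m, 'e) chart \<Rightarrow> ('m, 'e) chart \<Rightarrow> 'm \<Rightarrow> 'e \<Rightarrow> 'e" where
  "transition_deriv c c' x = frechet_derivative (coord c' \<circ> chart_inv c) (at (coord c x) within E)"

lemma transition_smooth: "c \<in> A \<Longrightarrow> c' \<in> A \<Longrightarrow> smooth_on (overlap c c') (coord c' \<circ> chart_inv c)"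
  using manifold by (simp add: smooth_manifold_def overlap_def)

lemma transition_has_derivative:
  assumes "c \<in> A" "c' \<in> A" "x \<in> chart_dom c" "x \<in> chart_dom c'"
  shows "((coord c' \<circ> chart_inv c) has_derivative transition_deriv c c' x) (at (coord c x) within E)"
  unfolding transition_deriv_def
  by (rule smooth_on_has_derivative[OF transition_smooth overlap_openin]) (use assms in \<open>auto simp: overlap_def\<close>)

lemma overlap_nhd:
  assumes "c \<in> A" "c' \<in> A" "x \<in> chart_dom c" "x \<in> chart_dom c'"
  obtains N where "open N" "coord c x \<in> N"
    "\<And>y. y \<in> E \<Longrightarrow> y \<in> N \<Longrightarrow> y \<in> chart_image c \<and> chart_inv c y \<in> chart_dom c'"
proof -
  have "coord c x \<in> overlap c c'" using assms by (auto simp: overlap_def)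
  from openin_nhd[OF overlap_openin[OF assms(1,2)] this]
  obtain N where "open N" "coord c x \<in> N" "E \<inter> N \<subseteq> overlap c c'" by metis
  then show ?thesis using that[of N] by (simp add: overlap_iff[OF assms(1)] subset_iff)
qed

lemma transition_deriv_in:
  assumes "c \<in> A" "c' \<in> A" "x \<in> chart_dom c" "x \<in> chart_dom c'" and v: "v \<in> E"
  shows "transition_deriv c c' x v \<in> E"
proof -
  obtain N where N: "open N" "coord c x \<in> N"
    "\<And>y. y \<in> E \<Longrightarrow> y \<in> N \<Longrightarrow> y \<in> chart_image c \<and> chart_inv c y \<in> chart_dom c'"
    using overlap_nhd[OF assms(1-4)] by metis
  have x: "coord c x \<in> E" using assms chart_coord by auto
  have lin: "coord c x + s *\<^sub>R v \<in> E" for s using x v subspace_E by (auto intro: subspace_add subspace_scale)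
  let ?c = "\<lambda>s::real. (coord c' \<circ> chart_inv c) (coord c x + s *\<^sub>R v)"
  have der: "(?c has_vector_derivative transition_deriv c c' x v) (at 0)"
    using has_vector_derivative_compose_nhd[OF line_has_vector_derivative, of "coord c' \<circ> chart_inv c" _ "coord c x" 0 v E UNIV]
      transition_has_derivative[OF assms(1-4)] lin by simp
  have "open ((\<lambda>s::real. coord c x + s *\<^sub>R v) -` N)"
    by (intro open_vimage N continuous_intros)
  then show ?thesis
    by (rule vector_derivative_in_subspace[OF subspace_E der]) (use N lin assms chart_coord in auto)
qed

lemma transition_deriv_add:
  assumes "c \<in> A" "c' \<in> A" "x \<in> chart_dom c" "x \<in> chart_dom c'"
  shows "transition_deriv c c' x (u + v) = transition_deriv c c' x u + transition_deriv c c' x v"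
    "transition_deriv c c' x (r *\<^sub>R u) = r *\<^sub>R transition_deriv c c' x u"
    "transition_deriv c c' x (u - v) = transition_deriv c c' x u - transition_deriv c c' x v"
proof -
  interpret linear "transition_deriv c c' x"
    by (rule has_derivative_linear[OF transition_has_derivative[OF assms]])
  show "transition_deriv c c' x (u + v) = transition_deriv c c' x u + transition_deriv c c' x v"
    "transition_deriv c c' x (r *\<^sub>R u) = r *\<^sub>R transition_deriv c c' x u"
    "transition_deriv c c' x (u - v) = transition_deriv c c' x u - transition_deriv c c' x v"
    by (simp_all add: add scale diff)
qed

lemma transition_chain:
  assumes c: "c \<in> A" "c' \<in> A" and x: "x \<in> chart_dom c" "x \<in> chart_dom c'" and v: "v \<in> E"
    and F: "((F \<circ> chart_inv c') has_derivative L) (at (coord c' x) within E)"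
  shows "((F \<circ> chart_inv c) has_derivative (\<lambda>v. L (transition_deriv c c' x v))) (at (coord c x) within E)"
proof -
  obtain N where N: "open N" "coord c x \<in> N"
    "\<And>y. y \<in> E \<Longrightarrow> y \<in> N \<Longrightarrow> y \<in> chart_image c \<and> chart_inv c y \<in> chart_dom c'"
    using overlap_nhd[OF c x] by metis
  have xE: "coord c x \<in> E" using c x chart_coord by auto
  have "((\<lambda>y. (F \<circ> chart_inv c') ((coord c' \<circ> chart_inv c) y)) has_derivative (\<lambda>v. L (transition_deriv c c' x v)))
      (at (coord c x) within E)"
  proof (rule has_derivative_compose_nhd[OF transition_has_derivative[OF c x] _ N(1,2)])
    show "(F \<circ> chart_inv c' has_derivative L) (at ((coord c' \<circ> chart_inv c) (coord c x)) within E)"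
      using F c x chart_coord by simp
    fix y assume "y \<in> E" "y \<in> N"
    then show "(coord c' \<circ> chart_inv c) y \<in> E" using N(3) chart_coord c by simp
  qed
  then show ?thesis
    by (rule has_derivative_transform_nhd[OF _ xE N(1,2)]) (use N(3) c chart_coord in auto)
qed

lemma transition_deriv_trans:
  assumes c: "c \<in> A" "c' \<in> A" "c'' \<in> A" and x: "x \<in> chart_dom c" "x \<in> chart_dom c'" "x \<in> chart_dom c''" and v: "v \<in> E"
  shows "transition_deriv c' c'' x (transition_deriv c c' x v) = transition_deriv c c'' x v"
proof -
  have xE: "coord c x \<in> E" using c x chart_coord by auto
  have "((coord c'' \<circ> chart_inv c) has_derivative (\<lambda>v. transition_deriv c' c'' x (transition_deriv c c' x v))) (at (coord c x) within E)"
    using transition_chain[OF c(1,2) x(1,2) v transition_has_derivative[OF c(2,3) x(2,3)]] .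
  from has_derivative_within_subspace_unique[OF subspace_E xE v this transition_has_derivative[OF c(1,3) x(1,3)]]
  show ?thesis .
qed

lemma transition_deriv_self:
  assumes c: "c \<in> A" and x: "x \<in> chart_dom c" and v: "v \<in> E"
  shows "transition_deriv c c x v = v"
proof -
  have xE: "coord c x \<in> E" using c x chart_coord by auto
  obtain N where N: "open N" "coord c x \<in> N"
    "\<And>y. y \<in> E \<Longrightarrow> y \<in> N \<Longrightarrow> y \<in> chart_image c \<and> chart_inv c y \<in> chart_dom c"
    using overlap_nhd[OF c c x x] by metis
  have "((coord c \<circ> chart_inv c) has_derivative (\<lambda>v. v)) (at (coord c x) within E)"
    by (rule has_derivative_transform_nhd[OF has_derivative_ident xE N(1,2)]) (use N(3) c chart_inverse in auto)
  from has_derivative_within_subspace_unique[OF subspace_E xE v transition_has_derivative[OF c c x x] this]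
  show ?thesis .
qed

lemma transition_deriv_inverse:
  assumes "c \<in> A" "c' \<in> A" "x \<in> chart_dom c" "x \<in> chart_dom c'" "v \<in> E"
  shows "transition_deriv c' c x (transition_deriv c c' x v) = v"
  using transition_deriv_trans[of c c' c x v] transition_deriv_self assms by simp

lemma tangent_of_eq:
  assumes "c \<in> A" "x \<in> chart_dom c"
  shows "tangent_of E A c (coord c x) = transition_deriv c (chart_at A x) x"
  using chart_coord[OF assms] by (simp add: tangent_of_def[abs_def] transition_deriv_def)

lemma curve_chart_change:
  assumes c: "c \<in> A" "c' \<in> A" and \<gamma>: "isCont \<gamma> t" "\<gamma> t \<in> chart_dom c" "\<gamma> t \<in> chart_dom c'"
    and der: "((coord c \<circ> \<gamma>) has_vector_derivative w) (at t)"
  shows "((coord c' \<circ> \<gamma>) has_vector_derivative transition_deriv c c' (\<gamma> t) w) (at t)"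
proof -
  have "open (chart_dom c \<inter> chart_dom c')" using chart(1)[OF c(1)] chart(1)[OF c(2)] by (rule open_Int)
  then obtain N where N: "open N" "t \<in> N" "\<And>s. s \<in> N \<Longrightarrow> \<gamma> s \<in> chart_dom c \<inter> chart_dom c'"
    using isCont_open_nhd[OF \<gamma>(1), of "chart_dom c \<inter> chart_dom c'"] \<gamma>(2,3) by auto
  have "((\<lambda>s. (coord c' \<circ> chart_inv c) ((coord c \<circ> \<gamma>) s)) has_vector_derivative transition_deriv c c' (\<gamma> t) w) (at t)"
  proof (rule has_vector_derivative_compose_nhd[OF der _ N(1,2)])
    show "(coord c' \<circ> chart_inv c has_derivative transition_deriv c c' (\<gamma> t)) (at ((coord c \<circ> \<gamma>) t) within E)"
      using transition_has_derivative[OF c \<gamma>(2,3)] by simp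
    fix s assume "s \<in> N"
    then show "(coord c \<circ> \<gamma>) s \<in> E" using N(3)[of s] chart_coord(2)[OF c(1), of "\<gamma> s"] by simp
  qed
  then show ?thesis
  proof (rule has_vector_derivative_transform_within_open[OF _ N(1,2)])
    fix s assume "s \<in> N"
    then show "(coord c' \<circ> chart_inv c) ((coord c \<circ> \<gamma>) s) = (coord c' \<circ> \<gamma>) s"
      using N(3)[of s] chart_coord(3)[OF c(1), of "\<gamma> s"] by simp
  qed
qed

lemma coordinate_ball_iff:
  assumes c: "c \<in> A" and sub: "E \<inter> cball q r \<subseteq> chart_image c"
  shows "x \<in> chart_inv c ` (E \<inter> cball q r) \<longleftrightarrow> x \<in> chart_dom c \<and> coord c x \<in> cball q r"
proof
  assume "x \<in> chart_inv c ` (E \<inter> cball q r)"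
  then obtain y where y: "x = chart_inv c y" "y \<in> E \<inter> cball q r" by blast
  then have "y \<in> chart_image c" using sub by blast
  then show "x \<in> chart_dom c \<and> coord c x \<in> cball q r"
    using chart_inverse[OF c, of y] y by simp
next
  assume x: "x \<in> chart_dom c \<and> coord c x \<in> cball q r"
  then have "coord c x \<in> E \<inter> cball q r" "x = chart_inv c (coord c x)"
    using chart_coord[OF c, of x] by simp_all
  then show "x \<in> chart_inv c ` (E \<inter> cball q r)" by blast
qed

lemma coordinate_ball_closed:
  assumes c: "c \<in> A" and sub: "E \<inter> cball q r \<subseteq> chart_image c"
  shows "closed (chart_inv c ` (E \<inter> cball q r))"
proof -
  have "compact (E \<inter> cball q r)" using closed_subspace[OF subspace_E] by (intro closed_Int_compact) auto
  then show ?thesis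
    using continuous_on_subset[OF continuous_chart_inv[OF c] sub]
    by (intro compact_imp_closed compact_continuous_image)
qed

lemma coordinate_ball_open:
  assumes c: "c \<in> A"
  shows "open (chart_dom c \<inter> coord c -` ball q r)"
  by (rule continuous_open_preimage[OF continuous_coord[OF c] chart(1)[OF c] open_ball])

end

section \<open>The gradient in a chart\<close>

locale gradient_system = manifold_atlas E A
  for E :: "'e::euclidean_space set" and A :: "('m::{t2_space, second_countable_topology}, 'e) chart set" +
  fixes g :: "'m \<Rightarrow> 'e \<Rightarrow> 'e \<Rightarrow> real" and f :: "'m \<Rightarrow> real" and \<Phi> :: "'m \<Rightarrow> real \<Rightarrow> 'm"
  assumes metric: "riemannian_metric E A g"
    and morse: "morse E A f"
    and flow: "negative_gradient_flow E A g f \<Phi>"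
begin

lemma metric_sym: "a \<in> E \<Longrightarrow> b \<in> E \<Longrightarrow> g x a b = g x b a"
  and metric_add: "a \<in> E \<Longrightarrow> a' \<in> E \<Longrightarrow> b \<in> E \<Longrightarrow> g x (a + a') b = g x a b + g x a' b"
  and metric_scale: "a \<in> E \<Longrightarrow> b \<in> E \<Longrightarrow> g x (r *\<^sub>R a) b = r * g x a b"
  and metric_pos: "a \<in> E \<Longrightarrow> a \<noteq> 0 \<Longrightarrow> g x a a > 0"
  and metric_smooth: "c \<in> A \<Longrightarrow> a \<in> E \<Longrightarrow> b \<in> E \<Longrightarrow> smooth_on (chart_image c)
        (\<lambda>y. g (chart_inv c y) (tangent_of E A c y a) (tangent_of E A c y b))"
  using metric unfolding riemannian_metric_def by blast+

lemma smooth_f: "c \<in> A \<Longrightarrow> smooth_on (chart_image c) (f \<circ> chart_inv c)"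
  using morse by (auto simp: morse_def smooth_function_def)

definition local_df :: "('m, 'e) chart \<Rightarrow> 'e \<Rightarrow> 'e \<Rightarrow> real" where
  "local_df c y = frechet_derivative (f \<circ> chart_inv c) (at y within E)"

definition local_metric :: "('m, 'e) chart \<Rightarrow> 'e \<Rightarrow> 'e \<Rightarrow> 'e \<Rightarrow> real" where
  "local_metric c y u v = g (chart_inv c y) (tangent_of E A c y u) (tangent_of E A c y v)"

text \<open>
The coordinates of the negative gradient in an arbitrary chart.
\<close>

definition local_field :: "('m, 'e) chart \<Rightarrow> 'e \<Rightarrow> 'e" where
  "local_field c y = transition_deriv (chart_at A (chart_inv c y)) c (chart_inv c y)
     (- gradient E A g f (chart_inv c y))"

lemma local_df_has_derivative:
  "c \<in> A \<Longrightarrow> y \<in> chart_image c \<Longrightarrow> ((f \<circ> chart_inv c) has_derivative local_df c y) (at y within E)"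
  unfolding local_df_def by (rule smooth_on_has_derivative[OF smooth_f chart(2)])

lemma dfun_eq_local_df: "dfun E A f x = local_df (chart_at A x) (coord (chart_at A x) x)"
  by (simp add: fun_eq_iff dfun_def local_df_def)

lemma dfun_has_derivative:
  "((f \<circ> chart_inv (chart_at A x)) has_derivative dfun E A f x) (at (coord (chart_at A x) x) within E)"
  unfolding dfun_eq_local_df by (rule local_df_has_derivative[OF chart_at(1) chart_coord(1)[OF chart_at]])

lemma local_df_eq_dfun:
  assumes c: "c \<in> A" and x: "x \<in> chart_dom c" and v: "v \<in> E"
  shows "local_df c (coord c x) v = dfun E A f x (transition_deriv c (chart_at A x) x v)"
  by (rule has_derivative_within_subspace_unique[OF subspace_E chart_coord(2)[OF c x] v
        local_df_has_derivative[OF c chart_coord(1)[OF c x]]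
        transition_chain[OF c chart_at(1) x chart_at(2) v dfun_has_derivative]])

text \<open>
The definition by a unique choice is meaningful because the metric is a positive definite form on the
finite-dimensional space \<open>E\<close>.
\<close>

lemma gradient: "gradient E A g f x \<in> E" "v \<in> E \<Longrightarrow> g x (gradient E A g f x) v = dfun E A f x v"
proof -
  interpret df: linear "dfun E A f x" by (rule has_derivative_linear[OF dfun_has_derivative])
  have "\<exists>!w. w \<in> E \<and> (\<forall>v\<in>E. g x w v = dfun E A f x v)"
    by (rule riesz_on_subspace[OF subspace_E])
      (auto simp: metric_add metric_scale metric_pos df.add df.scale intro: metric_sym)
  from theI'[OF this] show "gradient E A g f x \<in> E" "v \<in> E \<Longrightarrow> g x (gradient E A g f x) v = dfun E A f x v"
    by (auto simp: gradient_def)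
qed

lemma metric_minus: "a \<in> E \<Longrightarrow> b \<in> E \<Longrightarrow> g x (- a) b = - g x a b"
  using metric_scale[of a b x "-1"] by simp

lemma local_metric_eq:
  assumes "c \<in> A" "x \<in> chart_dom c"
  shows "local_metric c (coord c x) u v =
    g x (transition_deriv c (chart_at A x) x u) (transition_deriv c (chart_at A x) x v)"
  using chart_coord[OF assms] by (simp add: local_metric_def tangent_of_eq[OF assms])

lemma tangent_in: "c \<in> A \<Longrightarrow> x \<in> chart_dom c \<Longrightarrow> v \<in> E \<Longrightarrow> transition_deriv c (chart_at A x) x v \<in> E"
  by (rule transition_deriv_in[OF _ chart_at(1) _ chart_at(2)])

lemma local_field_at: "c \<in> A \<Longrightarrow> x \<in> chart_dom c \<Longrightarrow>
   local_field c (coord c x) = transition_deriv (chart_at A x) c x (- gradient E A g f x)"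
  by (simp add: local_field_def chart_coord)

lemma local_field_in: "c \<in> A \<Longrightarrow> x \<in> chart_dom c \<Longrightarrow> local_field c (coord c x) \<in> E"
  unfolding local_field_at
  by (rule transition_deriv_in[OF chart_at(1) _ chart_at(2)]) (auto intro: subspace_neg[OF subspace_E] gradient)

text \<open>
The equation characterising the gradient is natural, so it holds verbatim in the coordinates of every
chart.
\<close>

lemma local_equation:
  assumes c: "c \<in> A" and x: "x \<in> chart_dom c" and v: "v \<in> E"
  shows "local_metric c (coord c x) (local_field c (coord c x)) v = - local_df c (coord c x) v"
proof -
  have "transition_deriv c (chart_at A x) x (local_field c (coord c x)) = - gradient E A g f x"
    unfolding local_field_at[OF c x]
    by (rule transition_deriv_inverse[OF chart_at(1) c chart_at(2) x]) (intro subspace_neg[OF subspace_E] gradient)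
  then show ?thesis
    by (simp add: local_metric_eq[OF c x] metric_minus[OF gradient(1) tangent_in[OF c x v]]
        gradient(2)[OF tangent_in[OF c x v]] local_df_eq_dfun[OF c x v])
qed

lemma local_metric_add:
  assumes c: "c \<in> A" and y: "y \<in> chart_image c" and E: "u \<in> E" "v \<in> E" "w \<in> E"
  shows "local_metric c y (u + v) w = local_metric c y u w + local_metric c y v w"
    "local_metric c y (r *\<^sub>R u) w = r * local_metric c y u w"
    "local_metric c y u w = local_metric c y w u"
    "local_metric c y (u - v) w = local_metric c y u w - local_metric c y v w"
    "u \<noteq> 0 \<Longrightarrow> local_metric c y u u > 0"
proof -
  obtain x where x: "x \<in> chart_dom c" and yx: "y = coord c x"
    using chart_inverse[OF c y] by metis
  note t = transition_deriv_add[OF c chart_at(1) x chart_at(2)]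
  note tin = tangent_in[OF c x]
  show add: "local_metric c y (u + v) w = local_metric c y u w + local_metric c y v w"
    unfolding yx local_metric_eq[OF c x] t by (intro metric_add tin E)
  show scale: "local_metric c y (r *\<^sub>R u) w = r * local_metric c y u w"
    unfolding yx local_metric_eq[OF c x] t by (intro metric_scale tin E)
  show "local_metric c y u w = local_metric c y w u"
    unfolding yx local_metric_eq[OF c x] by (intro metric_sym tin E)
  have "local_metric c y (u - v) w = local_metric c y u w + g x (- transition_deriv c (chart_at A x) x v) (transition_deriv c (chart_at A x) x w)"
    unfolding yx local_metric_eq[OF c x] t diff_conv_add_uminus[of "transition_deriv c (chart_at A x) x u"]
    by (intro metric_add tin E subspace_neg[OF subspace_E])
  then show "local_metric c y (u - v) w = local_metric c y u w - local_metric c y v w"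
    using metric_minus[OF tin[OF E(2)] tin[OF E(3)]] by (simp add: yx local_metric_eq[OF c x])
  show "local_metric c y u u > 0" if "u \<noteq> 0"
    unfolding yx local_metric_eq[OF c x]
  proof (rule metric_pos[OF tin[OF E(1)]])
    show "transition_deriv c (chart_at A x) x u \<noteq> 0"
    proof
      assume "transition_deriv c (chart_at A x) x u = 0"
      then have "transition_deriv (chart_at A x) c x 0 = u"
        using transition_deriv_inverse[OF c chart_at(1) x chart_at(2) E(1)] by simp
      then show False using that transition_deriv_add(2)[OF chart_at(1) c chart_at(2) x, of 0 0] by simp
    qed
  qed
qed

lemma smooth_on_eventually_second_lip:
  fixes h :: "'e \<Rightarrow> real"
  assumes h: "smooth_on S h" and S: "openin (top_of_set E) S" and q: "q \<in> S"
  shows "\<forall>\<^sub>F r in at_right 0. \<exists>M. second_lip M (E \<inter> cball q r) h"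
proof -
  obtain U H where U: "open U" "q \<in> U" "\<And>k. Ck_on k U H" "\<And>y. y \<in> E \<inter> U \<Longrightarrow> H y = h y"
    using smooth_on_extension[OF assms] by metis
  show ?thesis
    using small_cball_subset[OF U(1,2)]
  proof eventually_elim
    case (elim r)
    obtain M where M: "second_lip M (cball q r) H"
      using Ck_on_2_second_lip[OF U(3) elim compact_cball convex_cball] by blast
    have "second_lip M (E \<inter> cball q r) h"
      by (rule second_lip_mono[OF M]) (use U(4) elim in auto)
    then show ?case ..
  qed
qed

lemma local_df_extension:
  assumes c: "c \<in> A" and q: "q \<in> chart_image c"
  obtains U H where "open U" "q \<in> U" "\<And>k. Ck_on k U H" "E \<inter> U \<subseteq> chart_image c"
    "\<And>y v. y \<in> E \<inter> U \<Longrightarrow> v \<in> E \<Longrightarrow> local_df c y v = frechet_derivative H (at y) v"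
proof -
  obtain U H where U: "open U" "q \<in> U" "\<And>k. Ck_on k U H" "E \<inter> U \<subseteq> chart_image c"
    and der: "\<And>y. y \<in> E \<inter> U \<Longrightarrow> ((f \<circ> chart_inv c) has_derivative frechet_derivative H (at y)) (at y within E)"
    using smooth_on_extension[OF smooth_f[OF c] chart(2)[OF c] q] by metis
  have "local_df c y v = frechet_derivative H (at y) v" if y: "y \<in> E \<inter> U" and v: "v \<in> E" for y v
    unfolding local_df_def by (rule frechet_derivative_within_subspace[OF subspace_E _ v der[OF y]]) (use y in simp)
  then show ?thesis using that[OF U] by blast
qed

lemma local_df_eventually_second_lip:
  assumes c: "c \<in> A" and q: "q \<in> chart_image c" and v: "v \<in> E"
  shows "\<forall>\<^sub>F r in at_right 0. \<exists>M. second_lip M (E \<inter> cball q r) (\<lambda>y. local_df c y v)"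
proof -
  obtain U H where U: "open U" "q \<in> U" "\<And>k. Ck_on k U H"
     and eq: "\<And>y v. y \<in> E \<inter> U \<Longrightarrow> v \<in> E \<Longrightarrow> local_df c y v = frechet_derivative H (at y) v"
    using local_df_extension[OF c q] by metis
  have C2: "Ck_on 2 U (\<lambda>y. frechet_derivative H (at y) v)"
    using U(3)[of "Suc 2"] unfolding Ck_on.simps(2) by blast
  show ?thesis
    using small_cball_subset[OF U(1,2)]
  proof eventually_elim
    case (elim r)
    obtain M where M: "second_lip M (cball q r) (\<lambda>y. frechet_derivative H (at y) v)"
      using Ck_on_2_second_lip[OF C2 elim compact_cball convex_cball] by blast
    have "second_lip M (E \<inter> cball q r) (\<lambda>y. local_df c y v)"
      by (rule second_lip_mono[OF M]) (use eq v elim in auto)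
    then show ?case ..
  qed
qed

text \<open>
The quadratic form attains a minimum on the unit sphere of \<open>E\<close>, which is empty if the manifold has
dimension zero.
\<close>

lemma local_metric_coercive_at:
  assumes c: "c \<in> A" and q: "q \<in> chart_image c"
  shows "\<exists>l>0. \<forall>u\<in>E. l * (norm u)\<^sup>2 \<le> local_metric c q u u"
proof (cases "E \<inter> sphere 0 1 = {}")
  case True
  have "u = 0" if "u \<in> E" for u
  proof (rule ccontr)
    assume "u \<noteq> 0"
    then have "u /\<^sub>R norm u \<in> E \<inter> sphere 0 1" using that subspace_E by (simp add: subspace_scale)
    with True show False by blast
  qed
  moreover have "local_metric c q 0 0 = 0"
    using local_metric_add(2)[OF c q, of 0 0 0 0] subspace_0[OF subspace_E] by simp
  ultimately show ?thesis by (intro exI[of _ 1]) fastforce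
next
  case False
  note m = local_metric_add[OF c q]
  obtain P K where P: "linear P" "\<And>v. P v \<in> E" "\<And>v. v \<in> E \<Longrightarrow> P v = v"
    and K: "K \<ge> 1" "\<And>v. norm (P v) \<le> K * norm v"
    using subspace_projection[OF subspace_E] by blast
  define \<phi> where "\<phi> u = (\<Sum>i\<in>Basis. (u \<bullet> i) * (\<Sum>j\<in>Basis. (u \<bullet> j) * local_metric c q (P j) (P i)))" for u
  have \<phi>: "local_metric c q u u = \<phi> u" if u: "u \<in> E" for u
  proof -
    have left: "local_metric c q u w = (\<Sum>j\<in>Basis. (u \<bullet> j) *\<^sub>R local_metric c q (P j) w)" if w: "w \<in> E" for w
      by (rule linear_on_subspace_expansion[where E = E and \<phi> = "\<lambda>u. local_metric c q u w"])
        (use P u w m in auto)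
    have "local_metric c q u u = (\<Sum>j\<in>Basis. (u \<bullet> j) * local_metric c q (P j) u)" using left[OF u] by simp
    also have "\<dots> = (\<Sum>j\<in>Basis. (u \<bullet> j) * local_metric c q u (P j))" by (simp only: m(3)[OF P(2) u u])
    also have "\<dots> = \<phi> u" unfolding \<phi>_def using left[OF P(2)] by simp
    finally show ?thesis .
  qed
  have "continuous_on (E \<inter> sphere 0 1) \<phi>"
    unfolding \<phi>_def by (intro continuous_intros)
  moreover have "compact (E \<inter> sphere 0 1)" using closed_subspace[OF subspace_E] by (intro closed_Int_compact) auto
  ultimately obtain u0 where u0: "u0 \<in> E \<inter> sphere 0 1" "\<And>u. u \<in> E \<inter> sphere 0 1 \<Longrightarrow> \<phi> u0 \<le> \<phi> u"
    using continuous_attains_inf[OF _ False] by metis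
  have pos: "\<phi> u0 > 0"
  proof -
    have "u0 \<in> E" "u0 \<noteq> 0" using u0(1) by auto
    then show ?thesis using \<phi>[of u0] m(5)[of u0 u0 u0] by simp
  qed
  have "\<phi> u0 * (norm u)\<^sup>2 \<le> local_metric c q u u" if u: "u \<in> E" for u
  proof (cases "u = 0")
    case True
    then show ?thesis using m(2)[of 0 0 0 0] subspace_0[OF subspace_E] by simp
  next
    case False
    define w where "w = u /\<^sub>R norm u"
    have w: "w \<in> E" "w \<in> E \<inter> sphere 0 1" using False u subspace_E by (auto simp: w_def subspace_scale)
    have uw: "u = norm u *\<^sub>R w" using False by (simp add: w_def)
    have wE: "norm u *\<^sub>R w \<in> E" using w subspace_E by (simp add: subspace_scale)
    have "local_metric c q u u = norm u * (norm u * local_metric c q w w)"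
    proof -
      have "local_metric c q (norm u *\<^sub>R w) (norm u *\<^sub>R w) = norm u * local_metric c q w (norm u *\<^sub>R w)"
        by (rule m(2)[OF w(1) w(1) wE])
      also have "local_metric c q w (norm u *\<^sub>R w) = local_metric c q (norm u *\<^sub>R w) w"
        by (rule m(3)[OF w(1) w(1) wE])
      also have "\<dots> = norm u * local_metric c q w w" by (rule m(2)[OF w(1) w(1) w(1)])
      finally show ?thesis using uw by simp
    qed
    moreover have "\<phi> u0 \<le> local_metric c q w w" using u0(2)[OF w(2)] \<phi>[OF w(1)] by simp
    then have "(norm u * norm u) * \<phi> u0 \<le> (norm u * norm u) * local_metric c q w w" by (intro mult_left_mono) auto
    ultimately show ?thesis by (simp add: power2_eq_square mult_ac)
  qed
  with pos show ?thesis by blast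
qed

text \<open>
Near every point the coordinate expressions satisfy the Euclidean estimates. Constants that are
uniform in the tangent vectors come from the finitely many smooth functions obtained by inserting
basis vectors, and the metric, being Lipschitz, stays coercive near \<open>q\<close>.
\<close>

lemma local_gradient_equation:
  assumes c: "c \<in> A" and q: "q \<in> chart_image c"
  shows "\<exists>r>0. \<exists>M l. E \<inter> cball q r \<subseteq> chart_image c \<and>
     gradient_equation E (E \<inter> cball q r) (local_df c) (local_metric c) (local_field c) M l"
proof -
  obtain P K where P: "linear P" "\<And>v. P v \<in> E" "\<And>v. v \<in> E \<Longrightarrow> P v = v"
    and K: "K \<ge> 1" "\<And>v. norm (P v) \<le> K * norm v"
    using subspace_projection[OF subspace_E] by blast
  have qE: "q \<in> E" using chart_image_subset[OF c] q by blast
  obtain l0 where l0: "l0 > 0" "\<And>u. u \<in> E \<Longrightarrow> l0 * (norm u)\<^sup>2 \<le> local_metric c q u u"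
    using local_metric_coercive_at[OF c q] by blast
  obtain N where N: "open N" "q \<in> N" "E \<inter> N \<subseteq> chart_image c"
    using openin_nhd[OF chart(2)[OF c] q] by metis
  have "\<forall>\<^sub>F r in at_right 0. 0 < r \<and> r < (1::real)" by (rule eventually_at_right_small) simp
  moreover note small_cball_subset[OF N(1,2)]
  moreover have "\<forall>\<^sub>F r in at_right 0. \<forall>i\<in>(Basis::'e set). \<exists>M. second_lip M (E \<inter> cball q r) (\<lambda>y. local_df c y (P i))"
    by (intro eventually_ball_finite ballI local_df_eventually_second_lip c q P) auto
  moreover have "\<forall>\<^sub>F r in at_right 0. \<forall>i\<in>(Basis::'e set). \<forall>j\<in>(Basis::'e set).
      \<exists>M. second_lip M (E \<inter> cball q r) (\<lambda>y. local_metric c y (P i) (P j))"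
    unfolding local_metric_def
    by (intro eventually_ball_finite ballI smooth_on_eventually_second_lip[OF metric_smooth chart(2)] c q P) auto
  ultimately have "\<forall>\<^sub>F r in at_right (0::real). 0 < r \<and> cball q r \<subseteq> N \<and>
     (\<forall>i\<in>(Basis::'e set). \<exists>M. second_lip M (E \<inter> cball q r) (\<lambda>y. local_df c y (P i))) \<and>
     (\<forall>i\<in>(Basis::'e set). \<forall>j\<in>(Basis::'e set). \<exists>M. second_lip M (E \<inter> cball q r) (\<lambda>y. local_metric c y (P i) (P j)))"
    by eventually_elim blast
  then obtain r0 where r0: "r0 > 0" "cball q r0 \<subseteq> N"
     and ex: "\<forall>i\<in>(Basis::'e set). \<exists>M. second_lip M (E \<inter> cball q r0) (\<lambda>y. local_df c y (P i))"
       "\<forall>i\<in>(Basis::'e set). \<forall>j\<in>(Basis::'e set). \<exists>M. second_lip M (E \<inter> cball q r0) (\<lambda>y. local_metric c y (P i) (P j))"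
    using eventually_happens'[OF trivial_limit_at_right_real] by blast
  define S0 where "S0 = E \<inter> cball q r0"
  have S0: "S0 \<subseteq> chart_image c" using N r0 by (auto simp: S0_def)
  obtain Md where Md: "\<And>i. i \<in> Basis \<Longrightarrow> second_lip (Md i * 1) S0 (\<lambda>y. local_df c y (P i))"
    using bchoice[OF ex(1)] by (auto simp: S0_def)
  have "\<forall>i\<in>(Basis::'e set). \<exists>M. \<forall>j\<in>Basis. second_lip (M j) S0 (\<lambda>y. local_metric c y (P i) (P j))"
    using ex(2) unfolding S0_def by (intro ballI bchoice) blast
  from bchoice[OF this]
  obtain Mg where Mg: "\<And>i j. i \<in> Basis \<Longrightarrow> j \<in> Basis \<Longrightarrow> second_lip (Mg i j * 1) S0 (\<lambda>y. local_metric c y (P i) (P j))"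
    by auto
  define M where "M = 1 + \<bar>\<Sum>i\<in>(Basis::'e set). Md i\<bar> + \<bar>\<Sum>i\<in>(Basis::'e set). \<Sum>j\<in>(Basis::'e set). Mg i j\<bar>"
  have M: "M \<ge> 1" "(\<Sum>i\<in>(Basis::'e set). Md i) \<le> M" "(\<Sum>i\<in>(Basis::'e set). \<Sum>j\<in>(Basis::'e set). Mg i j) \<le> M"
    by (auto simp: M_def)
  have D: "second_lip (M * norm v) S0 (\<lambda>y. local_df c y v)" if v: "v \<in> E" for v
  proof (rule second_lip_mono)
    show "second_lip ((\<Sum>i\<in>(Basis::'e set). Md i) * norm v * 1) S0 (\<lambda>y. local_df c y v)"
    proof (rule second_lip_expansion[OF Md])
      fix y assume "y \<in> S0"
      then have "linear (local_df c y)" using S0 by (intro has_derivative_linear[OF local_df_has_derivative[OF c]]) auto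
      then show "local_df c y v = (\<Sum>i\<in>Basis. (v \<bullet> i) *\<^sub>R local_df c y (P i))"
        by (intro linear_on_subspace_expansion[where E = E] P linear_add linear_cmul v)
    qed
    show "(\<Sum>i\<in>(Basis::'e set). Md i) * norm v * 1 \<le> M * norm v" using M by (simp add: mult_right_mono)
  qed auto
  have G: "second_lip (M * norm u * norm v) S0 (\<lambda>y. local_metric c y u v)" if u: "u \<in> E" and v: "v \<in> E" for u v
  proof (rule second_lip_mono)
    have 1: "second_lip ((\<Sum>j\<in>Basis. Mg i j) * norm v * 1) S0 (\<lambda>y. local_metric c y (P i) v)" if i: "i \<in> Basis" for i
    proof (rule second_lip_expansion[OF Mg[OF i]])
      fix y assume y: "y \<in> S0"
      then have y': "y \<in> chart_image c" using S0 by blast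
      note m = local_metric_add[OF c y']
      have sw: "local_metric c y (P i) w = local_metric c y w (P i)" if "w \<in> E" for w
        using m(3) that P(2) by blast
      have "local_metric c y v (P i) = (\<Sum>j\<in>Basis. (v \<bullet> j) *\<^sub>R local_metric c y (P j) (P i))"
        by (rule linear_on_subspace_expansion[where E = E and \<phi> = "\<lambda>v. local_metric c y v (P i)"])
          (use m P v in auto)
      then show "local_metric c y (P i) v = (\<Sum>j\<in>Basis. (v \<bullet> j) *\<^sub>R local_metric c y (P i) (P j))"
        using sw[OF v] sw[OF P(2)] by simp
    qed
    show "second_lip ((\<Sum>i\<in>Basis. \<Sum>j\<in>Basis. Mg i j) * norm u * norm v) S0 (\<lambda>y. local_metric c y u v)"
    proof (rule second_lip_expansion)
      show "second_lip ((\<Sum>j\<in>Basis. Mg i j) * norm v) S0 (\<lambda>y. local_metric c y (P i) v)" if "i \<in> Basis" for i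
        using 1[OF that] by simp
      fix y assume y: "y \<in> S0"
      then have y': "y \<in> chart_image c" using S0 by blast
      show "local_metric c y u v = (\<Sum>i\<in>Basis. (u \<bullet> i) *\<^sub>R local_metric c y (P i) v)"
        by (rule linear_on_subspace_expansion[where E = E and \<phi> = "\<lambda>u. local_metric c y u v"])
          (use local_metric_add[OF c y'] P u v in auto)
    qed
    show "(\<Sum>i\<in>Basis. \<Sum>j\<in>Basis. Mg i j) * norm u * norm v \<le> M * norm u * norm v"
      using M by (intro mult_right_mono) auto
  qed auto
  \<comment> \<open>on this ball the metric differs from its value at \<open>q\<close> by at most half of the coercivity constant \<open>l0\<close>\<close>
  define r where "r = min r0 (l0 / (2 * M))"
  have r: "r > 0" "r \<le> r0" "M * r \<le> l0 / 2"
  proof -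
    show "r > 0" "r \<le> r0" using r0 l0 M by (auto simp: r_def)
    have "M * r \<le> M * (l0 / (2 * M))" using M by (intro mult_left_mono) (auto simp: r_def)
    then show "M * r \<le> l0 / 2" using M by simp
  qed
  define S where "S = E \<inter> cball q r"
  have S: "S \<subseteq> S0" "S \<subseteq> chart_image c" using r S0 by (auto simp: S_def S0_def)
  have "gradient_equation E S (local_df c) (local_metric c) (local_field c) M (l0 / 2)"
  proof
    show "subspace E" "1 \<le> M" "0 < l0 / 2" using subspace_E M l0 by auto
    show "second_lip (M * norm v) S (\<lambda>y. local_df c y v)" if "v \<in> E" for v
      by (rule second_lip_mono[OF D[OF that]]) (use S in auto)
    show "second_lip (M * norm u * norm v) S (\<lambda>y. local_metric c y u v)" if "u \<in> E" "v \<in> E" for u v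
      by (rule second_lip_mono[OF G[OF that]]) (use S in auto)
    fix y assume y: "y \<in> S"
    then have y': "y \<in> chart_image c" using S by blast
    obtain x where x: "x \<in> chart_dom c" and yx: "y = coord c x"
      using chart_inverse[OF c y'] by metis
    show "local_field c y \<in> E" unfolding yx by (rule local_field_in[OF c x])
    show "local_metric c y (u - v) w = local_metric c y u w - local_metric c y v w"
      if "u \<in> E" "v \<in> E" "w \<in> E" for u v w by (rule local_metric_add(4)[OF c y' that])
    show "local_metric c y (local_field c y) v = - local_df c y v" if "v \<in> E" for v
      unfolding yx by (rule local_equation[OF c x that])
    show "l0 / 2 * (norm u)\<^sup>2 \<le> local_metric c y u u" if u: "u \<in> E" for u
    proof -
      have "\<bar>local_metric c y u u - local_metric c q u u\<bar> \<le> M * norm u * norm u * norm (y - q)"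
      proof -
        have "y \<in> S0" "q \<in> S0" using y S(1) qE r0(1) by (auto simp: S0_def)
        then show ?thesis using second_lip_lipschitz[OF G[OF u u], of y q] by simp
      qed
      also have "\<dots> \<le> M * norm u * norm u * r"
        using y M by (intro mult_left_mono) (auto simp: S_def dist_norm norm_minus_commute)
      also have "\<dots> = (M * r) * (norm u)\<^sup>2" by (simp add: power2_eq_square)
      also have "\<dots> \<le> l0 / 2 * (norm u)\<^sup>2" by (intro mult_right_mono r) auto
      finally show ?thesis using l0(2)[OF u] by linarith
    qed
  qed
  then show ?thesis using r(1) S by (auto simp: S_def)
qed

section \<open>The Hessian at a critical point\<close>

lemma critical_local_df:
  assumes "critical_point E A f p" "v \<in> E"
  shows "local_df (chart_at A p) (coord (chart_at A p) p) v = 0"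
  using assms by (simp add: critical_point_def dfun_eq_local_df)

text \<open>
The second derivative of a smooth extension of \<open>f\<close> agrees with the Hessian on \<open>E\<close>, is bilinear on the
whole space because it is linear in one argument and symmetric, and is a strict derivative of \<open>df\<close>,
uniformly in the direction.
\<close>

lemma hessian_form:
  assumes p: "critical_point E A f p"
  defines "c \<equiv> chart_at A p" and "q \<equiv> coord (chart_at A p) p"
  obtains H where "bounded_bilinear H" "\<And>u v. H u v = H v u"
    "\<And>a. a \<in> E \<Longrightarrow> (\<And>b. b \<in> E \<Longrightarrow> H a b = 0) \<Longrightarrow> a = 0"
    "\<And>\<eta>. 0 < \<eta> \<Longrightarrow> \<exists>r>0. \<forall>a\<in>E \<inter> cball q r. \<forall>b\<in>E \<inter> cball q r. \<forall>v\<in>E.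
       \<bar>local_df c a v - local_df c b v - H (a - b) v\<bar> \<le> \<eta> * norm (a - b) * norm v"
proof -
  have c: "c \<in> A" and q: "q \<in> chart_image c" and qE: "q \<in> E"
    using chart_at[of p] chart_coord[OF chart_at] by (auto simp: c_def q_def)
  obtain U F where U: "open U" "q \<in> U" "\<And>k. Ck_on k U F"
     and eq: "\<And>y v. y \<in> E \<inter> U \<Longrightarrow> v \<in> E \<Longrightarrow> local_df c y v = frechet_derivative F (at y) v"
    using local_df_extension[OF c q] by metis
  define H where "H u v = frechet_derivative (\<lambda>y. frechet_derivative F (at y) v) (at q) u" for u v
  have sym: "H u v = H v u" for u v
    unfolding H_def by (rule second_derivative_symmetric[OF U(1,2) U(3)])
  have der: "((\<lambda>y. frechet_derivative F (at y) v) has_derivative (\<lambda>u. H u v)) (at q)" for v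
  proof -
    have "Ck_on (Suc (Suc 0)) U F" by (rule U(3))
    then show ?thesis unfolding H_def using U(2) by (simp add: frechet_derivative_works)
  qed
  have lin: "linear (\<lambda>u. H u v)" for v by (rule has_derivative_linear[OF der])
  have lin': "linear (H u)" for u
  proof -
    have "H u = (\<lambda>v. H v u)" by (rule ext) (rule sym)
    then show ?thesis using lin[of u] by simp
  qed
  from lin lin' have bil: "bounded_bilinear H"
    by (simp add: bilinear_conv_bounded_bilinear[symmetric] bilinear_def)
  have der': "((\<lambda>y. local_df c y v) has_derivative (\<lambda>u. H u v)) (at q within E)" if v: "v \<in> E" for v
    by (rule has_derivative_transform_nhd[OF has_derivative_at_withinI[OF der] qE U(1,2)]) (use eq v in simp)
  have hess: "hessian E A f p a b = H b a" if "a \<in> E" "b \<in> E" for a b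
    unfolding hessian_def c_def[symmetric] q_def[symmetric]
    using frechet_derivative_within_subspace[OF subspace_E qE that(2) der'[OF that(1)]]
    by (simp add: local_df_def c_def q_def)
  have nd: "a = 0" if a: "a \<in> E" and 0: "\<And>b. b \<in> E \<Longrightarrow> H a b = 0" for a
  proof -
    have "\<forall>b\<in>E. hessian E A f p a b = 0" using hess[OF a] 0 sym by simp
    then show ?thesis using morse p a by (auto simp: morse_def)
  qed
  obtain P K where P: "linear P" "\<And>v. P v \<in> E" "\<And>v. v \<in> E \<Longrightarrow> P v = v"
    and K: "K \<ge> 1" "\<And>v. norm (P v) \<le> K * norm v"
    using subspace_projection[OF subspace_E] by blast
  have strict: "\<exists>r>0. \<forall>a\<in>E \<inter> cball q r. \<forall>b\<in>E \<inter> cball q r. \<forall>v\<in>E.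
       \<bar>local_df c a v - local_df c b v - H (a - b) v\<bar> \<le> \<eta> * norm (a - b) * norm v" if \<eta>: "0 < \<eta>" for \<eta>
  proof -
    define n where "n = real DIM('e)"
    have n: "n > 0" by (simp add: n_def)
    have "\<exists>r>0. \<forall>a\<in>E \<inter> cball q r. \<forall>b\<in>E \<inter> cball q r.
       norm (local_df c a v - local_df c b v - H (a - b) v) \<le> \<eta> / n * norm (a - b)" if v: "v \<in> E" for v
    proof -
      have "\<forall>\<^sub>F r in at_right (0::real). 0 < r \<and> r < 1" by (rule eventually_at_right_small) simp
      with local_df_eventually_second_lip[OF c q v]
      have "\<forall>\<^sub>F r in at_right (0::real). 0 < r \<and> (\<exists>M. second_lip M (E \<inter> cball q r) (\<lambda>y. local_df c y v))"
        by eventually_elim blast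
      then obtain r M where "r > 0" "second_lip M (E \<inter> cball q r) (\<lambda>y. local_df c y v)"
        using eventually_happens'[OF trivial_limit_at_right_real] by blast
      from second_lip_strict_derivative[OF subspace_E qE this der'[OF v] divide_pos_pos[OF \<eta> n]]
      show ?thesis .
    qed
    then have "\<forall>i\<in>(Basis::'e set). \<exists>r>0. \<forall>a\<in>E \<inter> cball q r. \<forall>b\<in>E \<inter> cball q r.
       norm (local_df c a (P i) - local_df c b (P i) - H (a - b) (P i)) \<le> \<eta> / n * norm (a - b)"
      using P(2) by blast
    from bchoice[OF this] obtain R where R: "\<And>i. i \<in> (Basis::'e set) \<Longrightarrow> R i > 0"
      "\<And>i a b. i \<in> (Basis::'e set) \<Longrightarrow> a \<in> E \<inter> cball q (R i) \<Longrightarrow> b \<in> E \<inter> cball q (R i) \<Longrightarrow>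
         norm (local_df c a (P i) - local_df c b (P i) - H (a - b) (P i)) \<le> \<eta> / n * norm (a - b)"
      by blast
    obtain rU where rU: "rU > 0" "cball q rU \<subseteq> U" using U open_contains_cball by blast
    define r where "r = min rU (Min (R ` Basis))"
    have r: "r > 0" using R(1) rU by (simp add: r_def)
    have rR: "r \<le> R i" if "i \<in> Basis" for i using that by (simp add: r_def min.coboundedI2)
    have "\<bar>local_df c a v - local_df c b v - H (a - b) v\<bar> \<le> \<eta> * norm (a - b) * norm v"
      if a: "a \<in> E \<inter> cball q r" and b: "b \<in> E \<inter> cball q r" and v: "v \<in> E" for a b v
    proof -
      have aU: "a \<in> E \<inter> U" and bU: "b \<in> E \<inter> U" using a b rU by (auto simp: r_def)
      have Fd: "linear (frechet_derivative F (at y))" if "y \<in> U" for y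
        using has_derivative_linear[OF Ck_on_differentiable[OF U(3) that]] .
      have "linear (\<lambda>v. frechet_derivative F (at a) (P v) - frechet_derivative F (at b) (P v) - H (a - b) (P v))"
        using linear_compose[OF P(1) Fd[of a]] linear_compose[OF P(1) Fd[of b]] aU bU
          linear_compose[OF P(1) lin']
        by (intro linear_compose_sub) (auto simp: o_def)
      moreover have "norm (frechet_derivative F (at a) (P i) - frechet_derivative F (at b) (P i) - H (a - b) (P i)) \<le> \<eta> / n * norm (a - b)"
        if i: "i \<in> Basis" for i
      proof -
        have "a \<in> E \<inter> cball q (R i)" "b \<in> E \<inter> cball q (R i)" using a b rR[OF i] by auto
        from R(2)[OF i this] show ?thesis by (simp add: eq[OF aU P(2)] eq[OF bU P(2)])
      qed
      ultimately have "norm (frechet_derivative F (at a) (P v) - frechet_derivative F (at b) (P v) - H (a - b) (P v))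
           \<le> (\<Sum>i\<in>(Basis::'e set). \<eta> / n * norm (a - b)) * norm v"
        by (rule norm_linear_le_sum_Basis)
      also have "(\<Sum>i\<in>(Basis::'e set). \<eta> / n * norm (a - b)) = \<eta> * norm (a - b)"
        using n by (simp add: n_def)
      finally show ?thesis by (simp add: P(3)[OF v] eq[OF aU v] eq[OF bU v])
    qed
    then show ?thesis using r by blast
  qed
  show ?thesis by (rule that[OF bil sym nd strict])
qed

section \<open>The flow has controlled second differences\<close>

lemma flow_0: "\<Phi> x 0 = x"
  and flow_velocity: "has_velocity A (\<Phi> x) (- gradient E A g f (\<Phi> x t)) t"
  using flow by (auto simp: negative_gradient_flow_def)

lemma flow_isCont: "isCont (\<Phi> x) t"
  using flow_velocity by (simp add: has_velocity_def)

lemma flow_has_derivative: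
  assumes c: "c \<in> A" and x: "\<Phi> x t \<in> chart_dom c"
  shows "((\<lambda>t. coord c (\<Phi> x t)) has_vector_derivative local_field c (coord c (\<Phi> x t))) (at t)"
proof -
  have "((coord (chart_at A (\<Phi> x t)) \<circ> \<Phi> x) has_vector_derivative - gradient E A g f (\<Phi> x t)) (at t)"
    using flow_velocity[of x t] by (simp add: has_velocity_def)
  from curve_chart_change[OF chart_at(1) c flow_isCont chart_at(2) x this]
  show ?thesis unfolding local_field_at[OF c x] comp_def .
qed

text \<open>
In the coordinate ball the speed is at most \<open>N\<close>, so crossing the shell between the radii \<open>r / 2\<close> and
\<open>r\<close> takes longer than \<open>r / (4 (N + 1))\<close>.
\<close>

lemma flow_trapped:
  assumes c: "c \<in> A" and r: "0 < r" and sub: "E \<inter> cball q r \<subseteq> chart_image c"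
    and N: "0 \<le> N" "\<And>y. y \<in> E \<inter> cball q r \<Longrightarrow> norm (local_field c y) \<le> N"
    and start: "\<Phi> x t1 \<in> chart_dom c" "coord c (\<Phi> x t1) \<in> cball q (r / 2)"
    and t: "t \<in> {t1..t1 + r / (4 * (N + 1))}"
  shows "\<Phi> x t \<in> chart_dom c \<and> coord c (\<Phi> x t) \<in> E \<inter> cball q r"
proof -
  define K where "K = chart_inv c ` (E \<inter> cball q r)"
  define W where "W = chart_dom c \<inter> coord c -` ball q r"
  have K_iff: "y \<in> K \<longleftrightarrow> y \<in> chart_dom c \<and> coord c y \<in> cball q r" for y
    unfolding K_def by (rule coordinate_ball_iff[OF c sub])
  have "\<Phi> x t \<in> K"
  proof (rule stays_in_closed_set[where W = W and T = "t1 + r / (4 * (N + 1))"])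
    show "closed K" unfolding K_def by (rule coordinate_ball_closed[OF c sub])
    show "open W" unfolding W_def by (rule coordinate_ball_open[OF c])
    show "W \<subseteq> K" by (auto simp: W_def K_iff)
    show "\<Phi> x t1 \<in> K" using start r by (auto simp: K_iff)
    show "isCont (\<Phi> x) t" for t by (rule flow_isCont)
    fix s assume s: "s \<in> {t1..t1 + r / (4 * (N + 1))}" and IH: "\<And>s'. s' \<in> {t1..s} \<Longrightarrow> \<Phi> x s' \<in> K"
    have "norm (coord c (\<Phi> x s) - coord c (\<Phi> x t1)) \<le> N * (s - t1)"
    proof (rule speed_bound)
      fix s' assume s': "s' \<in> {t1..s}"
      then have K': "\<Phi> x s' \<in> chart_dom c" "coord c (\<Phi> x s') \<in> cball q r" using IH[OF s'] K_iff by auto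
      show "((\<lambda>t. coord c (\<Phi> x t)) has_vector_derivative local_field c (coord c (\<Phi> x s'))) (at s')"
        by (rule flow_has_derivative[OF c K'(1)])
      show "norm (local_field c (coord c (\<Phi> x s'))) \<le> N"
        using K' chart_coord(2)[OF c K'(1)] by (intro N) auto
    qed (use s in auto)
    also have "\<dots> \<le> (N + 1) * (r / (4 * (N + 1)))"
      using s N by (intro mult_mono) auto
    also have "\<dots> = r / 4" using N by (simp add: divide_simps)
    finally have "dist (coord c (\<Phi> x s)) (coord c (\<Phi> x t1)) \<le> r / 4" by (simp add: dist_norm)
    moreover have "dist q (coord c (\<Phi> x t1)) \<le> r / 2" using start by simp
    ultimately have "dist q (coord c (\<Phi> x s)) < r"
      using r dist_triangle2[of q "coord c (\<Phi> x s)" "coord c (\<Phi> x t1)"] by linarith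
    moreover have "\<Phi> x s \<in> chart_dom c" using IH[of s] s K_iff by auto
    ultimately show "\<Phi> x s \<in> W" by (simp add: W_def)
  qed (use t in auto)
  then show ?thesis using K_iff chart_coord(2)[OF c, of "\<Phi> x t"] by auto
qed

definition base :: "'m \<Rightarrow> 'e" where "base x = coord (chart_at A x) x"

text \<open>
The points around \<open>x\<close>, parametrised by their coordinates relative to \<open>x\<close> in the preferred chart. For
large \<open>h\<close> the value is arbitrary.
\<close>

definition nearby :: "'m \<Rightarrow> 'e \<Rightarrow> 'm" where "nearby x h = chart_inv (chart_at A x) (base x + h)"

text \<open>
The time \<open>t\<close> map of the flow, read in \<open>c\<close> and in the preferred chart at \<open>x\<close>, is Lipschitz at \<open>x\<close> and has
quadratically small second differences there. This is the property that propagates in time and is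
preserved by coordinate changes.
\<close>

definition second_order_flow :: "('m, 'e) chart \<Rightarrow> real \<Rightarrow> 'm \<Rightarrow> bool" where
  "second_order_flow c t x \<longleftrightarrow> (\<exists>\<rho>>0. \<exists>M\<ge>0.
     (\<forall>h\<in>E. norm h < \<rho> \<longrightarrow> \<Phi> (nearby x h) t \<in> chart_dom c \<and>
        norm (coord c (\<Phi> (nearby x h) t) - coord c (\<Phi> x t)) \<le> M * norm h) \<and>
     (\<forall>h\<in>E. \<forall>k\<in>E. norm h + norm k < \<rho> \<longrightarrow>
        norm (coord c (\<Phi> (nearby x (h + k)) t) - coord c (\<Phi> (nearby x h) t) - coord c (\<Phi> (nearby x k) t)
           + coord c (\<Phi> x t)) \<le> M * (norm h + norm k)\<^sup>2))"

lemma base_in: "base x \<in> E" "base x \<in> chart_image (chart_at A x)"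
  using chart_coord[OF chart_at] by (simp_all add: base_def)

lemma nearby_0: "nearby x 0 = x"
  using chart_coord[OF chart_at] by (simp add: nearby_def base_def)

lemma second_order_flowI:
  assumes "0 < \<rho>" "0 \<le> M"
    "\<And>h. h \<in> E \<Longrightarrow> norm h < \<rho> \<Longrightarrow> \<Phi> (nearby x h) t \<in> chart_dom c"
    "\<And>h. h \<in> E \<Longrightarrow> norm h < \<rho> \<Longrightarrow> norm (coord c (\<Phi> (nearby x h) t) - coord c (\<Phi> x t)) \<le> M * norm h"
    "\<And>h k. h \<in> E \<Longrightarrow> k \<in> E \<Longrightarrow> norm h + norm k < \<rho> \<Longrightarrow>
       norm (coord c (\<Phi> (nearby x (h + k)) t) - coord c (\<Phi> (nearby x h) t) - coord c (\<Phi> (nearby x k) t)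
           + coord c (\<Phi> x t)) \<le> M * (norm h + norm k)\<^sup>2"
  shows "second_order_flow c t x"
  using assms unfolding second_order_flow_def by blast

lemma second_order_flowE:
  assumes "second_order_flow c t x"
  obtains \<rho> M where "0 < \<rho>" "0 \<le> M"
    "\<And>h. h \<in> E \<Longrightarrow> norm h < \<rho> \<Longrightarrow> \<Phi> (nearby x h) t \<in> chart_dom c"
    "\<And>h. h \<in> E \<Longrightarrow> norm h < \<rho> \<Longrightarrow> norm (coord c (\<Phi> (nearby x h) t) - coord c (\<Phi> x t)) \<le> M * norm h"
    "\<And>h k. h \<in> E \<Longrightarrow> k \<in> E \<Longrightarrow> norm h + norm k < \<rho> \<Longrightarrow>
       norm (coord c (\<Phi> (nearby x (h + k)) t) - coord c (\<Phi> (nearby x h) t) - coord c (\<Phi> (nearby x k) t)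
           + coord c (\<Phi> x t)) \<le> M * (norm h + norm k)\<^sup>2"
  using assms unfolding second_order_flow_def by blast

lemma second_order_flow_0: "second_order_flow (chart_at A x) 0 x"
proof -
  let ?c = "chart_at A x"
  obtain N where N: "open N" "base x \<in> N" "E \<inter> N \<subseteq> chart_image ?c"
    using openin_nhd[OF chart(2)[OF chart_at(1)] base_in(2)] by metis
  then obtain \<rho> where \<rho>: "\<rho> > 0" "ball (base x) \<rho> \<subseteq> N" using open_contains_ball by blast
  have im: "base x + h \<in> chart_image ?c" if "h \<in> E" "norm h < \<rho>" for h
  proof -
    have "base x + h \<in> ball (base x) \<rho>" using that by (simp add: dist_norm)
    moreover have "base x + h \<in> E" by (intro subspace_add subspace_E base_in that)
    ultimately show ?thesis using N \<rho> by blast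
  qed
  have dom: "nearby x h \<in> chart_dom ?c" and co: "coord ?c (nearby x h) = base x + h" if "h \<in> E" "norm h < \<rho>" for h
    using chart_inverse[OF chart_at(1) im[OF that]] by (simp_all add: nearby_def)
  show ?thesis
  proof (rule second_order_flowI[of \<rho> 1], unfold flow_0)
    fix h assume h: "h \<in> E" "norm h < \<rho>"
    show "nearby x h \<in> chart_dom ?c" by (rule dom[OF h])
    show "norm (coord ?c (nearby x h) - coord ?c x) \<le> 1 * norm h"
      unfolding co[OF h] by (simp add: base_def)
  next
    fix h k assume hk: "h \<in> E" "k \<in> E" "norm h + norm k < \<rho>"
    have "h + k \<in> E" "norm (h + k) < \<rho>" "norm h < \<rho>" "norm k < \<rho>"
      using hk norm_triangle_ineq[of h k] norm_ge_zero[of h] norm_ge_zero[of k]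
      by (auto intro: subspace_add[OF subspace_E] simp del: norm_ge_zero)
    then show "norm (coord ?c (nearby x (h + k)) - coord ?c (nearby x h) - coord ?c (nearby x k) + coord ?c x)
        \<le> 1 * (norm h + norm k)\<^sup>2"
      using hk co by (simp add: base_def)
  qed (use \<rho> in auto)
qed

text \<open>
A second difference of \<open>T \<circ> F\<close> is controlled by that of \<open>F\<close> and the spread of its values, since the smooth
coordinate change \<open>T\<close> has controlled second differences on general quadrilaterals.
\<close>

lemma second_order_flow_chart_change:
  assumes c: "c \<in> A" "c' \<in> A" and x: "\<Phi> x t \<in> chart_dom c" "\<Phi> x t \<in> chart_dom c'"
    and so: "second_order_flow c t x"
  shows "second_order_flow c' t x"
proof -
  obtain \<rho> M where \<rho>: "0 < \<rho>" and M: "0 \<le> M"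
    and dom: "\<And>h. h \<in> E \<Longrightarrow> norm h < \<rho> \<Longrightarrow> \<Phi> (nearby x h) t \<in> chart_dom c"
    and lip: "\<And>h. h \<in> E \<Longrightarrow> norm h < \<rho> \<Longrightarrow> norm (coord c (\<Phi> (nearby x h) t) - coord c (\<Phi> x t)) \<le> M * norm h"
    and sec: "\<And>h k. h \<in> E \<Longrightarrow> k \<in> E \<Longrightarrow> norm h + norm k < \<rho> \<Longrightarrow>
       norm (coord c (\<Phi> (nearby x (h + k)) t) - coord c (\<Phi> (nearby x h) t) - coord c (\<Phi> (nearby x k) t)
           + coord c (\<Phi> x t)) \<le> M * (norm h + norm k)\<^sup>2"
    using second_order_flowE[OF so] by metis
  define q where "q = coord c (\<Phi> x t)"
  define T where "T = coord c' \<circ> chart_inv c"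
  have q: "q \<in> overlap c c'" using x by (auto simp: q_def overlap_def)
  obtain U H where U: "open U" "q \<in> U" "\<And>k. Ck_on k U H" "E \<inter> U \<subseteq> overlap c c'" "\<And>y. y \<in> E \<inter> U \<Longrightarrow> H y = T y"
    using smooth_on_extension[OF transition_smooth[OF c] overlap_openin[OF c] q] unfolding T_def by metis
  obtain r where r: "r > 0" "cball q r \<subseteq> U" using U open_contains_cball by blast
  obtain N where "second_lip N (cball q r) H"
    using Ck_on_2_second_lip[OF U(3) r(2) compact_cball convex_cball] by blast
  then have N: "second_lip N (E \<inter> cball q r) T"
    by (rule second_lip_mono) (use U(5) r(2) in auto)
  note N0 = second_lip_nonneg[OF N]
  define \<rho>' where "\<rho>' = min \<rho> (r / (M + 1))"
  have \<rho>': "0 < \<rho>'" "\<rho>' \<le> \<rho>" using \<rho> r M by (auto simp: \<rho>'_def)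
  have S: "coord c (\<Phi> (nearby x h) t) \<in> E \<inter> cball q r" if h: "h \<in> E" "norm h < \<rho>'" for h
  proof -
    have "norm (coord c (\<Phi> (nearby x h) t) - q) \<le> M * norm h" unfolding q_def using h \<rho>' by (intro lip) auto
    also have "\<dots> \<le> (M + 1) * (r / (M + 1))" using h M by (intro mult_mono) (auto simp: \<rho>'_def)
    also have "\<dots> = r" using M by (simp add: divide_simps)
    finally show ?thesis
      using chart_coord(2)[OF c(1) dom[OF h(1)]] h \<rho>' by (simp add: dist_norm norm_minus_commute)
  qed
  have q': "q \<in> E \<inter> cball q r" using chart_coord(2)[OF c(1) x(1)] r by (simp add: q_def)
  have dom': "\<Phi> (nearby x h) t \<in> chart_dom c'" if h: "h \<in> E" "norm h < \<rho>'" for h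
  proof -
    have "coord c (\<Phi> (nearby x h) t) \<in> overlap c c'" using S[OF h] U(4) r(2) by blast
    then show ?thesis unfolding overlap_iff[OF c(1)] using chart_coord(3)[OF c(1) dom[OF h(1)]] h \<rho>' by simp
  qed
  have T: "coord c' (\<Phi> (nearby x h) t) = T (coord c (\<Phi> (nearby x h) t))" if h: "h \<in> E" "norm h < \<rho>'" for h
    using chart_coord(3)[OF c(1) dom[OF h(1)]] h \<rho>' by (simp add: T_def)
  have Tq: "coord c' (\<Phi> x t) = T q" using chart_coord(3)[OF c(1) x(1)] by (simp add: T_def q_def)
  show ?thesis
  proof (rule second_order_flowI[of \<rho>' "N * M + N * (9 * M\<^sup>2)"])
    show "0 < \<rho>'" "0 \<le> N * M + N * (9 * M\<^sup>2)" using \<rho>' N0 M by auto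
    fix h assume h: "h \<in> E" "norm h < \<rho>'"
    show "\<Phi> (nearby x h) t \<in> chart_dom c'" by (rule dom'[OF h])
    have "norm (T (coord c (\<Phi> (nearby x h) t)) - T q) \<le> N * norm (coord c (\<Phi> (nearby x h) t) - q)"
      by (rule second_lip_lipschitz[OF N S[OF h] q'])
    also have "\<dots> \<le> N * (M * norm h)" unfolding q_def using h \<rho>' by (intro mult_left_mono lip N0) auto
    also have "\<dots> \<le> (N * M + N * (9 * M\<^sup>2)) * norm h"
      using N0 by (simp add: distrib_right mult.assoc)
    finally show "norm (coord c' (\<Phi> (nearby x h) t) - coord c' (\<Phi> x t)) \<le> (N * M + N * (9 * M\<^sup>2)) * norm h"
      unfolding T[OF h] Tq .
  next
    fix h k assume hk: "h \<in> E" "k \<in> E" "norm h + norm k < \<rho>'"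
    define s where "s = norm h + norm k"
    have s: "norm (h + k) \<le> s" "norm h \<le> s" "norm k \<le> s" "0 \<le> s" "s < \<rho>'"
      using norm_triangle_ineq[of h k] hk by (auto simp: s_def)
    have hkE: "h + k \<in> E" by (intro subspace_add subspace_E hk)
    note small = order_le_less_trans[OF s(1) s(5)] order_le_less_trans[OF s(2) s(5)] order_le_less_trans[OF s(3) s(5)]
    let ?a = "coord c (\<Phi> (nearby x (h + k)) t)" and ?b = "coord c (\<Phi> (nearby x h) t)"
      and ?c = "coord c (\<Phi> (nearby x k) t)"
    have Ms: "norm (coord c (\<Phi> (nearby x j) t) - q) \<le> M * s" if j: "j \<in> E" "norm j < \<rho>'" "norm j \<le> s" for j
      using lip[OF j(1)] j \<rho>' mult_left_mono[OF j(3) M] by (simp add: q_def)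
    have "norm (T ?a - T ?b - T ?c + T q) \<le> N * quad ?a ?b ?c q"
      by (rule second_lip_quad[OF N S[OF hkE small(1)] S[OF hk(1) small(2)] S[OF hk(2) small(3)] q'])
    also have "\<dots> \<le> N * (norm (?a - ?b - ?c + q) + 9 * (M * s)\<^sup>2)"
      by (intro mult_left_mono N0 quad_le_spread Ms hkE hk small s)
    also have "\<dots> \<le> N * (M * s\<^sup>2 + 9 * (M * s)\<^sup>2)"
      using sec[OF hk(1,2)] hk(3) \<rho>' by (intro mult_left_mono N0 add_right_mono) (simp add: q_def s_def)
    also have "\<dots> = (N * M + N * (9 * M\<^sup>2)) * s\<^sup>2" by (simp add: algebra_simps power_mult_distrib)
    finally show "norm (coord c' (\<Phi> (nearby x (h + k)) t) - coord c' (\<Phi> (nearby x h) t) - coord c' (\<Phi> (nearby x k) t)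
           + coord c' (\<Phi> x t)) \<le> (N * M + N * (9 * M\<^sup>2)) * (norm h + norm k)\<^sup>2"
      unfolding T[OF hkE small(1)] T[OF hk(1) small(2)] T[OF hk(2) small(3)] Tq s_def[symmetric] .
  qed
qed

text \<open>
For a short time after \<open>t1\<close>, the orbits of all points near \<open>x\<close> remain in one chart and are
integral curves of a field with controlled second differences, so the estimates at time \<open>t1\<close>
propagate to time \<open>t2\<close>.
\<close>

lemma second_order_flow_step:
  "\<exists>\<epsilon>>0. \<forall>t1 t2. \<bar>t1 - t0\<bar> < \<epsilon> \<longrightarrow> t1 \<le> t2 \<longrightarrow> t2 < t0 + \<epsilon> \<longrightarrow>
     (\<exists>c\<in>A. \<Phi> x t1 \<in> chart_dom c \<and> second_order_flow c t1 x) \<longrightarrow>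
     (\<exists>c\<in>A. \<Phi> x t2 \<in> chart_dom c \<and> second_order_flow c t2 x)"
proof -
  define c where "c = chart_at A (\<Phi> x t0)"
  define q where "q = coord c (\<Phi> x t0)"
  have c: "c \<in> A" and xc: "\<Phi> x t0 \<in> chart_dom c" and q: "q \<in> chart_image c"
    using chart_at chart_coord[OF chart_at] by (auto simp: c_def q_def)
  obtain r M l where r: "r > 0" and sub: "E \<inter> cball q r \<subseteq> chart_image c" and
    ge: "gradient_equation E (E \<inter> cball q r) (local_df c) (local_metric c) (local_field c) M l"
    using local_gradient_equation[OF c q] by blast
  obtain N where N: "second_lip N (E \<inter> cball q r) (local_field c)"
    using gradient_equation.X_second_lip[OF ge] by blast
  note N0 = second_lip_nonneg[OF N]
  have "open (chart_dom c \<inter> coord c -` ball q (r / 4))" by (rule coordinate_ball_open[OF c])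
  moreover have "\<Phi> x t0 \<in> chart_dom c \<inter> coord c -` ball q (r / 4)" using xc r by (simp add: q_def)
  ultimately obtain I where I: "open I" "t0 \<in> I" "\<And>s. s \<in> I \<Longrightarrow> \<Phi> x s \<in> chart_dom c \<inter> coord c -` ball q (r / 4)"
    using isCont_open_nhd[OF flow_isCont] by metis
  obtain \<epsilon>1 where \<epsilon>1: "\<epsilon>1 > 0" "ball t0 \<epsilon>1 \<subseteq> I" using I open_contains_ball by blast
  \<comment> \<open>orbits that start in the ball of radius \<open>r / 2\<close> stay in the chart for the time \<open>2 \<epsilon>\<close>\<close>
  define \<epsilon> where "\<epsilon> = min \<epsilon>1 (r / (8 * (N + 1)))"
  have \<epsilon>: "\<epsilon> > 0" "2 * \<epsilon> \<le> r / (4 * (N + 1))"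
  proof -
    show "\<epsilon> > 0" using \<epsilon>1 r N0 by (simp add: \<epsilon>_def)
    have "2 * \<epsilon> \<le> 2 * (r / (8 * (N + 1)))" by (intro mult_left_mono) (auto simp: \<epsilon>_def)
    also have "\<dots> = r / (4 * (N + 1))" using N0 by (simp add: divide_simps)
    finally show "2 * \<epsilon> \<le> r / (4 * (N + 1))" .
  qed
  have "\<exists>c\<in>A. \<Phi> x t2 \<in> chart_dom c \<and> second_order_flow c t2 x"
    if t: "\<bar>t1 - t0\<bar> < \<epsilon>" "t1 \<le> t2" "t2 < t0 + \<epsilon>" and
      so': "\<exists>c\<in>A. \<Phi> x t1 \<in> chart_dom c \<and> second_order_flow c t1 x" for t1 t2
  proof -
    have "t1 \<in> I" using t \<epsilon>1 by (auto simp: \<epsilon>_def dist_real_def abs_minus_commute)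
    then have x1: "\<Phi> x t1 \<in> chart_dom c" "coord c (\<Phi> x t1) \<in> ball q (r / 4)" using I(3) by auto
    obtain c' where "c' \<in> A" "\<Phi> x t1 \<in> chart_dom c'" "second_order_flow c' t1 x" using so' by blast
    then have "second_order_flow c t1 x" using second_order_flow_chart_change c x1 by blast
    then obtain \<rho> K where \<rho>: "0 < \<rho>" and K: "0 \<le> K"
      and dom: "\<And>h. h \<in> E \<Longrightarrow> norm h < \<rho> \<Longrightarrow> \<Phi> (nearby x h) t1 \<in> chart_dom c"
      and lip: "\<And>h. h \<in> E \<Longrightarrow> norm h < \<rho> \<Longrightarrow> norm (coord c (\<Phi> (nearby x h) t1) - coord c (\<Phi> x t1)) \<le> K * norm h"
      and sec: "\<And>h k. h \<in> E \<Longrightarrow> k \<in> E \<Longrightarrow> norm h + norm k < \<rho> \<Longrightarrow>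
         norm (coord c (\<Phi> (nearby x (h + k)) t1) - coord c (\<Phi> (nearby x h) t1) - coord c (\<Phi> (nearby x k) t1)
             + coord c (\<Phi> x t1)) \<le> K * (norm h + norm k)\<^sup>2"
      using second_order_flowE by metis
    \<comment> \<open>points of this ball are carried into the ball of radius \<open>r / 2\<close> around \<open>q\<close> at time \<open>t1\<close>\<close>
    define \<rho>' where "\<rho>' = min \<rho> (r / (4 * (K + 1)))"
    have \<rho>': "0 < \<rho>'" "\<rho>' \<le> \<rho>" using \<rho> r K by (auto simp: \<rho>'_def)
    have start: "\<Phi> (nearby x h) t1 \<in> chart_dom c" "coord c (\<Phi> (nearby x h) t1) \<in> cball q (r / 2)"
      if h: "h \<in> E" "norm h < \<rho>'" for h
    proof -
      show "\<Phi> (nearby x h) t1 \<in> chart_dom c" using dom h \<rho>' by auto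
      have "norm (coord c (\<Phi> (nearby x h) t1) - coord c (\<Phi> x t1)) \<le> K * norm h" using h \<rho>' by (intro lip) auto
      also have "\<dots> \<le> (K + 1) * (r / (4 * (K + 1)))" using h K by (intro mult_mono) (auto simp: \<rho>'_def)
      also have "\<dots> = r / 4" using K by (simp add: divide_simps)
      finally have "dist (coord c (\<Phi> (nearby x h) t1)) (coord c (\<Phi> x t1)) \<le> r / 4" by (simp add: dist_norm)
      moreover have "dist q (coord c (\<Phi> x t1)) < r / 4" using x1 by simp
      ultimately show "coord c (\<Phi> (nearby x h) t1) \<in> cball q (r / 2)"
        using dist_triangle2[of q "coord c (\<Phi> (nearby x h) t1)" "coord c (\<Phi> x t1)"] by simp
    qed
    have trap: "\<Phi> (nearby x h) s \<in> chart_dom c" "coord c (\<Phi> (nearby x h) s) \<in> E \<inter> cball q r"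
      if h: "h \<in> E" "norm h < \<rho>'" and s: "s \<in> {t1..t2}" for h s
    proof -
      have "s \<in> {t1..t1 + r / (4 * (N + 1))}" using s t \<epsilon> by auto
      from flow_trapped[OF c r sub N0 second_lip_bound[OF N] start[OF h] this]
      show "\<Phi> (nearby x h) s \<in> chart_dom c" "coord c (\<Phi> (nearby x h) s) \<in> E \<inter> cball q r" by auto
    qed
    have der: "((\<lambda>s. coord c (\<Phi> (nearby x h) s)) has_vector_derivative local_field c (coord c (\<Phi> (nearby x h) s))) (at s)"
      if h: "h \<in> E" "norm h < \<rho>'" and s: "s \<in> {t1..t2}" for h s
      by (rule flow_has_derivative[OF c trap(1)[OF h s]])
    have E0: "(0::'e) \<in> E" "norm (0::'e) < \<rho>'" using subspace_0[OF subspace_E] \<rho>' by auto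
    have t2: "t2 \<in> {t1..t2}" using t by simp
    define e where "e = exp ((N + 1) * (t2 - t1))"
    have e: "e > 0" by (simp add: e_def)
    define C where "C = K * e + (K + N * (9 * (K * e)\<^sup>2)) * e"
    have "second_order_flow c t2 x"
    proof (rule second_order_flowI[of \<rho>' C])
      have nn: "0 \<le> K * e" "0 \<le> (K + N * (9 * (K * e)\<^sup>2)) * e" using K N0 e by auto
      show "0 < \<rho>'" "0 \<le> C" using \<rho>' nn by (auto simp: C_def)
      fix h assume h: "h \<in> E" "norm h < \<rho>'"
      show "\<Phi> (nearby x h) t2 \<in> chart_dom c" by (rule trap(1)[OF h t2])
      have "norm (coord c (\<Phi> (nearby x h) t2) - coord c (\<Phi> (nearby x 0) t2)) \<le>
          norm (coord c (\<Phi> (nearby x h) t1) - coord c (\<Phi> (nearby x 0) t1)) * e"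
        unfolding e_def
        by (rule integral_curves_distance[OF N trap(2)[OF h] der[OF h] trap(2)[OF E0] der[OF E0] t2])
      also have "\<dots> \<le> (K * norm h) * e"
        unfolding nearby_0 using h \<rho>' e by (intro mult_right_mono lip) auto
      also have "\<dots> \<le> C * norm h" unfolding C_def using mult_right_mono[OF nn(2) norm_ge_zero[of h]]
        by (simp add: algebra_simps)
      finally show "norm (coord c (\<Phi> (nearby x h) t2) - coord c (\<Phi> x t2)) \<le> C * norm h" by (simp add: nearby_0)
    next
      have nn: "0 \<le> K * e" using K e by auto
      fix h k assume hk: "h \<in> E" "k \<in> E" "norm h + norm k < \<rho>'"
      define s where "s = norm h + norm k"
      have s: "norm (h + k) \<le> s" "norm h \<le> s" "norm k \<le> s" "0 \<le> s" "s < \<rho>'"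
        using norm_triangle_ineq[of h k] hk by (auto simp: s_def)
      have hkE: "h + k \<in> E" by (intro subspace_add subspace_E hk)
      note small = order_le_less_trans[OF s(1) s(5)] order_le_less_trans[OF s(2) s(5)] order_le_less_trans[OF s(3) s(5)]
      have Ks: "norm (coord c (\<Phi> (nearby x j) t1) - coord c (\<Phi> (nearby x 0) t1)) \<le> K * s"
        if j: "j \<in> E" "norm j < \<rho>'" "norm j \<le> s" for j
        using lip[OF j(1)] j \<rho>' mult_left_mono[OF j(3) K] by (simp add: nearby_0)
      have "norm (coord c (\<Phi> (nearby x (h + k)) t2) - coord c (\<Phi> (nearby x h) t2) - coord c (\<Phi> (nearby x k) t2)
           + coord c (\<Phi> (nearby x 0) t2)) \<le> (K * s\<^sup>2 + N * (9 * ((K * s) * exp ((N + 1) * (t2 - t1)))\<^sup>2)) * exp ((N + 1) * (t2 - t1))"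
      proof (rule integral_curves_second_difference[OF N t(2) trap(2)[OF hkE small(1)] der[OF hkE small(1)]
            trap(2)[OF hk(1) small(2)] der[OF hk(1) small(2)] trap(2)[OF hk(2) small(3)] der[OF hk(2) small(3)]
            trap(2)[OF E0] der[OF E0]])
        show "norm (coord c (\<Phi> (nearby x (h + k)) t1) - coord c (\<Phi> (nearby x h) t1) - coord c (\<Phi> (nearby x k) t1)
           + coord c (\<Phi> (nearby x 0) t1)) \<le> K * s\<^sup>2"
          using sec[OF hk(1,2)] hk(3) \<rho>' by (simp add: nearby_0 s_def)
      qed (assumption | rule Ks hkE hk small s)+
      also have "\<dots> = (K + N * (9 * (K * e)\<^sup>2)) * e * s\<^sup>2"
        by (simp add: e_def power_mult_distrib algebra_simps)
      also have "\<dots> \<le> C * s\<^sup>2" using nn by (intro mult_right_mono) (auto simp: C_def)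
      finally show "norm (coord c (\<Phi> (nearby x (h + k)) t2) - coord c (\<Phi> (nearby x h) t2) - coord c (\<Phi> (nearby x k) t2)
           + coord c (\<Phi> x t2)) \<le> C * (norm h + norm k)\<^sup>2"
        by (simp add: nearby_0 s_def)
    qed
    moreover have "\<Phi> x t2 \<in> chart_dom c" using trap(1)[OF E0 t2] by (simp add: nearby_0)
    ultimately show ?thesis using c by blast
  qed
  then show ?thesis using \<epsilon>(1) by blast
qed

text \<open>
Induction along \<open>[0, t]\<close>, changing the chart whenever necessary.
\<close>

lemma second_order_flow_all:
  assumes t: "0 \<le> t" and c: "c \<in> A" "\<Phi> x t \<in> chart_dom c"
  shows "second_order_flow c t x"
proof -
  define P where "P t \<longleftrightarrow> (\<exists>c\<in>A. \<Phi> x t \<in> chart_dom c \<and> second_order_flow c t x)" for t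
  have step: "\<exists>\<epsilon>>0. \<forall>t1 t2. \<bar>t1 - t0\<bar> < \<epsilon> \<longrightarrow> t1 \<le> t2 \<longrightarrow> t2 < t0 + \<epsilon> \<longrightarrow> P t1 \<longrightarrow> P t2" for t0
    using second_order_flow_step[of t0 x] by (simp add: P_def)
  have "P t"
  proof (rule real_interval_induct[of P 0 t])
    show "P 0" unfolding P_def flow_0 using second_order_flow_0 chart_at by blast
  next
    fix t0 assume t0: "0 < t0" "t0 \<le> t" and IH: "\<And>s. 0 \<le> s \<Longrightarrow> s < t0 \<Longrightarrow> P s"
    obtain \<epsilon> where \<epsilon>: "\<epsilon> > 0" "\<And>t1 t2. \<bar>t1 - t0\<bar> < \<epsilon> \<Longrightarrow> t1 \<le> t2 \<Longrightarrow> t2 < t0 + \<epsilon> \<Longrightarrow> P t1 \<Longrightarrow> P t2"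
      using step[of t0] by blast
    define t1 where "t1 = max 0 (t0 - \<epsilon> / 2)"
    show "P t0" by (rule \<epsilon>(2)[of t1]) (use t0 \<epsilon>(1) IH[of t1] in \<open>auto simp: t1_def max_def\<close>)
  next
    fix t0 assume t0: "0 \<le> t0" "t0 < t" and IH: "\<And>s. 0 \<le> s \<Longrightarrow> s \<le> t0 \<Longrightarrow> P s"
    obtain \<epsilon> where \<epsilon>: "\<epsilon> > 0" "\<And>t1 t2. \<bar>t1 - t0\<bar> < \<epsilon> \<Longrightarrow> t1 \<le> t2 \<Longrightarrow> t2 < t0 + \<epsilon> \<Longrightarrow> P t1 \<Longrightarrow> P t2"
      using step[of t0] by blast
    show "\<exists>e>0. \<forall>s. t0 < s \<and> s < t0 + e \<longrightarrow> P s"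
    proof (intro exI[of _ \<epsilon>] conjI allI impI)
      fix s assume "t0 < s \<and> s < t0 + \<epsilon>"
      then show "P s" using \<epsilon>(2)[of t0 s] \<epsilon>(1) IH[of t0] t0 by simp
    qed (rule \<epsilon>(1))
  qed (use t in auto)
  then show ?thesis unfolding P_def using second_order_flow_chart_change c by blast
qed

lemma flow_differentiable:
  assumes t: "0 \<le> t" and c: "c \<in> A" "\<Phi> x t \<in> chart_dom c"
  shows "(coord c \<circ> (\<lambda>z. \<Phi> z t) \<circ> chart_inv (chart_at A x)) differentiable (at (base x) within E)"
proof -
  obtain \<rho> K where \<rho>: "0 < \<rho>" and K: "0 \<le> K"
      and lip: "\<And>h. h \<in> E \<Longrightarrow> norm h < \<rho> \<Longrightarrow> norm (coord c (\<Phi> (nearby x h) t) - coord c (\<Phi> x t)) \<le> K * norm h"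
      and sec: "\<And>h k. h \<in> E \<Longrightarrow> k \<in> E \<Longrightarrow> norm h + norm k < \<rho> \<Longrightarrow>
         norm (coord c (\<Phi> (nearby x (h + k)) t) - coord c (\<Phi> (nearby x h) t) - coord c (\<Phi> (nearby x k) t)
             + coord c (\<Phi> x t)) \<le> K * (norm h + norm k)\<^sup>2"
    using second_order_flowE[OF second_order_flow_all[OF t c]] by metis
  have b: "chart_inv (chart_at A x) (base x) = x" using nearby_0[of x] by (simp add: nearby_def)
  show ?thesis
    by (rule approximately_additive_differentiable_within[OF subspace_E base_in(1) \<rho> K])
      (use lip sec in \<open>auto simp: nearby_def b add.assoc\<close>)
qed

section \<open>Orbits of the stable manifold near the critical point\<close>

lemma f_flow_has_derivative:
  assumes c: "c \<in> A" and x: "\<Phi> x t \<in> chart_dom c"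
  shows "((\<lambda>t. f (\<Phi> x t)) has_real_derivative
     - local_metric c (coord c (\<Phi> x t)) (local_field c (coord c (\<Phi> x t))) (local_field c (coord c (\<Phi> x t)))) (at t)"
proof -
  obtain N where N: "open N" "t \<in> N" "\<And>s. s \<in> N \<Longrightarrow> \<Phi> x s \<in> chart_dom c"
    using isCont_open_nhd[OF flow_isCont chart(1)[OF c] x] by blast
  have "((\<lambda>s. (f \<circ> chart_inv c) (coord c (\<Phi> x s))) has_vector_derivative
     local_df c (coord c (\<Phi> x t)) (local_field c (coord c (\<Phi> x t)))) (at t)"
  proof (rule has_vector_derivative_compose_nhd[OF flow_has_derivative[OF c x] _ N(1,2)])
    show "(f \<circ> chart_inv c has_derivative local_df c (coord c (\<Phi> x t))) (at (coord c (\<Phi> x t)) within E)"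
      by (rule local_df_has_derivative[OF c chart_coord(1)[OF c x]])
    show "coord c (\<Phi> x s) \<in> E" if "s \<in> N" for s by (rule chart_coord(2)[OF c N(3)[OF that]])
  qed
  then have "((\<lambda>s. f (\<Phi> x s)) has_vector_derivative
     local_df c (coord c (\<Phi> x t)) (local_field c (coord c (\<Phi> x t)))) (at t)"
    by (rule has_vector_derivative_transform_within_open[OF _ N(1,2)])
      (simp add: chart_coord(3)[OF c N(3)])
  then show ?thesis
    using local_equation[OF c x local_field_in[OF c x]] by (simp add: has_real_derivative_iff_has_vector_derivative)
qed

lemma local_metric_nonneg:
  assumes c: "c \<in> A" and y: "y \<in> chart_image c" and u: "u \<in> E"
  shows "0 \<le> local_metric c y u u"
  using local_metric_add(5)[OF c y u u u] local_metric_add(2)[OF c y u u u, of 0] local_metric_add(2)[OF c y, of 0 0 0 0]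
    subspace_0[OF subspace_E] by (cases "u = 0") auto

text \<open>
The derivative of \<open>f\<close> along an orbit is \<open>- g(\<nabla>f, \<nabla>f)\<close>.
\<close>

lemma f_flow_antimono:
  assumes "s \<le> t"
  shows "f (\<Phi> x t) \<le> f (\<Phi> x s)"
proof (rule DERIV_nonpos_imp_nonincreasing[of s t "\<lambda>t. f (\<Phi> x t)", OF assms])
  fix r
  note c = chart_at[of "\<Phi> x r"]
  show "\<exists>y. ((\<lambda>t. f (\<Phi> x t)) has_real_derivative y) (at r) \<and> y \<le> 0"
    using f_flow_has_derivative[OF c] local_metric_nonneg[OF c(1) chart_coord(1)[OF c] local_field_in[OF c]]
    by (intro exI conjI) auto
qed

lemma continuous_f: "continuous_on UNIV f"
proof -
  have "isCont f x" for x
  proof -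
    note c = chart_at[of x]
    let ?c = "chart_at A x"
    have "continuous_on (chart_image ?c) (f \<circ> chart_inv ?c)"
      unfolding continuous_on_eq_continuous_within
    proof
      fix y assume "y \<in> chart_image ?c"
      from has_derivative_continuous[OF local_df_has_derivative[OF c(1) this]]
      show "continuous (at y within chart_image ?c) (f \<circ> chart_inv ?c)"
        by (rule continuous_within_subset[OF _ chart_image_subset[OF c(1)]])
    qed
    moreover have "coord ?c ` chart_dom ?c = chart_image ?c" by (simp add: chart_image_def)
    ultimately have "continuous_on (chart_dom ?c) ((f \<circ> chart_inv ?c) \<circ> coord ?c)"
      using continuous_on_compose[OF continuous_coord[OF c(1)]] by simp
    then have "continuous_on (chart_dom ?c) f"
      by (rule continuous_on_eq) (simp add: chart_coord[OF c(1)])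
    then show ?thesis using chart(1)[OF c(1)] c(2) by (simp add: continuous_on_eq_continuous_at)
  qed
  then show ?thesis by (simp add: continuous_on_eq_continuous_at)
qed

lemma stable_manifold_level:
  assumes "x \<in> stable_manifold \<Phi> p"
  shows "f p \<le> f (\<Phi> x t)"
proof -
  have "((\<lambda>s. f (\<Phi> x s)) \<longlongrightarrow> f p) at_top"
    using assms continuous_f by (intro isCont_tendsto_compose[of p f]) (auto simp: stable_manifold_def continuous_on_eq_continuous_at)
  moreover have "\<forall>\<^sub>F s in at_top. f (\<Phi> x s) \<le> f (\<Phi> x t)"
    using eventually_ge_at_top[of t] by eventually_elim (rule f_flow_antimono)
  ultimately show ?thesis by (intro tendsto_upperbound[of "\<lambda>s. f (\<Phi> x s)" "f p" at_top]) auto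
qed

text \<open>
By \<open>ineq\<close> the function \<open>f + \<kappa> |y - q|\<^sup>2\<close> is decreasing along orbits as long as they are in the
ball. Because \<open>f \<ge> f p\<close> on the stable manifold, \<open>\<kappa> |y - q|\<^sup>2\<close> stays below its value at the
boundary, so the orbit never reaches the boundary of the ball.
\<close>

lemma stable_orbit_trapped:
  assumes c: "c \<in> A" and r: "0 < r" and sub: "E \<inter> cball q r \<subseteq> chart_image c" and \<kappa>: "0 < \<kappa>"
    and ineq: "\<And>y. y \<in> E \<inter> cball q r \<Longrightarrow>
      2 * \<kappa> * norm (y - q) * norm (local_field c y) \<le> local_metric c y (local_field c y) (local_field c y)"
    and x: "x \<in> stable_manifold \<Phi> p"
    and start: "\<Phi> x T \<in> chart_dom c" "coord c (\<Phi> x T) \<in> cball q (r / 2)" "f (\<Phi> x T) < f p + \<kappa> * r\<^sup>2 / 2"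
    and t: "T \<le> t"
  shows "\<Phi> x t \<in> chart_dom c \<and> coord c (\<Phi> x t) \<in> E \<inter> cball q r"
proof -
  define K where "K = chart_inv c ` (E \<inter> cball q r)"
  define W where "W = chart_dom c \<inter> coord c -` ball q r"
  have K_iff: "y \<in> K \<longleftrightarrow> y \<in> chart_dom c \<and> coord c y \<in> cball q r" for y
    unfolding K_def by (rule coordinate_ball_iff[OF c sub])
  have "\<Phi> x t \<in> K"
  proof (rule stays_in_closed_set[where W = W and T = t and ?t0.0 = T])
    show "closed K" unfolding K_def by (rule coordinate_ball_closed[OF c sub])
    show "open W" unfolding W_def by (rule coordinate_ball_open[OF c])
    show "W \<subseteq> K" by (auto simp: W_def K_iff)
    show "\<Phi> x T \<in> K" using start r by (auto simp: K_iff)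
    show "isCont (\<Phi> x) t" for t by (rule flow_isCont)
    fix s assume s: "s \<in> {T..t}" and IH: "\<And>s'. s' \<in> {T..s} \<Longrightarrow> \<Phi> x s' \<in> K"
    define a where "a s = coord c (\<Phi> x s)" for s
    define \<psi> where "\<psi> s = f (\<Phi> x s) + \<kappa> * ((a s - q) \<bullet> (a s - q))" for s
    have "\<psi> s \<le> \<psi> T"
    proof (rule DERIV_nonpos_imp_nonincreasing[of T s \<psi>])
      fix s' assume "T \<le> s'" "s' \<le> s"
      then have K': "\<Phi> x s' \<in> chart_dom c" "a s' \<in> cball q r" using IH[of s'] K_iff by (auto simp: a_def)
      have aE: "a s' \<in> E \<inter> cball q r" using K' chart_coord(2)[OF c K'(1)] by (simp add: a_def)
      define X where "X = local_field c (a s')"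
      have "((\<lambda>s. a s - q) has_derivative (\<lambda>h. h *\<^sub>R X)) (at s')"
        using flow_has_derivative[OF c K'(1)] unfolding has_vector_derivative_def a_def X_def
        by (auto intro!: derivative_eq_intros)
      from has_derivative_inner[OF this this]
      have "((\<lambda>s. (a s - q) \<bullet> (a s - q)) has_real_derivative 2 * ((a s' - q) \<bullet> X)) (at s')"
        unfolding has_field_derivative_def by (rule has_derivative_eq_rhs) (auto simp: inner_commute)
      moreover have "((\<lambda>s. f (\<Phi> x s)) has_real_derivative - local_metric c (a s') X X) (at s')"
        using f_flow_has_derivative[OF c K'(1)] by (simp add: a_def X_def)
      ultimately have "(\<psi> has_real_derivative - local_metric c (a s') X X + \<kappa> * (2 * ((a s' - q) \<bullet> X))) (at s')"
        unfolding \<psi>_def[abs_def] by (intro DERIV_add DERIV_cmult)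
      moreover have "- local_metric c (a s') X X + \<kappa> * (2 * ((a s' - q) \<bullet> X)) \<le> 0"
      proof -
        have "(a s' - q) \<bullet> X \<le> norm (a s' - q) * norm X" by (rule norm_cauchy_schwarz)
        then have "2 * \<kappa> * ((a s' - q) \<bullet> X) \<le> 2 * \<kappa> * (norm (a s' - q) * norm X)"
          using \<kappa> by (intro mult_left_mono) auto
        then show ?thesis using ineq[OF aE, folded X_def] by (simp add: algebra_simps)
      qed
      ultimately show "\<exists>y. (\<psi> has_real_derivative y) (at s') \<and> y \<le> 0" by blast
    qed (use s in auto)
    then have "f (\<Phi> x s) + \<kappa> * (norm (a s - q))\<^sup>2 \<le> f (\<Phi> x T) + \<kappa> * (norm (a T - q))\<^sup>2"
      by (simp add: \<psi>_def dot_square_norm)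
    also have "\<kappa> * (norm (a T - q))\<^sup>2 \<le> \<kappa> * (r / 2)\<^sup>2"
      using start(2) \<kappa> by (intro mult_left_mono power_mono) (auto simp: a_def dist_norm norm_minus_commute)
    also have "\<kappa> * (r / 2)\<^sup>2 \<le> \<kappa> * r\<^sup>2 / 2" using \<kappa> by (simp add: power_divide)
    finally have "\<kappa> * (norm (a s - q))\<^sup>2 < \<kappa> * r\<^sup>2"
      using stable_manifold_level[OF x, of s] start(3) by linarith
    then have "(norm (a s - q))\<^sup>2 < r\<^sup>2" using \<kappa> by simp
    then have "norm (a s - q) < r" by (rule power_less_imp_less_base) (use r in simp)
    moreover have "\<Phi> x s \<in> chart_dom c" using IH[of s] s K_iff by auto
    ultimately show "\<Phi> x s \<in> W" by (simp add: W_def a_def dist_norm norm_minus_commute)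
  qed (use t in auto)
  then show ?thesis using K_iff chart_coord(2)[OF c, of "\<Phi> x t"] by auto
qed

text \<open>
In a small coordinate ball around \<open>p\<close> the hyperbolic estimates hold for all pairs of points. They
provide the rate of contraction and, applied to \<open>p\<close> and one further point, also the inequality that
traps the orbits.
\<close>

lemma contraction_near_critical_point:
  assumes p: "critical_point E A f p"
  defines "c \<equiv> chart_at A p"
  obtains Nb B C \<gamma> where "open Nb" "p \<in> Nb" "0 \<le> B" "0 \<le> C" "0 < \<gamma>"
    "\<And>x T t. x \<in> stable_manifold \<Phi> p \<Longrightarrow> \<Phi> x T \<in> Nb \<Longrightarrow> T \<le> t \<Longrightarrow> \<Phi> x t \<in> chart_dom c"
    "\<And>x T t b. x \<in> stable_manifold \<Phi> p \<Longrightarrow> \<Phi> x T \<in> Nb \<Longrightarrow> T \<le> t \<Longrightarrow> b \<in> E \<Longrightarrow>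
       local_metric c (coord c (\<Phi> x t)) b b \<le> B * (norm b)\<^sup>2"
    "\<And>x x' T t. x \<in> stable_manifold \<Phi> p \<Longrightarrow> x' \<in> stable_manifold \<Phi> p \<Longrightarrow> \<Phi> x T \<in> Nb \<Longrightarrow> \<Phi> x' T \<in> Nb \<Longrightarrow> T \<le> t \<Longrightarrow>
       norm (coord c (\<Phi> x t) - coord c (\<Phi> x' t)) \<le>
         C * exp (- \<gamma> * (t - T)) * norm (coord c (\<Phi> x T) - coord c (\<Phi> x' T))"
proof -
  define q where "q = coord c p"
  have c: "c \<in> A" and pc: "p \<in> chart_dom c" using chart_at by (auto simp: c_def)
  have q: "q \<in> chart_image c" "q \<in> E" using chart_coord[OF c pc] by (auto simp: q_def)
  obtain r0 M l where r0: "r0 > 0" and sub: "E \<inter> cball q r0 \<subseteq> chart_image c" and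
    ge: "gradient_equation E (E \<inter> cball q r0) (local_df c) (local_metric c) (local_field c) M l"
    using local_gradient_equation[OF c q(1)] by blast
  interpret ge: gradient_equation E "E \<inter> cball q r0" "local_df c" "local_metric c" "local_field c" M l
    by (rule ge)
  have qS: "q \<in> E \<inter> cball q r0" using q r0 by simp
  have Xq: "local_field c q = 0"
  proof -
    have "l * (norm (local_field c q))\<^sup>2 \<le> - local_df c q (local_field c q)"
      using ge.coercive[OF qS ge.X_in[OF qS]] ge.equation[OF qS ge.X_in[OF qS]] by simp
    also have "\<dots> = 0" using critical_local_df[OF p ge.X_in[OF qS]] by (simp add: c_def q_def)
    finally show ?thesis using ge.l by (simp add: mult_le_0_iff)
  qed
  obtain H where H: "bounded_bilinear H" "\<And>u v. H u v = H v u"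
    "\<And>a. a \<in> E \<Longrightarrow> (\<And>b. b \<in> E \<Longrightarrow> H a b = 0) \<Longrightarrow> a = 0"
    "\<And>\<eta>. 0 < \<eta> \<Longrightarrow> \<exists>r>0. \<forall>a\<in>E \<inter> cball q r. \<forall>b\<in>E \<inter> cball q r. \<forall>v\<in>E.
       \<bar>local_df c a v - local_df c b v - H (a - b) v\<bar> \<le> \<eta> * norm (a - b) * norm v"
    using hessian_form[OF p] unfolding c_def q_def by blast
  obtain r m where r: "r > 0" "r \<le> r0" and m: "m > 0" and hyp: "\<And>a b. a \<in> E \<inter> cball q r \<Longrightarrow> b \<in> E \<inter> cball q r \<Longrightarrow>
      H (a - b) (local_field c a - local_field c b) \<le> - m * (norm (a - b))\<^sup>2 \<and>
      m * norm (a - b) \<le> norm (local_field c a - local_field c b)"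
    using ge.hyperbolic_estimates[OF H(1,3) qS Xq r0 order.refl H(4)] by blast
  have sub': "E \<inter> cball q r \<subseteq> E \<inter> cball q r0" using r by auto
  have sub_im: "E \<inter> cball q r \<subseteq> chart_image c" using sub sub' by blast
  \<comment> \<open>chosen so that \<open>m |y - q| \<le> |X y|\<close> and \<open>l |X y|\<^sup>2 \<le> g(X y, X y)\<close> give \<open>ineq\<close>\<close>
  define \<kappa> where "\<kappa> = l * m / 2"
  have \<kappa>: "\<kappa> > 0" using ge.l m by (simp add: \<kappa>_def)
  have ineq: "2 * \<kappa> * norm (y - q) * norm (local_field c y) \<le> local_metric c y (local_field c y) (local_field c y)"
    if y: "y \<in> E \<inter> cball q r" for y
  proof -
    have "m * norm (y - q) \<le> norm (local_field c y)" using hyp[OF y, of q] Xq q r by simp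
    then have "l * (m * norm (y - q)) * norm (local_field c y) \<le> l * norm (local_field c y) * norm (local_field c y)"
      using ge.l by (intro mult_right_mono mult_left_mono) auto
    also have "\<dots> \<le> local_metric c y (local_field c y) (local_field c y)"
      using ge.coercive[OF _ ge.X_in, of y y] y sub' by (auto simp: power2_eq_square mult.assoc)
    finally show ?thesis by (simp add: \<kappa>_def mult_ac)
  qed
  \<comment> \<open>the two conditions bound \<open>f + \<kappa> |y - q|\<^sup>2\<close> by less than \<open>f p + \<kappa> r\<^sup>2\<close>\<close>
  define Nb where "Nb = (chart_dom c \<inter> coord c -` ball q (r / 2)) \<inter> {x. f x < f p + \<kappa> * r\<^sup>2 / 2}"
  have "open Nb" unfolding Nb_def
    by (intro open_Int coordinate_ball_open[OF c] open_Collect_less continuous_f continuous_on_const)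
  have "p \<in> Nb" using pc r \<kappa> by (simp add: Nb_def q_def)
  have stay: "\<Phi> x t \<in> chart_dom c \<and> coord c (\<Phi> x t) \<in> E \<inter> cball q r"
    if "x \<in> stable_manifold \<Phi> p" "\<Phi> x T \<in> Nb" "T \<le> t" for x T t
    by (rule stable_orbit_trapped[OF c r(1) sub_im \<kappa> ineq that(1) _ _ _ that(3)]) (use that(2) in \<open>auto simp: Nb_def\<close>)
  have lim: "((\<lambda>t. coord c (\<Phi> x t)) \<longlongrightarrow> q) at_top" if "x \<in> stable_manifold \<Phi> p" for x
    unfolding q_def using that
    by (intro isCont_tendsto_compose[OF isCont_coord[OF c pc]]) (simp add: stable_manifold_def)
  obtain K where K: "K > 0" "\<And>u v. norm (H u v) \<le> norm u * norm v * K"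
    using bounded_bilinear.pos_bounded[OF H(1)] by blast
  define C where "C = sqrt (K * (ge.lip_const + 1) / m)"
  have C: "0 \<le> C" using K m ge.lip_const_nonneg by (simp add: C_def)
  have contr: "norm (coord c (\<Phi> x t) - coord c (\<Phi> x' t)) \<le>
         C * exp (- (m / K) * (t - T)) * norm (coord c (\<Phi> x T) - coord c (\<Phi> x' T))"
    if x: "x \<in> stable_manifold \<Phi> p" and x': "x' \<in> stable_manifold \<Phi> p" and Nb: "\<Phi> x T \<in> Nb" "\<Phi> x' T \<in> Nb" and t: "T \<le> t"
    for x x' T t
  proof -
    have "norm (coord c (\<Phi> x t) - coord c (\<Phi> x' t)) \<le>
      sqrt (K * (ge.lip_const + 1) / m) * norm (coord c (\<Phi> x T) - coord c (\<Phi> x' T)) * exp (- (m / K) * (t - T))"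
    proof (rule exponential_contraction[where H = H and w = "\<lambda>t. local_field c (coord c (\<Phi> x t)) - local_field c (coord c (\<Phi> x' t))"])
      show "((\<lambda>t. coord c (\<Phi> x t) - coord c (\<Phi> x' t)) \<longlongrightarrow> 0) at_top"
        using tendsto_diff[OF lim[OF x] lim[OF x']] by simp
      show "\<bar>H u v\<bar> \<le> K * norm u * norm v" for u v using K(2)[of u v] by (simp add: mult_ac)
      show "bounded_bilinear H" "\<And>u v. H u v = H v u" "0 < K" "0 < m" "0 \<le> ge.lip_const" "T \<le> t"
        using H K m ge.lip_const_nonneg t by auto
      fix s assume s: "T \<le> s"
      note S = stay[OF x Nb(1) s] stay[OF x' Nb(2) s]
      show "((\<lambda>t. coord c (\<Phi> x t) - coord c (\<Phi> x' t)) has_vector_derivative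
          local_field c (coord c (\<Phi> x s)) - local_field c (coord c (\<Phi> x' s))) (at s)"
        using S by (intro has_vector_derivative_diff flow_has_derivative c) auto
      show "norm (local_field c (coord c (\<Phi> x s)) - local_field c (coord c (\<Phi> x' s)))
          \<le> ge.lip_const * norm (coord c (\<Phi> x s) - coord c (\<Phi> x' s))"
        using S sub' by (intro ge.X_lipschitz) blast+
      show "H (coord c (\<Phi> x s) - coord c (\<Phi> x' s)) (local_field c (coord c (\<Phi> x s)) - local_field c (coord c (\<Phi> x' s)))
          \<le> - m * (norm (coord c (\<Phi> x s) - coord c (\<Phi> x' s)))\<^sup>2"
        using hyp S by blast
    qed
    then show ?thesis by (simp add: C_def mult_ac)
  qed
  have bound: "local_metric c (coord c (\<Phi> x t)) b b \<le> M * (norm b)\<^sup>2"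
    if "x \<in> stable_manifold \<Phi> p" "\<Phi> x T \<in> Nb" "T \<le> t" and b: "b \<in> E" for x T t b
  proof -
    have "coord c (\<Phi> x t) \<in> E \<inter> cball q r0" using stay[OF that(1-3)] sub' by blast
    from second_lip_bound[OF ge.G_lip[OF b b] this] show ?thesis by (simp add: power2_eq_square mult.assoc)
  qed
  show ?thesis
  proof (rule that[OF \<open>open Nb\<close> \<open>p \<in> Nb\<close> _ C _ _ bound contr])
    show "0 \<le> M" "0 < m / K" using ge.M m K by auto
  qed (use stay in blast)+
qed

section \<open>Decay of stable tangent vectors\<close>

text \<open>
The curve \<open>z s = \<iota> (y + s u)\<close> in the stable manifold has velocity \<open>v\<close>. Its image under the flow has
velocity \<open>b t\<close> in the chart at \<open>p\<close>, and the contraction of the distances between \<open>z s\<close> and \<open>x\<close>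
from a common time \<open>T\<close> on bounds \<open>b t\<close> in terms of \<open>b T\<close>.
\<close>

lemma stable_tangent_vector_decays:
  assumes p: "critical_point E A f p" and x: "x \<in> stable_manifold \<Phi> p"
    and v: "v \<in> stable_tangent_space E A g f \<Phi> p x"
  shows "\<exists>\<gamma>>0. (\<lambda>t. tangent_norm g (\<Phi> x t) (differential E A (\<lambda>z. \<Phi> z t) x v)) \<in> O[at_top](\<lambda>t. exp (- \<gamma> * t))"
proof -
  obtain V \<iota> y u where imm: "immersed_parametrization A V \<iota> (stable_manifold \<Phi> p)"
    and y: "y \<in> V" "\<iota> y = x" and u: "u \<in> V"
    and v_eq: "v = frechet_derivative (coord (chart_at A x) \<circ> \<iota>) (at y within V) u"
    using v by (auto simp: stable_tangent_space_def)
  have V: "subspace V" and im: "\<iota> ` V = stable_manifold \<Phi> p" and cont: "continuous_on V \<iota>"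
    and sm: "\<And>c. c \<in> A \<Longrightarrow> smooth_on {y \<in> V. \<iota> y \<in> chart_dom c} (coord c \<circ> \<iota>)"
    using imm by (auto simp: immersed_parametrization_def)
  let ?cx = "chart_at A x"
  define z where "z s = \<iota> (y + s *\<^sub>R u)" for s :: real
  have line: "y + s *\<^sub>R u \<in> V" for s by (intro subspace_add[OF V] subspace_scale[OF V] y u)
  have z: "z s \<in> stable_manifold \<Phi> p" for s using im line[of s] by (auto simp: z_def)
  have z0: "z 0 = x" by (simp add: z_def y)
  define S where "S = {y \<in> V. \<iota> y \<in> chart_dom ?cx}"
  have S: "openin (top_of_set V) S"
    using continuous_openin_preimage_gen[OF cont chart(1)[OF chart_at(1)[of x]]]
    by (simp add: S_def vimage_def Int_def)
  have yS: "y \<in> S" using y chart_at(2)[of x] by (simp add: S_def)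
  have der_\<iota>: "((coord ?cx \<circ> \<iota>) has_derivative frechet_derivative (coord ?cx \<circ> \<iota>) (at y within V)) (at y within V)"
    using smooth_on_has_derivative[OF sm[OF chart_at(1)[of x], folded S_def] S yS] .
  define \<zeta> where "\<zeta> s = coord ?cx (z s)" for s
  have d\<zeta>: "(\<zeta> has_vector_derivative v) (at 0)"
    using has_vector_derivative_compose_nhd[OF line_has_vector_derivative[of y u 0], of "coord ?cx \<circ> \<iota>" _ V UNIV]
      der_\<iota> line by (simp add: \<zeta>_def[abs_def] z_def v_eq)
  obtain N where N: "open N" "y \<in> N" "V \<inter> N \<subseteq> S" using openin_nhd[OF S yS] by metis
  define I where "I = (\<lambda>s::real. y + s *\<^sub>R u) -` N"
  have I: "open I" "0 \<in> I" unfolding I_def using N by (auto intro!: open_vimage continuous_intros)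
  have zI: "z s \<in> chart_dom ?cx" if "s \<in> I" for s
    using N(3) line[of s] that by (auto simp: I_def z_def S_def)
  have \<zeta>E: "\<zeta> s \<in> E" and z_eq: "chart_inv ?cx (\<zeta> s) = z s" if "s \<in> I" for s
    using chart_coord[OF chart_at(1) zI[OF that]] by (auto simp: \<zeta>_def)
  have \<zeta>0: "\<zeta> 0 = base x" by (simp add: \<zeta>_def base_def z0)
  have \<zeta>lim: "(\<zeta> \<longlongrightarrow> base x) (at 0)"
    using has_vector_derivative_continuous[OF d\<zeta>] by (simp add: continuous_within \<zeta>0)
  have evI: "\<forall>\<^sub>F s in at 0. s \<in> I" using eventually_at_in_open'[OF I] .
  have der: "((\<lambda>s. coord c (\<Phi> (z s) t)) has_vector_derivative
      frechet_derivative (coord c \<circ> (\<lambda>z. \<Phi> z t) \<circ> chart_inv ?cx) (at (base x) within E) v) (at 0)"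
    if t: "0 \<le> t" and c: "c \<in> A" "\<Phi> x t \<in> chart_dom c" for c t
  proof -
    let ?F = "coord c \<circ> (\<lambda>z. \<Phi> z t) \<circ> chart_inv ?cx"
    have "(?F has_derivative frechet_derivative ?F (at (base x) within E)) (at (\<zeta> 0) within E)"
      using flow_differentiable[OF t c] by (simp add: frechet_derivative_works \<zeta>0)
    from has_vector_derivative_compose_nhd[OF d\<zeta> this I \<zeta>E]
    have "((\<lambda>s. ?F (\<zeta> s)) has_vector_derivative frechet_derivative ?F (at (base x) within E) v) (at 0)" .
    then show ?thesis
      by (rule has_vector_derivative_transform_within_open[OF _ I]) (simp add: z_eq)
  qed
  \<comment> \<open>coordinates are meaningful only for points of the chart, so convergence of coordinates has to be turned into convergence in the manifold\<close>
  have cont_flow: "isCont (\<lambda>s. \<Phi> (z s) t) 0" if t: "0 \<le> t" for t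
  proof -
    define c where "c = chart_at A (\<Phi> x t)"
    have c: "c \<in> A" "\<Phi> x t \<in> chart_dom c" using chart_at by (auto simp: c_def)
    obtain \<rho> where \<rho>: "\<rho> > 0" and dom: "\<And>h. h \<in> E \<Longrightarrow> norm h < \<rho> \<Longrightarrow> \<Phi> (nearby x h) t \<in> chart_dom c"
      using second_order_flowE[OF second_order_flow_all[OF t c]] by metis
    have "\<forall>\<^sub>F s in at 0. dist (\<zeta> s) (base x) < \<rho>" using tendstoD[OF \<zeta>lim \<rho>] .
    with evI have ev: "\<forall>\<^sub>F s in at 0. \<Phi> (z s) t \<in> chart_dom c"
    proof eventually_elim
      case (elim s)
      have "\<zeta> s - base x \<in> E" by (intro subspace_diff[OF subspace_E] \<zeta>E elim base_in)
      then show ?case using dom[of "\<zeta> s - base x"] elim z_eq[OF elim(1)] by (simp add: dist_norm nearby_def)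
    qed
    have "((\<lambda>s. coord c (\<Phi> (z s) t)) \<longlongrightarrow> coord c (\<Phi> x t)) (at 0)"
      using has_vector_derivative_continuous[OF der[OF t c]] by (simp add: continuous_within z0)
    then have "((\<lambda>s. chart_inv c (coord c (\<Phi> (z s) t))) \<longlongrightarrow> chart_inv c (coord c (\<Phi> x t))) (at 0)"
      by (rule continuous_on_tendsto_compose[OF continuous_chart_inv[OF c(1)]])
        (use ev chart_coord(1)[OF c] in \<open>auto elim!: eventually_mono intro: chart_coord(1)[OF c(1)]\<close>)
    then have "((\<lambda>s. \<Phi> (z s) t) \<longlongrightarrow> \<Phi> x t) (at 0)"
      unfolding chart_coord(3)[OF c]
      by (rule Lim_transform_eventually) (use ev in \<open>auto elim!: eventually_mono simp: chart_coord(3)[OF c(1)]\<close>)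
    then show ?thesis by (simp add: isCont_def z0)
  qed
  define c where "c = chart_at A p"
  have c: "c \<in> A" by (simp add: c_def chart_at)
  obtain Nb B C \<gamma> where Nb: "open Nb" "p \<in> Nb" and B: "0 \<le> B" and C: "0 \<le> C" and \<gamma>: "0 < \<gamma>"
    and stay: "\<And>x T t. x \<in> stable_manifold \<Phi> p \<Longrightarrow> \<Phi> x T \<in> Nb \<Longrightarrow> T \<le> t \<Longrightarrow> \<Phi> x t \<in> chart_dom c"
    and bound: "\<And>x T t b. x \<in> stable_manifold \<Phi> p \<Longrightarrow> \<Phi> x T \<in> Nb \<Longrightarrow> T \<le> t \<Longrightarrow> b \<in> E \<Longrightarrow>
       local_metric c (coord c (\<Phi> x t)) b b \<le> B * (norm b)\<^sup>2"
    and contr: "\<And>x x' T t. x \<in> stable_manifold \<Phi> p \<Longrightarrow> x' \<in> stable_manifold \<Phi> p \<Longrightarrow> \<Phi> x T \<in> Nb \<Longrightarrow> \<Phi> x' T \<in> Nb \<Longrightarrow> T \<le> t \<Longrightarrow>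
       norm (coord c (\<Phi> x t) - coord c (\<Phi> x' t)) \<le>
         C * exp (- \<gamma> * (t - T)) * norm (coord c (\<Phi> x T) - coord c (\<Phi> x' T))"
    using contraction_near_critical_point[OF p, folded c_def] by blast
  have "\<forall>\<^sub>F t in at_top. \<Phi> x t \<in> Nb"
    using x Nb by (auto simp: stable_manifold_def dest: topological_tendstoD)
  then obtain T0 where T0: "\<And>t. T0 \<le> t \<Longrightarrow> \<Phi> x t \<in> Nb" by (auto simp: eventually_at_top_linorder)
  \<comment> \<open>the flow is known to be differentiable for non-negative times\<close>
  define T where "T = max 0 T0"
  have T: "0 \<le> T" "\<Phi> x T \<in> Nb" using T0 by (auto simp: T_def)
  have evO: "\<forall>\<^sub>F s in at 0. \<Phi> (z s) T \<in> Nb"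
    using topological_tendstoD[OF cont_flow[OF T(1), unfolded isCont_def] Nb(1)] T(2) by (simp add: z0)
  define b where "b t = frechet_derivative (coord c \<circ> (\<lambda>z. \<Phi> z t) \<circ> chart_inv ?cx) (at (base x) within E) v" for t
  have domc: "\<Phi> x t \<in> chart_dom c" if "T \<le> t" for t by (rule stay[OF x T(2) that])
  have db: "((\<lambda>s. coord c (\<Phi> (z s) t)) has_vector_derivative b t) (at 0)" if "T \<le> t" for t
    unfolding b_def using that T by (intro der c domc) auto
  have decay: "norm (b t) \<le> C * exp (- \<gamma> * (t - T)) * norm (b T)" if t: "T \<le> t" for t
  proof (rule vector_derivative_norm_le[OF db[OF t] db[OF order.refl]])
    show "\<forall>\<^sub>F s in at 0. norm (coord c (\<Phi> (z s) t) - coord c (\<Phi> (z 0) t))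
        \<le> C * exp (- \<gamma> * (t - T)) * norm (coord c (\<Phi> (z s) T) - coord c (\<Phi> (z 0) T))"
      using evO by eventually_elim (intro contr z t, use T z0 in auto)
  qed
  have norm_le: "tangent_norm g (\<Phi> x t) (differential E A (\<lambda>z. \<Phi> z t) x v) \<le> sqrt B * norm (b t)"
    and norm_ge: "0 \<le> tangent_norm g (\<Phi> x t) (differential E A (\<lambda>z. \<Phi> z t) x v)" if t: "T \<le> t" for t
  proof -
    have t0: "0 \<le> t" using t T by simp
    let ?ct = "chart_at A (\<Phi> x t)"
    obtain J where J: "open J" "0 \<in> J" "\<And>s. s \<in> J \<Longrightarrow> \<Phi> (z s) t \<in> chart_dom c"
      using isCont_open_nhd[OF cont_flow[OF t0] chart(1)[OF c]] domc[OF t] by (auto simp: z0)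
    have bE: "b t \<in> E"
      by (rule vector_derivative_in_subspace[OF subspace_E db[OF t] J(1,2)]) (rule chart_coord(2)[OF c J(3)])
    have "((coord ?ct \<circ> (\<lambda>s. \<Phi> (z s) t)) has_vector_derivative transition_deriv c ?ct (\<Phi> (z 0) t) (b t)) (at 0)"
      by (rule curve_chart_change[OF c chart_at(1) cont_flow[OF t0]])
        (use domc[OF t] chart_at(2) db[OF t] in \<open>auto simp: z0 comp_def\<close>)
    moreover have "((coord ?ct \<circ> (\<lambda>s. \<Phi> (z s) t)) has_vector_derivative differential E A (\<lambda>z. \<Phi> z t) x v) (at 0)"
      using der[OF t0 chart_at] by (simp add: differential_def comp_def base_def)
    \<comment> \<open>both sides are the velocity of the transported curve in the preferred chart at its end point\<close>
    ultimately have eq: "differential E A (\<lambda>z. \<Phi> z t) x v = transition_deriv c ?ct (\<Phi> x t) (b t)"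
      using vector_derivative_unique_at z0 by metis
    have tn: "tangent_norm g (\<Phi> x t) (differential E A (\<lambda>z. \<Phi> z t) x v) = sqrt (local_metric c (coord c (\<Phi> x t)) (b t) (b t))"
      unfolding tangent_norm_def eq local_metric_eq[OF c domc[OF t]] ..
    show "tangent_norm g (\<Phi> x t) (differential E A (\<lambda>z. \<Phi> z t) x v) \<le> sqrt B * norm (b t)"
      unfolding tn using bound[OF x T(2) t bE] real_sqrt_le_mono by (fastforce simp: real_sqrt_mult)
    show "0 \<le> tangent_norm g (\<Phi> x t) (differential E A (\<lambda>z. \<Phi> z t) x v)"
      unfolding tn using local_metric_nonneg[OF c chart_coord(1)[OF c domc[OF t]] bE] by simp
  qed
  have "(\<lambda>t. tangent_norm g (\<Phi> x t) (differential E A (\<lambda>z. \<Phi> z t) x v)) \<in> O[at_top](\<lambda>t. exp (- \<gamma> * t))"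
  proof (rule bigoI)
    show "\<forall>\<^sub>F t in at_top. norm (tangent_norm g (\<Phi> x t) (differential E A (\<lambda>z. \<Phi> z t) x v)) \<le>
       (sqrt B * C * exp (\<gamma> * T) * norm (b T)) * norm (exp (- \<gamma> * t))"
      using eventually_ge_at_top[of T]
    proof eventually_elim
      case (elim t)
      have "norm (tangent_norm g (\<Phi> x t) (differential E A (\<lambda>z. \<Phi> z t) x v)) \<le> sqrt B * norm (b t)"
        using norm_le[OF elim] norm_ge[OF elim] by simp
      also have "\<dots> \<le> sqrt B * (C * exp (- \<gamma> * (t - T)) * norm (b T))"
        using B by (intro mult_left_mono decay elim) auto
      also have "exp (- \<gamma> * (t - T)) = exp (\<gamma> * T) * exp (- \<gamma> * t)"
        by (simp add: exp_add[symmetric] algebra_simps)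
      finally show ?case by (simp add: mult_ac)
    qed
  qed
  then show ?thesis using \<gamma> by blast
qed

end

theorem theorem2p2:
  fixes E :: "'e::euclidean_space set"
    and A :: "('m::{t2_space, second_countable_topology}, 'e) chart set"
    and g :: "'m \<Rightarrow> 'e \<Rightarrow> 'e \<Rightarrow> real"
    and f :: "'m \<Rightarrow> real"
    and \<Phi> :: "'m \<Rightarrow> real \<Rightarrow> 'm"
    and p :: 'm
  assumes "smooth_manifold E A"
    and "connected (UNIV :: 'm set)"
    and "compact (UNIV :: 'm set)"
    and "riemannian_metric E A g"
    and "morse E A f"
    and "negative_gradient_flow E A g f \<Phi>"
    and "critical_point E A f p"
  shows "\<forall>x \<in> stable_manifold \<Phi> p. \<forall>v \<in> stable_tangent_space E A g f \<Phi> p x.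
    \<exists>c>0. (\<lambda>t. tangent_norm g (\<Phi> x t) (differential E A (\<lambda>z. \<Phi> z t) x v))
             \<in> O[at_top](\<lambda>t. exp (- c * t))"
proof -
  interpret gradient_system E A g f \<Phi>
    using assms by unfold_locales
  show ?thesis using stable_tangent_vector_decays[OF assms(7)] by blast
qed

end
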